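(* Fix $n\in\mathbb N$, $p\in\{1,2,\dots,n\}$ and $\alpha\in(0,1)$. Let $\Omega$ be a strictly $(p-1)$-convex bounded domain in $\mathbb R^n$ with $\partial\Omega$ smooth, let $\psi$ be a smooth function on $\partial\Omega$, and let $\tilde\varphi(x,t)$ be a positive continuous function in $\overline\Omega\times\mathbb R$ that is non-decreasing with respect to $t$. Then there exists $v\in C^\infty(\overline\Omega)$ satisfying $$\sigma_p^{1/p}\bigl(\lambda(D^2v(x))\bigr)\ge\tilde\varphi(x,v(x))\bigl(1+|Dv(x)|+|v(x)|^\alpha\bigr),\qquad\forall x\in\overline\Omega,$$ $$\lambda(D^2v(x))\in\Gamma_p,\quad\forall x\in\overline\Omega;\qquad v(x)=\psi(x),\quad\forall x\in\partial\Omega .$$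
   Context: For $\mu\in\mathbb R^m$ and $1\le q\le m$, $\sigma_q(\mu)=\sum_{1\le j_1<\dots<j_q\le m}\mu_{j_1}\cdots\mu_{j_q}$, and $\Gamma_q^{(m)}=\{\mu\in\mathbb R^m:\sigma_r(\mu)>0\ \forall r\in\{1,\dots,q\}\}$; $\Gamma_0^{(m)}=\mathbb R^m$; $\Gamma_p=\Gamma_p^{(n)}$. $Dv$ and $D^2v$ are the gradient and Hessian matrix of $v$; $\lambda(D^2v(x))\in\mathbb R^n$ is the vector of eigenvalues of $D^2v(x)$ in non-decreasing order. $\Omega$ is strictly $(p-1)$-convex if for every $x\in\partial\Omega$ the vector of the $n-1$ principal curvatures of $\partial\Omega$ at $x$ with respect to the inward normal lies in $\Gamma_{p-1}^{(n-1)}$. *)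

theory Defs
  imports "HOL-Analysis.Analysis"
begin

section \<open>Elementary symmetric functions and the cones \<open>\<Gamma>\<close>\<close>

text \<open>A vector of \<open>\<real>\<^sup>m\<close> is a list of length \<open>m\<close>, with entries indexed from 0; the dimension has to
  be a term here, because both \<open>n\<close> and \<open>n - 1\<close> occur.\<close>

definition elem_sym :: "nat \<Rightarrow> real list \<Rightarrow> real" where
  "elem_sym q \<mu> = (\<Sum>J\<in>{J. J \<subseteq> {..<length \<mu>} \<and> card J = q}. \<Prod>j\<in>J. \<mu> ! j)"

definition Gamma_cone :: "nat \<Rightarrow> nat \<Rightarrow> real list set" where
  "Gamma_cone m q = {\<mu>. length \<mu> = m \<and> (\<forall>r\<in>{1..q}. elem_sym r \<mu> > 0)}"


section \<open>Derivatives and smoothness\<close>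

definition partial_deriv :: "'n \<Rightarrow> (real ^ 'n \<Rightarrow> real) \<Rightarrow> real ^ 'n \<Rightarrow> real" where
  "partial_deriv i f x = frechet_derivative f (at x) (axis i 1)"

definition grad :: "(real ^ 'n \<Rightarrow> real) \<Rightarrow> real ^ 'n \<Rightarrow> real ^ 'n" where
  "grad f x = (\<chi> i. partial_deriv i f x)"

definition hessian :: "(real ^ 'n \<Rightarrow> real) \<Rightarrow> real ^ 'n \<Rightarrow> real ^ 'n ^ 'n" where
  "hessian f x = (\<chi> i j. partial_deriv i (partial_deriv j f) x)"

text \<open>To be used for open \<open>U\<close> only.\<close>

primrec Ck_on :: "nat \<Rightarrow> (real ^ 'n) set \<Rightarrow> (real ^ 'n \<Rightarrow> real) \<Rightarrow> bool" where
  "Ck_on 0 U f \<longleftrightarrow> continuous_on U f"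
| "Ck_on (Suc k) U f \<longleftrightarrow>
     (\<forall>x\<in>U. f differentiable (at x)) \<and> (\<forall>i. Ck_on k U (partial_deriv i f))"

text \<open>On a closed set \<open>S\<close>, such as the closure of a smooth domain or its boundary, the smooth
  functions are the restrictions to \<open>S\<close> of functions that are smooth near \<open>S\<close>. The predicate below
  says that \<open>f\<close> itself is smooth near \<open>S\<close>; its gradient and Hessian then make sense at all points
  of \<open>S\<close>, including boundary points.\<close>

definition smooth_near :: "(real ^ 'n) set \<Rightarrow> (real ^ 'n \<Rightarrow> real) \<Rightarrow> bool" where
  "smooth_near S f \<longleftrightarrow> (\<exists>U. open U \<and> S \<subseteq> U \<and> (\<forall>k. Ck_on k U f))"

definition smooth_restriction :: "(real ^ 'n) set \<Rightarrow> (real ^ 'n \<Rightarrow> real) \<Rightarrow> bool" where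
  "smooth_restriction S f \<longleftrightarrow> (\<exists>g. smooth_near S g \<and> (\<forall>x\<in>S. g x = f x))"


section \<open>Eigenvalues\<close>

text \<open>The roots of the characteristic polynomial, with multiplicity, in non-decreasing order. This
  is meaningful for matrices with only real eigenvalues, in particular for symmetric ones. Here
  \<open>mat t\<close> is \<open>t\<close> times the identity matrix.\<close>

definition eigenvals :: "real ^ 'n ^ 'n \<Rightarrow> real list" where
  "eigenvals A = (THE l. length l = CARD('n) \<and> sorted l \<and>
     (\<forall>t. det (mat t - A) = (\<Prod>i<CARD('n). t - l ! i)))"


section \<open>Smooth boundaries and principal curvatures\<close>

definition local_defining_function ::
    "(real ^ 'n) set \<Rightarrow> (real ^ 'n) set \<Rightarrow> (real ^ 'n \<Rightarrow> real) \<Rightarrow> bool" where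
  "local_defining_function \<Omega> U \<rho> \<longleftrightarrow>
     open U \<and> (\<forall>k. Ck_on k U \<rho>) \<and> (\<forall>y\<in>U. grad \<rho> y \<noteq> 0) \<and>
     \<Omega> \<inter> U = {y\<in>U. \<rho> y < 0} \<and> frontier \<Omega> \<inter> U = {y\<in>U. \<rho> y = 0}"

definition smooth_boundary :: "(real ^ 'n) set \<Rightarrow> bool" where
  "smooth_boundary \<Omega> \<longleftrightarrow>
     (\<forall>x\<in>frontier \<Omega>. \<exists>U \<rho>. x \<in> U \<and> local_defining_function \<Omega> U \<rho>)"

definition inward_normal :: "(real ^ 'n \<Rightarrow> real) \<Rightarrow> real ^ 'n \<Rightarrow> real ^ 'n" where
  "inward_normal \<rho> y = - (grad \<rho> y /\<^sub>R norm (grad \<rho> y))"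

text \<open>The principal curvatures are the eigenvalues, with multiplicity, of the shape operator
  \<open>X \<mapsto> - d\<nu>(X)\<close> on the tangent space, where \<open>\<nu>\<close> is the inward unit normal; \<open>e\<close> below is an
  orthonormal basis of principal directions. With this sign the sphere bounding a ball of radius
  \<open>R\<close> has all its principal curvatures equal to \<open>1 / R\<close>. The vector \<open>\<kappa>\<close> exists, and it is
  determined up to the order of its entries: the shape operator is self-adjoint and does not
  depend on \<open>\<rho>\<close>.\<close>

definition principal_curvatures :: "(real ^ 'n) set \<Rightarrow> real ^ 'n \<Rightarrow> real list \<Rightarrow> bool" where
  "principal_curvatures \<Omega> x \<kappa> \<longleftrightarrow> length \<kappa> = CARD('n) - 1 \<and>
     (\<exists>U \<rho> e. x \<in> U \<and> local_defining_function \<Omega> U \<rho> \<and>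
        (\<forall>i<CARD('n) - 1. e i \<bullet> inward_normal \<rho> x = 0) \<and>
        (\<forall>i<CARD('n) - 1. \<forall>j<CARD('n) - 1. e i \<bullet> e j = (if i = j then 1 else 0)) \<and>
        (\<forall>i<CARD('n) - 1.
           - frechet_derivative (inward_normal \<rho>) (at x) (e i) = (\<kappa> ! i) *\<^sub>R e i))"

definition strictly_convex_order :: "nat \<Rightarrow> (real ^ 'n) set \<Rightarrow> bool" where
  "strictly_convex_order q \<Omega> \<longleftrightarrow>
     (\<forall>x\<in>frontier \<Omega>. \<exists>\<kappa>. principal_curvatures \<Omega> x \<kappa> \<and> \<kappa> \<in> Gamma_cone (CARD('n) - 1) q)"

end

theory Submission
  imports Defs "HOL-Computational_Algebra.Fundamental_Theorem_Algebra" "HOL-Real_Asymp.Real_Asymp"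
begin

text \<open>
  The function \<open>v\<close> is built explicitly. Write
  \<open>D\<^sup>2f \<in> \<Gamma>\<close> for \<open>\<lambda>(D\<^sup>2f) \<in> \<Gamma>\<^sub>p\<close>.

  It suffices to find one smooth \<open>\<eta> \<le> 0\<close> on the closure of \<open>\<Omega>\<close> that vanishes on the boundary and satisfies
  \<open>D\<^sup>2\<eta> - I / 2 \<in> \<Gamma>\<close>. Let \<open>\<Psi>\<close> be a smooth extension of \<open>\<psi>\<close> and put
  \<open>v = \<Psi> + M (exp (B \<eta>) - 1)\<close>, with the abbreviation \<open>h = M B exp (B \<eta>)\<close>. Then
  \<open>D\<^sup>2v = D\<^sup>2\<Psi> + h (D\<^sup>2\<eta> + B D\<eta> \<otimes> D\<eta>)\<close>. The rank one term makes \<open>\<sigma>\<^sub>p (D\<^sup>2v) / h\<^sup>p\<close> grow at least like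
  \<open>const + const B |D\<eta>|\<^sup>2\<close>, so a large \<open>B\<close> makes its \<open>p\<close>-th root beat any multiple of \<open>|D\<eta>|\<close>, that is,
  of the main part of \<open>|Dv| / h\<close>. After \<open>B\<close> is fixed, \<open>h\<close> is of order \<open>M\<close> and \<open>|v|\<close> is at most of order \<open>M\<close>;
  since \<open>\<alpha> < 1\<close>, a large \<open>M\<close> absorbs \<open>|v|\<^sup>\<alpha>\<close>, \<open>D\<Psi>\<close> and \<open>D\<^sup>2\<Psi>\<close>. As \<open>\<eta> \<le> 0\<close>, the values of \<open>v\<close> are
  bounded above independently of \<open>M\<close> and \<open>B\<close>, and the monotonicity of \<open>\<phi>\<close> turns this into an upper
  bound for \<open>\<phi> x (v x)\<close>.

  For \<open>\<eta>\<close>, take a function \<open>\<rho>\<close> that is negative in \<open>\<Omega>\<close>, zero on the boundary and has nonzero gradient there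
  (\<open>global_defining_function\<close>: local defining functions, glued with bump functions). Strict
  \<open>(p - 1)\<close>-convexity says that the tangential part of \<open>D\<^sup>2\<rho>\<close> lies in \<open>\<Gamma>\<^sub>p\<^sub>-\<^sub>1\<close>, so
  \<open>D\<^sup>2\<rho> + A D\<rho> \<otimes> D\<rho> \<in> \<Gamma>\<close> near the boundary for large \<open>A\<close> (\<open>Gamma_form_near_frontier\<close>). Compose \<open>\<rho>\<close> with
  \<open>exp (- 1 / (t + \<delta>))\<close>, extended by \<open>0\<close> to \<open>t \<le> - \<delta>\<close>: the second derivative of this function exceeds
  \<open>A\<close> times the first one when \<open>\<delta>\<close> is small, so the result has its Hessian in the closure of \<open>\<Gamma>\<close>
  on the closure of \<open>\<Omega>\<close> and a large one near the boundary. Adding a quadratic function that is cut off near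
  the boundary gives \<open>\<eta>\<close> (\<open>Gamma_subharmonic_exists\<close>).

  The algebra behind these steps is monotonicity: a symmetric matrix whose quadratic form dominates a
  diagonal form with coefficients in \<open>\<Gamma>\<^sub>p\<close> has its eigenvalues in \<open>\<Gamma>\<^sub>p\<close>
  (\<open>eigenvals_of_form_lower_bound\<close>). It follows from Weyl's monotonicity of eigenvalues and the
  monotonicity of \<open>\<sigma>\<^sub>k\<close> in each entry on \<open>\<Gamma>\<^sub>k\<close>, and the latter from Newton's inequality.
\<close>

section \<open>Elementary symmetric functions as coefficients\<close>

lemma elem_sym_0 [simp]: "elem_sym 0 \<mu> = 1"
proof -
  have "{J. J \<subseteq> {..<length \<mu>} \<and> card J = 0} = {{}}"
    by (auto simp: card_eq_0_iff dest: finite_subset)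
  then show ?thesis by (simp add: elem_sym_def)
qed

lemma elem_sym_Suc_Nil [simp]: "elem_sym (Suc k) [] = 0"
proof -
  have "{J. J \<subseteq> {..<length []} \<and> card J = Suc k} = {}" by auto
  then show ?thesis unfolding elem_sym_def by (metis sum.empty)
qed

text \<open>The subsets of size \<open>k + 1\<close> are split according to whether they contain the last index.\<close>
lemma elem_sym_snoc:
  "elem_sym (Suc k) (\<mu> @ [a]) = elem_sym (Suc k) \<mu> + a * elem_sym k \<mu>"
proof -
  let ?n = "length \<mu>"
  let ?A = "\<lambda>k. {J. J \<subseteq> {..<?n} \<and> card J = k}"
  have fin: "finite (?A k)" for k by (rule finite_subset[of _ "Pow {..<?n}"]) auto
  have finJ: "finite J" if "J \<subseteq> {..<?n}" for J using that finite_subset by blast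
  have split: "{J. J \<subseteq> {..<length (\<mu> @ [a])} \<and> card J = Suc k} = ?A (Suc k) \<union> insert ?n ` ?A k"
    (is "?L = ?R")
  proof
    show "?L \<subseteq> ?R"
    proof
      fix J assume J: "J \<in> ?L"
      then have fJ: "finite J" by (auto dest: finite_subset)
      show "J \<in> ?R"
      proof (cases "?n \<in> J")
        case True
        have "J = insert ?n (J - {?n})" using True by auto
        moreover have "J - {?n} \<in> ?A k" using J True fJ by (auto simp: less_Suc_eq)
        ultimately show ?thesis by blast
      next
        case False
        then have "J \<subseteq> {..<?n}" using J by (auto simp: less_Suc_eq)
        then show ?thesis using J by auto
      qed
    qed
    show "?R \<subseteq> ?L"
    proof
      fix J assume "J \<in> ?R"
      then consider "J \<in> ?A (Suc k)" | K where "K \<in> ?A k" "J = insert ?n K" by auto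
      then show "J \<in> ?L"
      proof cases
        case 2
        then have "?n \<notin> K" "finite K" using finJ by auto
        with 2 show ?thesis by auto
      qed auto
    qed
  qed
  have inj: "inj_on (insert ?n) (?A k)"
  proof (rule inj_onI)
    fix J K assume "J \<in> ?A k" "K \<in> ?A k" and eq: "insert ?n J = insert ?n K"
    then have "?n \<notin> J" "?n \<notin> K" by auto
    with eq show "J = K" by (metis Diff_insert_absorb)
  qed
  have disj: "?A (Suc k) \<inter> insert ?n ` ?A k = {}" by auto
  have "elem_sym (Suc k) (\<mu> @ [a])
      = (\<Sum>J\<in>?A (Suc k). \<Prod>j\<in>J. (\<mu> @ [a]) ! j) + (\<Sum>J\<in>insert ?n ` ?A k. \<Prod>j\<in>J. (\<mu> @ [a]) ! j)"
    unfolding elem_sym_def split by (rule sum.union_disjoint) (use fin disj in auto)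
  also have "(\<Sum>J\<in>?A (Suc k). \<Prod>j\<in>J. (\<mu> @ [a]) ! j) = elem_sym (Suc k) \<mu>"
    unfolding elem_sym_def by (intro sum.cong prod.cong) (auto simp: nth_append)
  also have "(\<Sum>J\<in>insert ?n ` ?A k. \<Prod>j\<in>J. (\<mu> @ [a]) ! j)
      = (\<Sum>J\<in>?A k. \<Prod>j\<in>insert ?n J. (\<mu> @ [a]) ! j)"
    by (subst sum.reindex[OF inj]) simp
  also have "\<dots> = (\<Sum>J\<in>?A k. a * (\<Prod>j\<in>J. \<mu> ! j))"
  proof (rule sum.cong[OF refl])
    fix J assume J: "J \<in> ?A k"
    then have "?n \<notin> J" "finite J" using finJ by auto
    then have "(\<Prod>j\<in>insert ?n J. (\<mu> @ [a]) ! j) = a * (\<Prod>j\<in>J. (\<mu> @ [a]) ! j)" by simp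
    also have "(\<Prod>j\<in>J. (\<mu> @ [a]) ! j) = (\<Prod>j\<in>J. \<mu> ! j)"
      using J by (intro prod.cong) (auto simp: nth_append)
    finally show "(\<Prod>j\<in>insert ?n J. (\<mu> @ [a]) ! j) = a * (\<Prod>j\<in>J. \<mu> ! j)" .
  qed
  also have "\<dots> = a * elem_sym k \<mu>" by (simp add: elem_sym_def sum_distrib_left)
  finally show ?thesis .
qed

text \<open>The sign is chosen so that the coefficients are the elementary symmetric functions themselves;
  the roots are the negatives of the entries.\<close>
definition root_poly :: "real list \<Rightarrow> real poly" where
  "root_poly \<mu> = (\<Prod>a\<leftarrow>\<mu>. [:a, 1:])"

lemma root_poly_simps [simp]:
  "root_poly [] = 1" "root_poly (a # \<mu>) = [:a, 1:] * root_poly \<mu>"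
  "root_poly (\<mu> @ \<mu>') = root_poly \<mu> * root_poly \<mu>'"
  by (simp_all add: root_poly_def)

lemma elem_sym_gt_length: "length \<mu> < k \<Longrightarrow> elem_sym k \<mu> = 0"
proof (induction \<mu> arbitrary: k rule: rev_induct)
  case Nil then show ?case by (cases k) auto
next
  case (snoc a \<mu>)
  then obtain j where "k = Suc j" by (cases k) auto
  with snoc show ?case by (simp add: elem_sym_snoc)
qed

lemma degree_root_poly: "degree (root_poly \<mu>) \<le> length \<mu>"
proof (induction \<mu>)
  case (Cons a \<mu>)
  have "degree ([:a, 1:] * root_poly \<mu>) \<le> degree [:a, 1:] + degree (root_poly \<mu>)"
    by (rule degree_mult_le)
  with Cons show ?case by simp
qed simp

lemma root_poly_neq_0 [simp]: "root_poly \<mu> \<noteq> 0"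
  by (induction \<mu>) (simp_all only: root_poly_simps mult_eq_0_iff, auto)

lemma coeff_root_poly: "k \<le> length \<mu> \<Longrightarrow> coeff (root_poly \<mu>) (length \<mu> - k) = elem_sym k \<mu>"
proof (induction \<mu> arbitrary: k rule: rev_induct)
  case Nil then show ?case by simp
next
  case (snoc a \<mu>)
  have eq: "root_poly (\<mu> @ [a]) = smult a (root_poly \<mu>) + pCons 0 (root_poly \<mu>)"
    by (simp add: mult.commute[of "root_poly \<mu>"])
  show ?case
  proof (cases k)
    case 0
    have "coeff (root_poly \<mu>) (Suc (length \<mu>)) = 0"
      using degree_root_poly[of \<mu>] by (intro coeff_eq_0) simp
    then show ?thesis using 0 snoc.IH[of 0] by (simp add: eq)
  next
    case (Suc j)
    show ?thesis
    proof (cases "Suc j \<le> length \<mu>")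
      case True
      then have "length \<mu> - j = Suc (length \<mu> - Suc j)" by simp
      then show ?thesis using Suc True snoc.IH[of j] snoc.IH[of "Suc j"]
        by (simp add: eq elem_sym_snoc)
    next
      case False
      then have "j = length \<mu>" using snoc.prems Suc by simp
      then show ?thesis using Suc snoc.IH[of j]
        by (simp add: eq elem_sym_snoc elem_sym_gt_length)
    qed
  qed
qed

text \<open>The polynomial with these roots does not see the order of the entries.\<close>
lemma elem_sym_mset_cong:
  assumes "mset \<mu> = mset \<mu>'" shows "elem_sym k \<mu> = elem_sym k \<mu>'"
proof -
  have "root_poly \<mu> = prod_mset (image_mset (\<lambda>a. [:a, 1:]) (mset \<mu>))" for \<mu>
    by (simp add: root_poly_def prod_mset_prod_list[symmetric])
  then have "root_poly \<mu> = root_poly \<mu>'" using assms by simp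
  moreover have "length \<mu> = length \<mu>'" using assms mset_eq_length by blast
  ultimately show ?thesis
    by (metis coeff_root_poly elem_sym_gt_length not_le)
qed

lemma elem_sym_Cons:
  "elem_sym (Suc k) (a # \<mu>) = elem_sym (Suc k) \<mu> + a * elem_sym k \<mu>"
  using elem_sym_mset_cong[of "a # \<mu>" "\<mu> @ [a]"] by (simp add: elem_sym_snoc)

lemma elem_sym_1: "elem_sym (Suc 0) \<mu> = sum_list \<mu>"
  by (induction \<mu>) (auto simp: elem_sym_Cons)

section \<open>Newton's inequality\<close>

text \<open>Splitting into real linear factors, with constants (including \<open>0\<close>) allowed.\<close>
definition real_rooted :: "real poly \<Rightarrow> bool" where
  "real_rooted p \<longleftrightarrow> (\<exists>c \<mu>. p = smult c (root_poly \<mu>))"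

abbreviation cpoly :: "real poly \<Rightarrow> complex poly" where
  "cpoly \<equiv> map_poly of_real"

lemma cpoly_mult: "cpoly (p * q) = cpoly p * cpoly q"
  by (rule poly_eqI) (simp add: coeff_map_poly coeff_mult)

lemma cpoly_smult: "cpoly (smult c p) = smult (of_real c) (cpoly p)"
  by (rule poly_eqI) (simp add: coeff_map_poly)

lemma poly_cpoly_of_real: "poly (cpoly p) (of_real x) = of_real (poly p x)"
  by (induction p) (auto simp: map_poly_pCons)

text \<open>The fundamental theorem of algebra provides a root, which is real by hypothesis and can be
  divided out.\<close>
lemma real_rootedI:
  assumes "\<And>z. poly (cpoly p) z = 0 \<Longrightarrow> Im z = 0"
  shows "real_rooted p"
  using assms
proof (induction "degree p" arbitrary: p)
  case 0
  then obtain c where "p = [:c:]" by (metis degree_eq_zeroE)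
  then have "p = smult c (root_poly [])" by simp
  then show ?case unfolding real_rooted_def by blast
next
  case (Suc d)
  have "degree (cpoly p) = Suc d" using Suc by (simp add: degree_map_poly)
  then have "\<not> constant (poly (cpoly p))" by (simp add: constant_degree)
  then obtain z where z: "poly (cpoly p) z = 0" using fundamental_theorem_of_algebra by blast
  with Suc.prems have "Im z = 0" by blast
  then have "z = of_real (Re z)" by (simp add: complex_eq_iff)
  then have "poly p (Re z) = 0" using z poly_cpoly_of_real[of p "Re z"] by simp
  then obtain q where q: "p = [:- Re z, 1:] * q" by (auto simp: poly_eq_0_iff_dvd elim: dvdE)
  have "q \<noteq> 0" using Suc.hyps q by auto
  then have "degree p = 1 + degree q" unfolding q by (subst degree_mult_eq) auto
  then have "degree q = d" using Suc.hyps by simp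
  moreover have "Im w = 0" if "poly (cpoly q) w = 0" for w
    using that Suc.prems[of w] unfolding q cpoly_mult by simp
  ultimately have "real_rooted q" using Suc.hyps by blast
  then obtain c \<mu> where "q = smult c (root_poly \<mu>)" unfolding real_rooted_def by blast
  then have "p = smult c (root_poly (- Re z # \<mu>))" using q by simp
  then show ?case unfolding real_rooted_def by blast
qed

text \<open>The logarithmic derivative is the sum of the terms \<open>1 / (z + a)\<close>, and each of them has an imaginary part
  of sign opposite to that of \<open>z\<close>. In particular the derivative has no root off the real line.\<close>
lemma Im_logderiv_neg:
  assumes "Im z \<noteq> 0"
  shows "poly (cpoly (root_poly \<mu>)) z \<noteq> 0 \<and>
    (Im (poly (pderiv (cpoly (root_poly \<mu>))) z / poly (cpoly (root_poly \<mu>)) z) * Im z < 0 \<or> \<mu> = [])"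
proof (induction \<mu>)
  case Nil
  then show ?case by simp
next
  case (Cons a \<mu>)
  let ?P = "cpoly (root_poly \<mu>)"
  let ?L = "\<lambda>\<mu>. Im (poly (pderiv (cpoly (root_poly \<mu>))) z / poly (cpoly (root_poly \<mu>)) z)"
  define w where "w = z + of_real a"
  have w: "w \<noteq> 0" "Im w = Im z" using assms by (auto simp: w_def complex_eq_iff)
  have P0: "poly ?P z \<noteq> 0" using Cons by simp
  have eq: "cpoly (root_poly (a # \<mu>)) = [:of_real a, 1:] * ?P"
    by (simp only: root_poly_simps cpoly_mult) (simp add: map_poly_pCons)
  have val: "poly (cpoly (root_poly (a # \<mu>))) z = w * poly ?P z"
    unfolding eq by (simp add: w_def algebra_simps)
  have der: "poly (pderiv (cpoly (root_poly (a # \<mu>)))) z = poly ?P z + w * poly (pderiv ?P) z"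
    unfolding eq pderiv_mult by (simp add: w_def pderiv_pCons algebra_simps)
  have "(poly ?P z + w * poly (pderiv ?P) z) / (w * poly ?P z)
      = 1 / w + poly (pderiv ?P) z / poly ?P z"
    using w P0 by (simp add: field_simps)
  then have L: "?L (a # \<mu>) = Im (1 / w) + ?L \<mu>" unfolding val der by simp
  have "Im (1 / w) * Im z = - ((Im z)\<^sup>2 / ((Re w)\<^sup>2 + (Im w)\<^sup>2))"
    using w by (simp add: Im_divide power2_eq_square)
  moreover have "(Im z)\<^sup>2 / ((Re w)\<^sup>2 + (Im w)\<^sup>2) > 0"
    using assms w by (intro divide_pos_pos) (auto simp: sum_power2_gt_zero_iff)
  ultimately have "Im (1 / w) * Im z < 0" by linarith
  moreover have "?L \<mu> * Im z \<le> 0" using Cons by auto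
  ultimately have "?L (a # \<mu>) * Im z < 0" unfolding L by (simp add: distrib_right)
  then show ?case using val w P0 by simp
qed

lemma pderiv_cpoly: "pderiv (cpoly p) = cpoly (pderiv p)"
  by (rule poly_eqI) (simp add: coeff_map_poly coeff_pderiv)

lemma real_rooted_pderiv:
  assumes "real_rooted p" "pderiv p \<noteq> 0"
  shows "real_rooted (pderiv p)"
proof (rule real_rootedI)
  fix z assume z: "poly (cpoly (pderiv p)) z = 0"
  obtain c \<mu> where p: "p = smult c (root_poly \<mu>)" using assms unfolding real_rooted_def by blast
  have c: "c \<noteq> 0" and \<mu>: "\<mu> \<noteq> []" using assms(2) p by auto
  show "Im z = 0"
  proof (rule ccontr)
    assume "Im z \<noteq> 0"
    from Im_logderiv_neg[OF this, of \<mu>] \<mu>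
    have "poly (pderiv (cpoly (root_poly \<mu>))) z \<noteq> 0" by auto
    moreover have "cpoly (pderiv p) = smult (of_real c) (pderiv (cpoly (root_poly \<mu>)))"
      by (simp add: p pderiv_smult pderiv_cpoly cpoly_smult)
    ultimately show False using z c by simp
  qed
qed

lemma real_rooted_higher_pderiv: "real_rooted p \<Longrightarrow> real_rooted ((pderiv ^^ m) p)"
proof (induction m)
  case (Suc m)
  show ?case
  proof (cases "pderiv ((pderiv ^^ m) p) = 0")
    case True
    then have "(pderiv ^^ Suc m) p = smult 0 (root_poly [])" by simp
    then show ?thesis unfolding real_rooted_def by blast
  next
    case False
    then show ?thesis using Suc real_rooted_pderiv by simp
  qed
qed simp

text \<open>Equivalent to saying that the logarithmic derivative is decreasing. A new linear factor \<open>x + a\<close>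
  multiplies the difference of the two sides by \<open>(x + a)\<^sup>2\<close> and adds the square of the old polynomial.\<close>
lemma Laguerre_root_poly:
  "poly (root_poly \<mu>) x * poly (pderiv (pderiv (root_poly \<mu>))) x \<le> (poly (pderiv (root_poly \<mu>)) x)\<^sup>2"
proof (induction \<mu>)
  case Nil
  then show ?case by simp
next
  case (Cons a \<mu>)
  let ?q = "poly (root_poly \<mu>) x" and ?q1 = "poly (pderiv (root_poly \<mu>)) x"
    and ?q2 = "poly (pderiv (pderiv (root_poly \<mu>))) x"
  have eq: "poly (root_poly (a # \<mu>)) x = (x + a) * ?q"
    "poly (pderiv (root_poly (a # \<mu>))) x = ?q + (x + a) * ?q1"
    "poly (pderiv (pderiv (root_poly (a # \<mu>)))) x = 2 * ?q1 + (x + a) * ?q2"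
    by (simp_all add: pderiv_mult pderiv_add pderiv_smult pderiv_pCons algebra_simps)
  have "0 \<le> ?q\<^sup>2 + (x + a)\<^sup>2 * (?q1\<^sup>2 - ?q * ?q2)" using Cons by simp
  also have "\<dots> = (?q + (x + a) * ?q1)\<^sup>2 - (x + a) * ?q * (2 * ?q1 + (x + a) * ?q2)"
    by (simp add: power2_eq_square algebra_simps)
  finally show ?case unfolding eq by simp
qed

lemma Laguerre:
  assumes "real_rooted p"
  shows "poly p x * poly (pderiv (pderiv p)) x \<le> (poly (pderiv p) x)\<^sup>2"
proof -
  obtain c \<mu> where p: "p = smult c (root_poly \<mu>)" using assms unfolding real_rooted_def by blast
  show ?thesis using mult_left_mono[OF Laguerre_root_poly[of \<mu> x], of "c\<^sup>2"]
    by (simp add: p pderiv_smult power2_eq_square algebra_simps)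
qed

text \<open>Laguerre's inequality at \<open>0\<close> for the \<open>m\<close>-th derivative, which is again real-rooted. It gives the stronger
  constant \<open>(m + 1) / (m + 2)\<close>, which is then dropped.\<close>
lemma real_rooted_coeff_ineq:
  assumes "real_rooted p"
  shows "coeff p m * coeff p (m + 2) \<le> (coeff p (m + 1))\<^sup>2"
proof -
  let ?q = "(pderiv ^^ m) p"
  let ?F = "(fact m)\<^sup>2 :: real"
  have q: "coeff ?q j = pochhammer (of_nat (Suc j)) m * coeff p (j + m)" for j
    by (simp add: coeff_higher_pderiv add.commute)
  have p0: "pochhammer (1::real) m = fact m" by (simp add: pochhammer_fact)
  have p1: "pochhammer (2::real) m = (m + 1) * fact m"
    using pochhammer_rec[of "1::real" m] pochhammer_fact[of "Suc m", where 'a=real] by (simp add: algebra_simps)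
  have p2: "2 * pochhammer (3::real) m = (m + 2) * (m + 1) * fact m"
    using pochhammer_rec[of "2::real" "m"] pochhammer_rec[of "1::real" "Suc m"]
      pochhammer_fact[of "Suc (Suc m)", where 'a=real] by (simp add: algebra_simps)
  have "poly ?q 0 * poly (pderiv (pderiv ?q)) 0 \<le> (poly (pderiv ?q) 0)\<^sup>2"
    by (rule Laguerre[OF real_rooted_higher_pderiv[OF assms]])
  then have "coeff ?q 0 * (2 * coeff ?q 2) \<le> (coeff ?q 1)\<^sup>2"
    by (simp add: poly_0_coeff_0 coeff_pderiv numeral_2_eq_2)
  then have "fact m * coeff p m * ((2 * pochhammer 3 m) * coeff p (m + 2)) \<le> ((m + 1) * fact m * coeff p (m + 1))\<^sup>2"
    unfolding q using p0 p1 by (simp add: algebra_simps)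
  then have "((m + 1) * ?F) * ((m + 2) * (coeff p m * coeff p (m + 2)))
      \<le> ((m + 1) * ?F) * ((m + 1) * (coeff p (m + 1))\<^sup>2)"
    unfolding p2 by (simp add: power2_eq_square algebra_simps)
  moreover have "(m + 1) * ?F > 0" by (simp add: add_pos_nonneg)
  ultimately have *: "(m + 2) * (coeff p m * coeff p (m + 2)) \<le> (m + 1) * (coeff p (m + 1))\<^sup>2"
    by (simp only: mult_le_cancel_left_pos)
  show ?thesis
  proof (rule ccontr)
    assume n: "\<not> ?thesis"
    then have "(m + 2) * (coeff p (m + 1))\<^sup>2 < (m + 2) * (coeff p m * coeff p (m + 2))" by simp
    with * have "(m + 2) * (coeff p (m + 1))\<^sup>2 < (m + 1) * (coeff p (m + 1))\<^sup>2" by linarith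
    then show False by (simp add: mult_less_cancel_right)
  qed
qed

lemma Newton_ineq: "elem_sym k \<mu> * elem_sym (k + 2) \<mu> \<le> (elem_sym (k + 1) \<mu>)\<^sup>2"
proof (cases "k + 2 \<le> length \<mu>")
  case True
  then obtain m where m: "length \<mu> = m + (k + 2)" by (metis le_Suc_ex add.commute)
  have "real_rooted (root_poly \<mu>)" unfolding real_rooted_def by (metis smult_1_left)
  from real_rooted_coeff_ineq[OF this, of m] show ?thesis
    using coeff_root_poly[of k \<mu>] coeff_root_poly[of "k + 1" \<mu>] coeff_root_poly[of "k + 2" \<mu>]
    by (simp add: m mult.commute)
next
  case False
  then show ?thesis by (simp add: elem_sym_gt_length)
qed

section \<open>Monotonicity on the Garding cone\<close>

text \<open>Membership in \<open>\<Gamma>\<^sub>k\<close> without fixing the length; the index \<open>0\<close> may be included because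
  \<open>\<sigma>\<^sub>0 = 1\<close>, and including it makes inductions on \<open>k\<close> uniform.\<close>
definition in_cone :: "nat \<Rightarrow> real list \<Rightarrow> bool" where
  "in_cone k \<mu> \<longleftrightarrow> (\<forall>r\<le>k. elem_sym r \<mu> > 0)"

lemma Gamma_cone_iff: "\<mu> \<in> Gamma_cone m q \<longleftrightarrow> length \<mu> = m \<and> in_cone q \<mu>"
proof -
  have "(\<forall>r\<in>{1..q}. elem_sym r \<mu> > 0) \<longleftrightarrow> (\<forall>r\<le>q. elem_sym r \<mu> > 0)"
    using elem_sym_0[of \<mu>] by (metis One_nat_def Suc_leI atLeastAtMost_iff neq0_conv zero_less_one)
  then show ?thesis by (simp add: Gamma_cone_def in_cone_def)
qed

lemma in_cone_mono: "in_cone k \<mu> \<Longrightarrow> j \<le> k \<Longrightarrow> in_cone j \<mu>"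
  by (simp add: in_cone_def)

text \<open>In other words, on the cone the functions up to \<open>\<sigma>\<^sub>k\<^sub>+\<^sub>1\<close> have positive partial derivatives. By
  induction only \<open>\<sigma>\<^sub>k (\<mu>) \<le> 0\<close> has to be excluded, and in that case the positivity of \<open>\<sigma>\<^sub>k\<close> and
  \<open>\<sigma>\<^sub>k\<^sub>+\<^sub>1\<close> of the longer list contradicts Newton's inequality for \<open>\<mu>\<close>.\<close>
lemma in_cone_remove: "in_cone (Suc k) (a # \<mu>) \<Longrightarrow> in_cone k \<mu>"
proof (induction k)
  case 0
  then show ?case by (simp add: in_cone_def)
next
  case (Suc k)
  let ?e = "\<lambda>j. elem_sym j \<mu>"
  have IH: "in_cone k \<mu>" using Suc.IH Suc.prems in_cone_mono by auto
  have "?e (Suc k) > 0"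
  proof (rule ccontr)
    assume "\<not> ?e (Suc k) > 0"
    then have le: "?e (Suc k) \<le> 0" by simp
    have ek: "?e k > 0" using IH by (simp add: in_cone_def)
    have "elem_sym (Suc k) (a # \<mu>) > 0" "elem_sym (Suc (Suc k)) (a # \<mu>) > 0"
      using Suc.prems by (simp_all add: in_cone_def)
    then have "?e (Suc k) + a * ?e k > 0" "?e (Suc (Suc k)) + a * ?e (Suc k) > 0"
      by (simp_all add: elem_sym_Cons)
    then have h1: "a * ?e k > - ?e (Suc k)" and h2: "?e (Suc (Suc k)) > a * (- ?e (Suc k))" by auto
    have "(?e (Suc k))\<^sup>2 = (- ?e (Suc k)) * (- ?e (Suc k))" by (simp add: power2_eq_square)
    also have "\<dots> \<le> (a * ?e k) * (- ?e (Suc k))" using h1 le by (intro mult_right_mono) auto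
    also have "\<dots> = ?e k * (a * (- ?e (Suc k)))" by simp
    also have "\<dots> < ?e k * ?e (Suc (Suc k))" using h2 ek by (intro mult_strict_left_mono)
    finally show False using Newton_ineq[of k \<mu>] by simp
  qed
  with IH show ?case by (auto simp: in_cone_def le_Suc_eq)
qed

lemma in_cone_increase_one:
  assumes "in_cone k (a # \<mu>)" "a \<le> b"
  shows "in_cone k (b # \<mu>) \<and> (\<forall>j\<le>k. elem_sym j (a # \<mu>) \<le> elem_sym j (b # \<mu>))"
proof -
  have le: "elem_sym j (a # \<mu>) \<le> elem_sym j (b # \<mu>)" if "j \<le> k" for j
  proof (cases j)
    case 0 then show ?thesis by simp
  next
    case (Suc i)
    have "in_cone i \<mu>" using in_cone_remove assms(1) in_cone_mono Suc that by blast
    then have "elem_sym i \<mu> > 0" by (simp add: in_cone_def)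
    then show ?thesis using Suc assms(2) by (simp add: elem_sym_Cons mult_right_mono)
  qed
  then show ?thesis using assms(1) unfolding in_cone_def by (meson less_le_trans)
qed

text \<open>The entries are raised one at a time; the suffix \<open>\<nu>\<close> collects those already treated.\<close>
lemma in_cone_increase_append:
  assumes "list_all2 (\<le>) \<mu> \<mu>'" "in_cone k (\<mu> @ \<nu>)"
  shows "in_cone k (\<mu>' @ \<nu>) \<and> (\<forall>j\<le>k. elem_sym j (\<mu> @ \<nu>) \<le> elem_sym j (\<mu>' @ \<nu>))"
  using assms
proof (induction arbitrary: \<nu> rule: list_all2_induct)
  case Nil
  then show ?case by simp
next
  case (Cons a \<mu> b \<mu>')
  have 1: "in_cone k (b # \<mu> @ \<nu>) \<and> (\<forall>j\<le>k. elem_sym j (a # \<mu> @ \<nu>) \<le> elem_sym j (b # \<mu> @ \<nu>))"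
    using in_cone_increase_one[of k a "\<mu> @ \<nu>" b] Cons by simp
  have eq: "elem_sym j (\<mu> @ b # \<nu>) = elem_sym j (b # \<mu> @ \<nu>)"
    "elem_sym j (\<mu>' @ b # \<nu>) = elem_sym j (b # \<mu>' @ \<nu>)" for j by (rule elem_sym_mset_cong; simp)+
  have "in_cone k (\<mu> @ b # \<nu>)" using 1 by (simp add: in_cone_def eq)
  from Cons.IH[OF this] 1 show ?case by (auto simp: in_cone_def eq intro: order_trans)
qed

lemma in_cone_increase:
  assumes "list_all2 (\<le>) \<mu> \<mu>'" "in_cone k \<mu>"
  shows "in_cone k \<mu>'" "\<And>j. j \<le> k \<Longrightarrow> elem_sym j \<mu> \<le> elem_sym j \<mu>'"
  using in_cone_increase_append[OF assms(1), of k "[]"] assms(2) by auto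

lemma elem_sym_scale: "elem_sym k (map (\<lambda>x. c * x) \<mu>) = c ^ k * elem_sym k \<mu>"
proof (induction \<mu> arbitrary: k)
  case Nil then show ?case by (cases k) auto
next
  case (Cons a \<mu>) then show ?case by (cases k) (auto simp: elem_sym_Cons algebra_simps)
qed

lemma in_cone_scale: "c > 0 \<Longrightarrow> in_cone k \<mu> \<Longrightarrow> in_cone k (map (\<lambda>x. c * x) \<mu>)"
  by (simp add: in_cone_def elem_sym_scale)

lemma coeff_shift:
  fixes q :: "real poly"
  assumes "degree q \<le> d"
  shows "coeff (pcompose q [:c, 1:]) k = (\<Sum>m\<le>d. coeff q m * (of_nat (m choose k) * c ^ (m - k)))"
proof -
  have pow: "pcompose ([:0, 1:] ^ m) [:c, 1:] = [:c, 1:] ^ m" for m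
    by (induction m) (simp_all only: power_0 power_Suc pcompose_mult pcompose_1, simp add: pcompose_pCons)
  have "pcompose q [:c, 1:] = pcompose (\<Sum>m\<le>d. monom (coeff q m) m) [:c, 1:]"
    using poly_as_sum_of_monoms'[OF assms] by simp
  also have "\<dots> = (\<Sum>m\<le>d. smult (coeff q m) ([:c, 1:] ^ m))"
    unfolding pcompose_sum
    by (simp add: monom_altdef pcompose_smult pow)
  finally have *: "coeff (pcompose q [:c, 1:]) k = (\<Sum>m\<le>d. coeff q m * coeff ([:c, 1:] ^ m) k)"
    by (simp add: coeff_sum)
  moreover have "coeff ([:c, 1:] ^ m) k = of_nat (m choose k) * c ^ (m - k)" for m
  proof (cases "k \<le> m")
    case True then show ?thesis by (simp add: coeff_linear_poly_power)
  next
    case False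
    have "degree ([:c, 1:] ^ m) \<le> m" by (simp add: degree_linear_power)
    then show ?thesis using False by (simp add: coeff_eq_0 binomial_eq_0)
  qed
  ultimately show ?thesis by simp
qed

lemma root_poly_shift: "root_poly (map (\<lambda>x. x + c) \<mu>) = pcompose (root_poly \<mu>) [:c, 1:]"
  by (induction \<mu>) (auto simp: pcompose_mult pcompose_pCons pcompose_add pcompose_smult smult_add_left pcompose_1)

text \<open>\<open>\<sigma>\<^sub>p (\<mu> + c)\<close> is a combination of \<open>c\<^sup>p\<^sup>-\<^sup>j \<sigma>\<^sub>j (\<mu>)\<close>, \<open>j \<le> p\<close>, with binomial coefficients. In the cone all
  terms are nonnegative, and only those with \<open>j = 0\<close> and \<open>j = 1\<close> are kept. The linear term in \<open>\<sigma>\<^sub>1\<close> is what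
  makes \<open>\<sigma>\<^sub>p\<close> large when one eigenvalue is large.\<close>
lemma elem_sym_shift_ge:
  assumes "in_cone p \<mu>" "1 \<le> p" "p \<le> length \<mu>" "0 \<le> c"
  shows "elem_sym p (map (\<lambda>x. x + c) \<mu>) \<ge> c ^ p + c ^ (p - 1) * elem_sym 1 \<mu>"
proof -
  define n where "n = length \<mu>"
  define g where "g = (\<lambda>m. coeff (root_poly \<mu>) m * (of_nat (m choose (n - p)) * c ^ (m - (n - p))))"
  have n1: "n \<ge> 1" "p \<le> n" using assms by (auto simp: n_def)
  have "elem_sym p (map (\<lambda>x. x + c) \<mu>) = coeff (root_poly (map (\<lambda>x. x + c) \<mu>)) (n - p)"
    using coeff_root_poly[of p "map (\<lambda>x. x + c) \<mu>"] assms by (simp add: n_def)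
  also have "\<dots> = (\<Sum>m\<le>n. g m)" unfolding root_poly_shift g_def
    by (rule coeff_shift) (use degree_root_poly n_def in auto)
  also have "\<dots> \<ge> (\<Sum>m\<in>{n - 1, n}. g m)"
  proof (rule sum_mono2)
    fix m assume m: "m \<in> {..n} - {n - 1, n}"
    show "0 \<le> g m"
    proof (cases "m < n - p")
      case True then show ?thesis by (simp add: g_def binomial_eq_0)
    next
      case False
      have "coeff (root_poly \<mu>) (n - (n - m)) = elem_sym (n - m) \<mu>"
        unfolding n_def by (rule coeff_root_poly) simp
      moreover have "elem_sym (n - m) \<mu> > 0" using False assms(1) n1 by (auto simp: in_cone_def)
      ultimately have "coeff (root_poly \<mu>) m \<ge> 0" using m by simp
      then show ?thesis using assms(4) by (simp add: g_def)
    qed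
  qed auto
  finally have *: "elem_sym p (map (\<lambda>x. x + c) \<mu>) \<ge> g (n - 1) + g n" using n1 by simp
  have e1: "elem_sym 1 \<mu> > 0" using assms by (simp add: in_cone_def)
  have cn: "coeff (root_poly \<mu>) n = 1" "coeff (root_poly \<mu>) (n - 1) = elem_sym 1 \<mu>"
    using coeff_root_poly[of 0 \<mu>] coeff_root_poly[of 1 \<mu>] n1 by (simp_all add: n_def)
  have b: "real (n choose (n - p)) \<ge> 1" "real ((n - 1) choose (n - p)) \<ge> 1"
    using n1 assms(2) zero_less_binomial[of "n - p" n] zero_less_binomial[of "n - p" "n - 1"]
    by (simp_all add: Suc_le_eq)
  have i: "n - (n - p) = p" "n - 1 - (n - p) = p - 1" using n1 assms(2) by auto
  have "c ^ p \<le> g n" unfolding g_def cn i using b(1) assms(4)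
    by (simp add: mult_le_cancel_right1)
  moreover have "c ^ (p - 1) * elem_sym 1 \<mu> \<le> g (n - 1)"
  proof -
    have "elem_sym 1 \<mu> * c ^ (p - 1) * 1 \<le> elem_sym 1 \<mu> * c ^ (p - 1) * real ((n - 1) choose (n - p))"
      using b(2) e1 assms(4) by (intro mult_left_mono) auto
    then show ?thesis unfolding g_def cn i by (simp add: mult_ac)
  qed
  ultimately show ?thesis using * by linarith
qed

section \<open>Eigenvalues of symmetric matrices\<close>

text \<open>Indexed by numbers below the dimension, because eigenvalues come as a list.\<close>
definition onb :: "(nat \<Rightarrow> real ^ 'n) \<Rightarrow> bool" where
  "onb e \<longleftrightarrow> (\<forall>i<CARD('n). \<forall>j<CARD('n). e i \<bullet> e j = (if i = j then 1 else 0))"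

lemma onb_expand:
  fixes e :: "nat \<Rightarrow> real ^ 'n"
  assumes "onb e"
  shows "x = (\<Sum>i<CARD('n). (x \<bullet> e i) *\<^sub>R e i)"
proof -
  let ?n = "CARD('n)"
  let ?B = "e ` {..<?n}"
  have orth: "e i \<bullet> e j = (if i = j then 1 else 0)" if "i < ?n" "j < ?n" for i j
    using assms that by (simp add: onb_def)
  have inj: "inj_on e {..<?n}"
    by (rule inj_onI) (metis lessThan_iff orth zero_neq_one)
  have "independent ?B"
  proof (rule pairwise_orthogonal_independent)
    show "pairwise orthogonal ?B"
      unfolding pairwise_def orthogonal_def using orth by force
    show "0 \<notin> ?B"
      using orth by force
  qed
  moreover have "card ?B = ?n" using inj by (simp add: card_image)
  ultimately have sp: "span ?B = UNIV"
    using card_ge_dim_independent[of ?B UNIV] by auto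
  define y where "y = x - (\<Sum>i<?n. (x \<bullet> e i) *\<^sub>R e i)"
  have "orthogonal y b" if bB: "b \<in> ?B" for b
  proof -
    obtain j where j: "j < ?n" "b = e j" using bB by blast
    have "(\<Sum>i<?n. (x \<bullet> e i) *\<^sub>R e i) \<bullet> e j = (\<Sum>i<?n. (x \<bullet> e i) * (if i = j then 1 else 0))"
      unfolding inner_sum_left using orth j by (intro sum.cong) auto
    also have "\<dots> = x \<bullet> e j" using j by (simp add: if_distrib cong: if_cong)
    finally show ?thesis using j by (simp add: y_def orthogonal_def inner_diff_left)
  qed
  then have "orthogonal y y"
    using orthogonal_to_span[of y ?B y] sp by simp
  then show ?thesis by (simp add: y_def orthogonal_def)
qed

lemma onb_parseval:
  fixes e :: "nat \<Rightarrow> real ^ 'n"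
  assumes "onb e"
  shows "(\<Sum>i<CARD('n). (x \<bullet> e i)\<^sup>2) = x \<bullet> x"
proof -
  have "x \<bullet> x = x \<bullet> (\<Sum>i<CARD('n). (x \<bullet> e i) *\<^sub>R e i)" using onb_expand[OF assms, of x] by simp
  also have "\<dots> = (\<Sum>i<CARD('n). (x \<bullet> e i)\<^sup>2)" by (simp add: inner_sum_right power2_eq_square)
  finally show ?thesis by simp
qed

lemma symmetric_matrix_inner:
  fixes M :: "real ^ 'n ^ 'n"
  assumes "transpose M = M"
  shows "x \<bullet> (M *v y) = (M *v x) \<bullet> y"
  by (metis assms dot_lmul_matrix transpose_matrix_vector)

text \<open>A maximiser of the Rayleigh quotient on the orthogonal complement of the eigenvectors already
  found is a further eigenvector.\<close>
lemma symmetric_orthonormal_eigenvectors: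
  fixes M :: "real ^ 'n ^ 'n"
  assumes sym: "transpose M = M" and "k \<le> CARD('n)"
  shows "\<exists>u a. (\<forall>i<k. \<forall>j<k. u i \<bullet> u j = (if i = j then 1 else 0)) \<and> (\<forall>i<k. M *v u i = a i *\<^sub>R u i)"
  using assms(2)
proof (induction k)
  case 0
  then show ?case by simp
next
  case (Suc k)
  then obtain u :: "nat \<Rightarrow> real ^ 'n" and a :: "nat \<Rightarrow> real" where
    u: "\<And>i j. i < k \<Longrightarrow> j < k \<Longrightarrow> u i \<bullet> u j = (if i = j then 1 else 0)"
    and a: "\<And>i. i < k \<Longrightarrow> M *v u i = a i *\<^sub>R u i" by auto
  let ?S = "{x. \<forall>i<k. x \<bullet> u i = 0}"
  let ?K = "sphere 0 1 \<inter> ?S"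
  have "dim (u ` {..<k}) \<le> card (u ` {..<k})" by (rule dim_le_card') simp
  also have "\<dots> \<le> k" using card_image_le[of "{..<k}" u] by simp
  finally have "dim (u ` {..<k}) < DIM(real ^ 'n)" using Suc.prems by simp
  then obtain x0 where x0: "x0 \<noteq> 0" "\<And>y. y \<in> span (u ` {..<k}) \<Longrightarrow> orthogonal x0 y"
    using orthogonal_to_subspace_exists by metis
  have "x0 \<bullet> u i = 0" if "i < k" for i
    using x0(2)[of "u i"] that by (simp add: orthogonal_def span_base)
  then have "x0 /\<^sub>R norm x0 \<in> ?K" using x0 by simp
  then have K: "?K \<noteq> {}" by blast
  have compact: "compact ?K"
  proof (rule compact_Int_closed)
    have "?S = (\<Inter>i\<in>{..<k}. {x. x \<bullet> u i = 0})" by auto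
    moreover have "closed \<dots>"
      by (intro closed_INT ballI closed_Collect_eq continuous_intros)
    ultimately show "closed ?S" by simp
  qed simp
  have cont: "continuous_on ?K (\<lambda>x. x \<bullet> (M *v x))"
    by (intro continuous_intros matrix_vector_mult_linear_continuous_on)
  obtain w where w: "w \<in> ?K" and wmax: "\<And>x. x \<in> ?K \<Longrightarrow> x \<bullet> (M *v x) \<le> w \<bullet> (M *v w)"
    using continuous_attains_sup[OF compact K cont] by blast
  define c where "c = w \<bullet> (M *v w)"
  have ww: "w \<bullet> w = 1" using w by (simp add: norm_eq_1)
  have wS: "w \<bullet> u i = 0" if "i < k" for i using w that by auto
  have form_le: "x \<bullet> (M *v x) \<le> c * (x \<bullet> x)" if "x \<in> ?S" for x
  proof (cases "x = 0")
    case False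
    then have "x /\<^sub>R norm x \<in> ?K" using that by simp
    from wmax[OF this] have "(x \<bullet> (M *v x)) / (norm x)\<^sup>2 \<le> c"
      by (simp add: c_def matrix_vector_mult_scaleR power2_eq_square field_simps)
    then show ?thesis using False by (simp add: pos_divide_le_eq power2_norm_eq_inner)
  qed simp
  define y where "y = M *v w - c *\<^sub>R w"
  have yS: "y \<in> ?S"
  proof (clarsimp)
    fix i assume i: "i < k"
    have "(M *v w) \<bullet> u i = w \<bullet> (M *v u i)" using symmetric_matrix_inner[OF sym, of w "u i"] by simp
    also have "\<dots> = 0" using a[OF i] wS[OF i] by simp
    finally show "y \<bullet> u i = 0" using wS[OF i] by (simp add: y_def inner_diff_left)
  qed
  have yw: "y \<bullet> w = 0" using ww by (simp add: y_def inner_diff_left inner_diff_right c_def inner_commute)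
  have Mw: "M *v w = y + c *\<^sub>R w" by (simp add: y_def)
  \<comment> \<open>First variation: moving from the maximiser \<open>w\<close> in the direction \<open>y\<close> cannot increase the Rayleigh quotient.\<close>
  have var: "2 * t * (y \<bullet> y) + t\<^sup>2 * (y \<bullet> (M *v y) - c * (y \<bullet> y)) \<le> 0" for t
  proof -
    have "w + t *\<^sub>R y \<in> ?S" using yS wS by (auto simp: inner_add_left)
    from form_le[OF this]
    have "(w + t *\<^sub>R y) \<bullet> (M *v w + t *\<^sub>R (M *v y)) \<le> c * ((w + t *\<^sub>R y) \<bullet> (w + t *\<^sub>R y))"
      by (simp add: matrix_vector_right_distrib matrix_vector_mult_scaleR)
    moreover have "w \<bullet> (M *v y) = y \<bullet> y"
      using symmetric_matrix_inner[OF sym, of w y] yw by (simp add: Mw inner_add_left inner_add_right inner_commute)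
    moreover have "y \<bullet> (M *v w) = y \<bullet> y" using yw by (simp add: Mw inner_add_right)
    moreover have "w \<bullet> (M *v w) = c" by (simp add: c_def)
    ultimately show ?thesis using ww yw
      by (simp add: inner_add_left inner_add_right inner_commute power2_eq_square algebra_simps)
  qed
  have "y = 0"
  proof (rule ccontr)
    assume "y \<noteq> 0"
    then have pos: "y \<bullet> y > 0" by simp
    define q where "q = \<bar>y \<bullet> (M *v y) - c * (y \<bullet> y)\<bar> + 1"
    define t where "t = (y \<bullet> y) / q"
    have q: "q > 0" by (simp add: q_def)
    then have t: "t > 0" using pos by (simp add: t_def)
    have "t * (2 * (y \<bullet> y) + t * (y \<bullet> (M *v y) - c * (y \<bullet> y))) \<le> 0"
      using var[of t] by (simp add: power2_eq_square algebra_simps)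
    then have "2 * (y \<bullet> y) + t * (y \<bullet> (M *v y) - c * (y \<bullet> y)) \<le> 0"
      using t by (simp add: mult_le_0_iff)
    moreover have "t * (y \<bullet> (M *v y) - c * (y \<bullet> y)) \<ge> t * (- q)"
      using t by (intro mult_left_mono) (auto simp: q_def)
    moreover have "t * (- q) = - (y \<bullet> y)" using q by (simp add: t_def)
    ultimately show False using pos by linarith
  qed
  then have eig: "M *v w = c *\<^sub>R w" by (simp add: Mw)
  have "\<forall>i<Suc k. \<forall>j<Suc k. (u(k := w)) i \<bullet> (u(k := w)) j = (if i = j then 1 else 0)"
    using u wS ww by (auto simp: less_Suc_eq inner_commute)
  moreover have "\<forall>i<Suc k. M *v (u(k := w)) i = (a(k := c)) i *\<^sub>R (u(k := w)) i"
    using a eig by (auto simp: less_Suc_eq)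
  ultimately show ?case by blast
qed

lemma sorting_permutation:
  fixes b :: "nat \<Rightarrow> real"
  obtains \<pi> where "bij_betw \<pi> {..<n} {..<n}" "\<And>i j. i \<le> j \<Longrightarrow> j < n \<Longrightarrow> b (\<pi> i) \<le> b (\<pi> j)"
    "mset (map (\<lambda>i. b (\<pi> i)) [0..<n]) = mset (map b [0..<n])"
proof -
  define xs where "xs = sort_key b [0..<n]"
  have xs: "length xs = n" "distinct xs" "set xs = {..<n}" "sorted (map b xs)" "mset xs = mset [0..<n]"
    by (auto simp: xs_def)
  have bij: "bij_betw ((!) xs) {..<n} {..<n}"
    by (rule bij_betw_nth) (simp_all only: xs)
  have mono: "b (xs ! i) \<le> b (xs ! j)" if "i \<le> j" "j < n" for i j
    using sorted_nth_mono[OF xs(4), of i j] that xs(1) by simp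
  have "map (\<lambda>i. b (xs ! i)) [0..<n] = map b xs"
    using xs(1) by (intro nth_equalityI) auto
  then have "mset (map (\<lambda>i. b (xs ! i)) [0..<n]) = mset (map b [0..<n])"
    using xs(5) by (metis mset_map)
  then show ?thesis using that[of "(!) xs", OF bij mono] by blast
qed

lemma onb_permute:
  fixes e :: "nat \<Rightarrow> real ^ 'n"
  assumes "onb e" "bij_betw \<pi> {..<CARD('n)} {..<CARD('n)}"
  shows "onb (\<lambda>i. e (\<pi> i))"
proof -
  have "\<pi> i < CARD('n)" if "i < CARD('n)" for i
    using assms(2) that by (auto simp: bij_betw_def)
  moreover have "\<pi> i = \<pi> j \<longleftrightarrow> i = j" if "i < CARD('n)" "j < CARD('n)" for i j
    using assms(2) that by (auto simp: bij_betw_def inj_on_def)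
  ultimately show ?thesis using assms(1) by (simp add: onb_def)
qed

text \<open>With the eigenvectors as the columns of \<open>Q\<close>, the matrix \<open>mat t - M\<close> is conjugate to a diagonal one.\<close>
lemma char_poly_of_eigenbasis:
  fixes M :: "real ^ 'n ^ 'n"
  assumes "onb u" and eig: "\<And>i. i < CARD('n) \<Longrightarrow> M *v u i = a i *\<^sub>R u i"
  shows "det (mat t - M) = (\<Prod>i<CARD('n). t - a i)"
proof -
  obtain h where h: "bij_betw h (UNIV :: 'n set) {..<CARD('n)}"
    using ex_bij_betw_finite_nat[of "UNIV :: 'n set"] by (auto simp: atLeast0LessThan)
  have hlt: "h i < CARD('n)" for i using h by (auto simp: bij_betw_def)
  have heq: "h i = h j \<longleftrightarrow> i = j" for i j using h by (auto simp: bij_betw_def inj_on_def)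
  define Q :: "real ^ 'n ^ 'n" where "Q = (\<chi> i j. u (h j) $ i)"
  define D :: "real ^ 'n ^ 'n" where "D = (\<chi> i j. if i = j then t - a (h i) else 0)"
  have "transpose Q ** Q = mat 1"
    using assms(1) hlt heq
    by (simp add: vec_eq_iff matrix_matrix_mult_def transpose_def Q_def mat_def onb_def inner_vec_def)
  then have "det (transpose Q) * det Q = 1" by (metis det_I det_mul)
  then have Q0: "det Q \<noteq> 0" by auto
  have "(mat t - M) ** Q = Q ** D"
  proof -
    have "((mat t - M) ** Q) $ i $ j = (Q ** D) $ i $ j" for i j
    proof -
      have "((mat t - M) ** Q) $ i $ j = ((mat t - M) *v u (h j)) $ i"
        by (simp add: matrix_matrix_mult_def matrix_vector_mult_def Q_def)
      also have "(mat t - M) *v u (h j) = t *\<^sub>R u (h j) - a (h j) *\<^sub>R u (h j)"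
      proof -
        have "mat t *v x = t *\<^sub>R x" for x :: "real ^ 'n"
          by (simp add: vec_eq_iff matrix_vector_mult_def mat_def if_distrib cong: if_cong)
             (simp add: if_distribR sum.delta cong: if_cong)
        then show ?thesis using eig[OF hlt] by (simp add: matrix_vector_mult_diff_rdistrib)
      qed
      also have "\<dots> $ i = (Q ** D) $ i $ j"
        by (simp add: matrix_matrix_mult_def Q_def D_def if_distrib algebra_simps cong: if_cong)
      finally show ?thesis .
    qed
    then show ?thesis by (simp add: vec_eq_iff)
  qed
  then have "det (mat t - M) * det Q = det Q * det D" by (metis det_mul)
  then have "det (mat t - M) = det D" using Q0 by simp
  also have "\<dots> = (\<Prod>i\<in>UNIV. t - a (h i))"
    by (subst det_diagonal) (auto simp: D_def)
  also have "\<dots> = (\<Prod>i<CARD('n). t - a i)"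
    by (rule prod.reindex_bij_betw[OF h])
  finally show ?thesis .
qed

text \<open>The common polynomial determines the multiset of its roots, and the order is determined by
  sortedness.\<close>
lemma sorted_roots_unique:
  fixes l l' :: "real list"
  assumes "sorted l" "sorted l'" "length l = n" "length l' = n"
    and "\<And>t. (\<Prod>i<n. t - l ! i) = (\<Prod>i<n. t - l' ! i)"
  shows "l = l'"
proof -
  have val: "poly (\<Prod>a\<leftarrow>l. [:- a, 1:]) t = (\<Prod>i<length l. t - l ! i)" for l :: "real list" and t
  proof (induction l rule: rev_induct)
    case (snoc a l)
    have "(\<Prod>i<length l. t - (l @ [a]) ! i) = (\<Prod>i<length l. t - l ! i)"
      by (rule prod.cong) (auto simp: nth_append)
    then show ?case using snoc by (simp add: algebra_simps)
  qed simp
  have roots: "proots (\<Prod>a\<leftarrow>l. [:- a, 1:]) = mset l" for l :: "real list"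
  proof (induction l)
    case (Cons a l)
    have "(\<Prod>a\<leftarrow>l. [:- a, 1:]) \<noteq> 0" by (auto simp: prod_list_zero_iff)
    then have "proots ([:- a, 1:] * (\<Prod>a\<leftarrow>l. [:- a, 1:])) = {#a#} + mset l"
      using Cons by (subst proots_mult) auto
    then show ?case by (simp del: mult_pCons_left)
  qed simp
  have "(\<Prod>a\<leftarrow>l. [:- a, 1:]) = (\<Prod>a\<leftarrow>l'. [:- a, 1:])"
    using assms val by (intro poly_eq_poly_eq_iff[THEN iffD1] ext) simp
  then have "mset l = mset l'" using roots by metis
  then show ?thesis using assms by (metis properties_for_sort)
qed

lemma eigenvals_symmetric:
  fixes M :: "real ^ 'n ^ 'n"
  assumes sym: "transpose M = M"
  shows "length (eigenvals M) = CARD('n) \<and> sorted (eigenvals M) \<and>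
    (\<exists>u. onb u \<and> (\<forall>i<CARD('n). M *v u i = (eigenvals M ! i) *\<^sub>R u i))"
proof -
  let ?n = "CARD('n)"
  obtain u :: "nat \<Rightarrow> real ^ 'n" and a where u: "onb u" and a: "\<And>i. i < ?n \<Longrightarrow> M *v u i = a i *\<^sub>R u i"
    using symmetric_orthonormal_eigenvectors[OF sym, of ?n] unfolding onb_def by blast
  obtain \<pi> where \<pi>: "bij_betw \<pi> {..<?n} {..<?n}" "\<And>i j. i \<le> j \<Longrightarrow> j < ?n \<Longrightarrow> a (\<pi> i) \<le> a (\<pi> j)"
    using sorting_permutation by blast
  define l where "l = map (\<lambda>i. a (\<pi> i)) [0..<?n]"
  define u' where "u' = (\<lambda>i. u (\<pi> i))"
  have lt: "\<pi> i < ?n" if "i < ?n" for i using \<pi>(1) that by (auto simp: bij_betw_def)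
  have l: "length l = ?n" "sorted l" using \<pi>(2) by (auto simp: l_def sorted_iff_nth_mono)
  have u': "onb u'" unfolding u'_def by (rule onb_permute[OF u \<pi>(1)])
  have eig: "M *v u' i = (l ! i) *\<^sub>R u' i" if "i < ?n" for i
    using a[OF lt[OF that]] that by (simp add: u'_def l_def)
  have "eigenvals M = l" unfolding eigenvals_def
  proof (rule the_equality)
    show "length l = ?n \<and> sorted l \<and> (\<forall>t. det (mat t - M) = (\<Prod>i<?n. t - l ! i))"
      using l char_poly_of_eigenbasis[OF u' eig] by simp
    fix l' assume l': "length l' = ?n \<and> sorted l' \<and> (\<forall>t. det (mat t - M) = (\<Prod>i<?n. t - l' ! i))"
    show "l' = l"
      by (rule sorted_roots_unique[of _ _ ?n]) (use l l' char_poly_of_eigenbasis[OF u' eig] in auto)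
  qed
  then show ?thesis using l u' eig by blast
qed

text \<open>A dimension count: the \<open>n - 1\<close> vectors \<open>e j\<close> with \<open>j < i\<close> and \<open>u j\<close> with \<open>j > i\<close> have a common nonzero
  orthogonal vector. On it the first form is at least \<open>b i\<close> times the squared norm and the second one at
  most \<open>a i\<close> times the squared norm.\<close>
lemma Weyl_monotonicity:
  fixes e u :: "nat \<Rightarrow> real ^ 'n"
  assumes e: "onb e" and u: "onb u"
    and b: "\<And>i j. i \<le> j \<Longrightarrow> j < CARD('n) \<Longrightarrow> b i \<le> b j"
    and a: "\<And>i j. i \<le> j \<Longrightarrow> j < CARD('n) \<Longrightarrow> a i \<le> a j"
    and le: "\<And>x. (\<Sum>i<CARD('n). b i * (x \<bullet> e i)\<^sup>2) \<le> (\<Sum>i<CARD('n). a i * (x \<bullet> u i)\<^sup>2)"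
    and i: "i < CARD('n)"
  shows "b i \<le> (a i :: real)"
proof -
  let ?n = "CARD('n)"
  let ?B = "e ` {..<i} \<union> u ` {Suc i..<?n}"
  have "dim ?B \<le> card ?B" by (rule dim_le_card') simp
  also have "\<dots> \<le> card (e ` {..<i}) + card (u ` {Suc i..<?n})" by (rule card_Un_le)
  also have "\<dots> \<le> i + (?n - Suc i)"
    using card_image_le[of "{..<i}" e] card_image_le[of "{Suc i..<?n}" u] by simp
  also have "\<dots> < ?n" using i by simp
  finally have "dim ?B < DIM(real ^ 'n)" by simp
  then obtain x where x: "x \<noteq> 0" "\<And>y. y \<in> span ?B \<Longrightarrow> orthogonal x y"
    using orthogonal_to_subspace_exists by metis
  have xe: "x \<bullet> e j = 0" if "j < i" for j
    using x(2)[of "e j"] that by (simp add: orthogonal_def span_base)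
  have xu: "x \<bullet> u j = 0" if "i < j" "j < ?n" for j
    using x(2)[of "u j"] that by (simp add: orthogonal_def span_base)
  have "b i * (x \<bullet> x) = (\<Sum>j<?n. b i * (x \<bullet> e j)\<^sup>2)"
    by (simp add: onb_parseval[OF e, symmetric] sum_distrib_left)
  also have "\<dots> \<le> (\<Sum>j<?n. b j * (x \<bullet> e j)\<^sup>2)"
  proof (rule sum_mono)
    fix j assume "j \<in> {..<?n}"
    then show "b i * (x \<bullet> e j)\<^sup>2 \<le> b j * (x \<bullet> e j)\<^sup>2"
      using xe b[of i j] by (cases "j < i") (auto intro: mult_right_mono)
  qed
  also have "\<dots> \<le> (\<Sum>j<?n. a j * (x \<bullet> u j)\<^sup>2)" by (rule le)
  also have "\<dots> \<le> (\<Sum>j<?n. a i * (x \<bullet> u j)\<^sup>2)"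
  proof (rule sum_mono)
    fix j assume "j \<in> {..<?n}"
    then show "a j * (x \<bullet> u j)\<^sup>2 \<le> a i * (x \<bullet> u j)\<^sup>2"
      using xu a[of j i] i by (cases "i < j") (auto intro: mult_right_mono)
  qed
  also have "\<dots> = a i * (x \<bullet> x)"
    by (simp add: onb_parseval[OF u, symmetric] sum_distrib_left)
  finally show ?thesis using x(1) by simp
qed

text \<open>By Weyl's monotonicity the eigenvalues of \<open>M - c\<close> dominate the sorted entries of \<open>l\<close>, hence lie in the
  cone. The sum of the eigenvalues of \<open>M - c\<close>, computed in an eigenbasis, is at least \<open>B |\<xi>|\<^sup>2\<close>, and shifting by \<open>c\<close> gives the lower bound for
  \<open>\<sigma>\<^sub>p\<close>. A rank one term \<open>B \<xi> \<otimes> \<xi>\<close> thus has a quantitative effect whatever its position relative to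
  the basis \<open>e\<close>.\<close>
lemma eigenvals_of_form_lower_bound:
  fixes M :: "real ^ 'n ^ 'n" and e :: "nat \<Rightarrow> real ^ 'n"
  assumes sym: "transpose M = M" and e: "onb e" and l: "length l = CARD('n)" "in_cone p l"
    and p: "1 \<le> p" "p \<le> CARD('n)" and c: "0 \<le> c"
    and form: "\<And>x. (\<Sum>i<CARD('n). l ! i * (x \<bullet> e i)\<^sup>2) + c * (x \<bullet> x) + B * (x \<bullet> \<xi>)\<^sup>2 \<le> x \<bullet> (M *v x)"
    and B: "0 \<le> B"
  shows "in_cone p (eigenvals M)"
    and "c ^ p + c ^ (p - 1) * (B * (\<xi> \<bullet> \<xi>)) \<le> elem_sym p (eigenvals M)"
proof -
  let ?n = "CARD('n)"
  let ?a = "eigenvals M"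
  obtain u where len: "length ?a = ?n" and srt: "sorted ?a" and u: "onb u"
    and eig: "\<And>i. i < ?n \<Longrightarrow> M *v u i = (?a ! i) *\<^sub>R u i"
    using eigenvals_symmetric[OF sym] by blast
  define \<mu> where "\<mu> = map (\<lambda>x. x - c) ?a"
  have shift: "map (\<lambda>x. x + c) \<mu> = ?a" by (simp add: \<mu>_def comp_def)
  have quad: "x \<bullet> (M *v x) = (\<Sum>i<?n. ?a ! i * (x \<bullet> u i)\<^sup>2)" for x
  proof -
    have "x \<bullet> (M *v x) = (M *v x) \<bullet> (\<Sum>i<?n. (x \<bullet> u i) *\<^sub>R u i)"
      using onb_expand[OF u, of x] by (simp add: inner_commute)
    also have "\<dots> = (\<Sum>i<?n. (x \<bullet> u i) * ((M *v x) \<bullet> u i))" by (simp add: inner_sum_right)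
    also have "\<dots> = (\<Sum>i<?n. ?a ! i * (x \<bullet> u i)\<^sup>2)"
    proof (rule sum.cong[OF refl])
      fix i assume "i \<in> {..<?n}"
      then have "(M *v x) \<bullet> u i = ?a ! i * (x \<bullet> u i)"
        using symmetric_matrix_inner[OF sym, of x "u i"] eig[of i] by simp
      then show "(x \<bullet> u i) * ((M *v x) \<bullet> u i) = ?a ! i * (x \<bullet> u i)\<^sup>2"
        by (simp add: power2_eq_square)
    qed
    finally show ?thesis .
  qed
  obtain \<pi> where \<pi>: "bij_betw \<pi> {..<?n} {..<?n}"
    "\<And>i j. i \<le> j \<Longrightarrow> j < ?n \<Longrightarrow> l ! \<pi> i \<le> l ! \<pi> j"
    "mset (map (\<lambda>i. l ! \<pi> i) [0..<?n]) = mset (map ((!) l) [0..<?n])"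
    using sorting_permutation[of ?n "(!) l"] by blast
  define l' where "l' = map (\<lambda>i. l ! \<pi> i) [0..<?n]"
  have "map ((!) l) [0..<?n] = l" using l(1) by (metis map_nth)
  then have ml: "mset l' = mset l" using \<pi>(3) by (simp add: l'_def)
  then have l': "in_cone p l'" using l(2) elem_sym_mset_cong[OF ml] by (simp add: in_cone_def)
  have weyl: "l ! \<pi> i \<le> ?a ! i - c" if "i < ?n" for i
  proof (rule Weyl_monotonicity[of "\<lambda>i. e (\<pi> i)" u "\<lambda>i. l ! \<pi> i" "\<lambda>i. ?a ! i - c", OF onb_permute[OF e \<pi>(1)] u \<pi>(2) _ _ that])
    show "?a ! i - c \<le> ?a ! j - c" if "i \<le> j" "j < ?n" for i j
      using sorted_nth_mono[OF srt that(1)] that len by simp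
    fix x :: "real ^ 'n"
    have "(\<Sum>i<?n. l ! \<pi> i * (x \<bullet> e (\<pi> i))\<^sup>2) = (\<Sum>i<?n. l ! i * (x \<bullet> e i)\<^sup>2)"
      by (rule sum.reindex_bij_betw[OF \<pi>(1)])
    also have "\<dots> \<le> x \<bullet> (M *v x) - c * (x \<bullet> x)"
      using form[of x] B by (smt (verit) mult_nonneg_nonneg zero_le_power2)
    also have "\<dots> = (\<Sum>i<?n. (?a ! i - c) * (x \<bullet> u i)\<^sup>2)"
      by (simp add: quad onb_parseval[OF u, symmetric] sum_distrib_left sum_subtractf left_diff_distrib)
    finally show "(\<Sum>i<?n. l ! \<pi> i * (x \<bullet> e (\<pi> i))\<^sup>2) \<le> (\<Sum>i<?n. (?a ! i - c) * (x \<bullet> u i)\<^sup>2)" .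
  qed auto
  have "list_all2 (\<le>) l' \<mu>"
    using weyl len by (auto simp: list_all2_conv_all_nth l'_def \<mu>_def)
  then have \<mu>: "in_cone p \<mu>" using in_cone_increase(1) l' by blast
  have "list_all2 (\<le>) \<mu> ?a" using len c by (auto simp: list_all2_conv_all_nth \<mu>_def)
  then show "in_cone p ?a" using in_cone_increase(1) \<mu> by blast
  have "elem_sym 1 \<mu> = (\<Sum>k<?n. u k \<bullet> (M *v u k) - c * (u k \<bullet> u k))"
  proof -
    have "u k \<bullet> (M *v u k) - c * (u k \<bullet> u k) = ?a ! k - c" if "k < ?n" for k
      using eig[OF that] u that by (simp add: onb_def)
    then have "(\<Sum>k<?n. u k \<bullet> (M *v u k) - c * (u k \<bullet> u k)) = (\<Sum>k<?n. \<mu> ! k)"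
      using len by (intro sum.cong) (auto simp: \<mu>_def)
    then show ?thesis using len by (simp add: elem_sym_1 sum_list_sum_nth \<mu>_def atLeast0LessThan)
  qed
  also have "\<dots> \<ge> (\<Sum>k<?n. (\<Sum>i<?n. l ! i * (u k \<bullet> e i)\<^sup>2) + B * (u k \<bullet> \<xi>)\<^sup>2)"
    using form by (intro sum_mono) (simp add: algebra_simps)
  also have "(\<Sum>k<?n. (\<Sum>i<?n. l ! i * (u k \<bullet> e i)\<^sup>2) + B * (u k \<bullet> \<xi>)\<^sup>2)
      = (\<Sum>i<?n. l ! i * (\<Sum>k<?n. (e i \<bullet> u k)\<^sup>2)) + B * (\<Sum>k<?n. (\<xi> \<bullet> u k)\<^sup>2)"
    unfolding sum.distrib sum_distrib_left by (subst sum.swap) (simp add: inner_commute)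
  also have "\<dots> = (\<Sum>i<?n. l ! i) + B * (\<xi> \<bullet> \<xi>)"
    using e by (simp add: onb_parseval[OF u] onb_def)
  also have "(\<Sum>i<?n. l ! i) = elem_sym 1 l"
    using l(1) by (simp add: elem_sym_1 sum_list_sum_nth atLeast0LessThan)
  finally have "B * (\<xi> \<bullet> \<xi>) \<le> elem_sym 1 \<mu>"
    using l(2) p unfolding in_cone_def by (smt (verit))
  then have "c ^ (p - 1) * (B * (\<xi> \<bullet> \<xi>)) \<le> c ^ (p - 1) * elem_sym 1 \<mu>"
    using c by (simp add: mult_left_mono)
  moreover have "c ^ p + c ^ (p - 1) * elem_sym 1 \<mu> \<le> elem_sym p (map (\<lambda>x. x + c) \<mu>)"
    using elem_sym_shift_ge[OF \<mu> p(1) _ c] p len by (simp add: \<mu>_def)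
  ultimately show "c ^ p + c ^ (p - 1) * (B * (\<xi> \<bullet> \<xi>)) \<le> elem_sym p (eigenvals M)"
    unfolding shift by linarith
qed

section \<open>Calculus of smooth functions\<close>

definition smooth_on :: "(real ^ 'n) set \<Rightarrow> (real ^ 'n \<Rightarrow> real) \<Rightarrow> bool" where
  "smooth_on U f \<longleftrightarrow> (\<forall>k. Ck_on k U f)"

lemma Ck_on_cong:
  assumes "open U" "\<And>x. x \<in> U \<Longrightarrow> f x = g x" "Ck_on k U f"
  shows "Ck_on k U g"
  using assms(2,3)
proof (induction k arbitrary: f g)
  case 0
  then show ?case using continuous_on_cong by force
next
  case (Suc k)
  have "g differentiable (at x)" if x: "x \<in> U" for x
  proof -
    have "(f has_derivative frechet_derivative f (at x)) (at x)"
      using Suc.prems x by (simp add: frechet_derivative_works)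
    then have "(g has_derivative frechet_derivative f (at x)) (at x)"
      by (rule has_derivative_transform_within_open[OF _ assms(1) x Suc.prems(1)])
    then show ?thesis by (rule differentiableI)
  qed
  moreover have "Ck_on k U (partial_deriv i g)" for i
  proof (rule Suc.IH[of "partial_deriv i f"])
    show "partial_deriv i f x = partial_deriv i g x" if "x \<in> U" for x
      unfolding partial_deriv_def
      using frechet_derivative_transform_within_open[OF _ assms(1) that Suc.prems(1)] Suc.prems(2) that
      by simp
    show "Ck_on k U (partial_deriv i f)" using Suc.prems by simp
  qed
  ultimately show ?case by simp
qed

lemma Ck_on_subset: "Ck_on k U f \<Longrightarrow> V \<subseteq> U \<Longrightarrow> Ck_on k V f"
  by (induction k arbitrary: f) (auto intro: continuous_on_subset)

lemma Ck_on_Un: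
  "open U \<Longrightarrow> open V \<Longrightarrow> Ck_on k U f \<Longrightarrow> Ck_on k V f \<Longrightarrow> Ck_on k (U \<union> V) f"
  by (induction k arbitrary: f) (auto intro: continuous_on_open_Un)

lemma Ck_on_lower: "Ck_on (Suc k) U f \<Longrightarrow> Ck_on k U f"
proof (induction k arbitrary: f)
  case 0
  then show ?case
    by (auto intro!: continuous_at_imp_continuous_on differentiable_imp_continuous_within)
next
  case (Suc k)
  then show ?case by (metis Ck_on.simps(2))
qed

lemma Ck_on_const: 
  fixes U :: "(real ^ 'n) set"
  shows "Ck_on k U (\<lambda>x. c)"
proof (induction k arbitrary: c)
  case (Suc k)
  have "partial_deriv i (\<lambda>x :: real ^ 'n. c) = (\<lambda>x. 0)" for i by (simp add: partial_deriv_def fun_eq_iff)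
  then show ?case using Suc by simp
qed simp

lemma partial_deriv_has_derivative:
  assumes "(f has_derivative f') (at x)"
  shows "partial_deriv i f x = f' (axis i 1)"
  using frechet_derivative_at[OF assms] by (simp add: partial_deriv_def)

lemma partial_deriv_coord: "partial_deriv j (\<lambda>x. x $ i) x = (if i = j then 1 else 0)"
proof -
  have "((\<lambda>x. x $ i) has_derivative (\<lambda>h. h $ i)) (at x)" for x :: "real ^ 'a"
    by (rule bounded_linear_imp_has_derivative[OF bounded_linear_vec_nth])
  from partial_deriv_has_derivative[OF this] show ?thesis by (simp add: axis_def)
qed

lemma differentiable_frechet:
  "f differentiable (at x) \<Longrightarrow> (f has_derivative frechet_derivative f (at x)) (at x)"
  by (simp add: frechet_derivative_works)

lemma partial_deriv_add:
  assumes "f differentiable (at x)" "g differentiable (at x)"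
  shows "partial_deriv i (\<lambda>x. f x + g x) x = partial_deriv i f x + partial_deriv i g x"
  using partial_deriv_has_derivative[OF has_derivative_add[OF assms[THEN differentiable_frechet]]]
  by (simp add: partial_deriv_def)

lemma partial_deriv_mult:
  assumes "f differentiable (at x)" "g differentiable (at x)"
  shows "partial_deriv i (\<lambda>x. f x * g x) x = f x * partial_deriv i g x + partial_deriv i f x * g x"
  using partial_deriv_has_derivative[OF has_derivative_mult[OF assms[THEN differentiable_frechet]]]
  by (simp add: partial_deriv_def)

lemma Ck_on_add: "open U \<Longrightarrow> Ck_on k U f \<Longrightarrow> Ck_on k U g \<Longrightarrow> Ck_on k U (\<lambda>x. f x + g x)"
proof (induction k arbitrary: f g)
  case 0
  then show ?case by (auto intro: continuous_intros)
next
  case (Suc k)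
  have "Ck_on k U (partial_deriv i (\<lambda>x. f x + g x))" for i
    by (rule Ck_on_cong[OF Suc.prems(1), of "\<lambda>x. partial_deriv i f x + partial_deriv i g x"])
       (use Suc in \<open>auto simp: partial_deriv_add\<close>)
  with Suc show ?case by (auto intro: differentiable_add)
qed

lemma Ck_on_mult: "open U \<Longrightarrow> Ck_on k U f \<Longrightarrow> Ck_on k U g \<Longrightarrow> Ck_on k U (\<lambda>x. f x * g x)"
proof (induction k arbitrary: f g)
  case 0
  then show ?case by (auto intro: continuous_intros)
next
  case (Suc k)
  have low: "Ck_on k U f" "Ck_on k U g" using Suc.prems Ck_on_lower by blast+
  have "Ck_on k U (partial_deriv i (\<lambda>x. f x * g x))" for i
    by (rule Ck_on_cong[OF Suc.prems(1), of "\<lambda>x. f x * partial_deriv i g x + partial_deriv i f x * g x"])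
       (use Suc low in \<open>auto simp: partial_deriv_mult intro!: Ck_on_add\<close>)
  with Suc show ?case by (auto intro: differentiable_mult)
qed

text \<open>A smooth function of one variable together with all its derivatives, so that the derivatives of
  a composition can be named.\<close>
definition deriv_seq :: "(nat \<Rightarrow> real \<Rightarrow> real) \<Rightarrow> bool" where
  "deriv_seq D \<longleftrightarrow> (\<forall>m t. (D m has_real_derivative D (Suc m) t) (at t))"

lemma has_derivative_compose_real:
  assumes "(h has_real_derivative h') (at (f x))" "(f has_derivative f') (at x)"
  shows "((\<lambda>x. h (f x)) has_derivative (\<lambda>v. h' * f' v)) (at x)"
  using has_derivative_compose[OF assms(2), of h "\<lambda>v. h' * v"] assms(1)
  by (simp add: has_field_derivative_def)

lemma partial_deriv_compose:
  assumes "deriv_seq D" "f differentiable (at x)"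
  shows "partial_deriv i (\<lambda>x. D m (f x)) x = D (Suc m) (f x) * partial_deriv i f x"
  using partial_deriv_has_derivative[OF has_derivative_compose_real[OF _ differentiable_frechet[OF assms(2)]], of "D m" "D (Suc m) (f x)"]
    assms(1) by (simp add: partial_deriv_def deriv_seq_def)

lemma differentiable_compose_seq:
  assumes "deriv_seq D" "f differentiable (at x)"
  shows "(\<lambda>x. D m (f x)) differentiable (at x)"
  using has_derivative_compose_real[OF _ differentiable_frechet[OF assms(2)], of "D m" "D (Suc m) (f x)"]
    assms(1) by (auto simp: deriv_seq_def intro: differentiableI)

lemma Ck_on_compose:
  assumes D: "deriv_seq D" and "open U"
  shows "Ck_on k U f \<Longrightarrow> Ck_on k U (\<lambda>x. D m (f x))"
proof (induction k arbitrary: m)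
  case 0
  have "continuous_on UNIV (D m)"
    using D by (auto simp: deriv_seq_def intro!: continuous_at_imp_continuous_on DERIV_isCont)
  then show ?case using 0 continuous_on_compose2[of UNIV "D m" U f] by simp
next
  case (Suc k)
  have "Ck_on k U (partial_deriv i (\<lambda>x. D m (f x)))" for i
    by (rule Ck_on_cong[OF assms(2), of "\<lambda>x. D (Suc m) (f x) * partial_deriv i f x"])
       (use Suc Ck_on_lower[OF Suc.prems] D in \<open>auto simp: partial_deriv_compose intro!: Ck_on_mult[OF assms(2)]\<close>)
  with Suc D show ?case by (auto intro: differentiable_compose_seq)
qed

lemma Ck_on_coord: "Ck_on k U (\<lambda>x. x $ i)"
proof (cases k)
  case (Suc j)
  have "partial_deriv j (\<lambda>x. x $ i) = (\<lambda>x. if i = j then 1 else 0)" for j :: 'a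
    by (simp add: partial_deriv_coord fun_eq_iff)
  moreover have "(\<lambda>x. x $ i) differentiable (at x)" for x :: "real ^ 'a"
    by (rule bounded_linear_imp_differentiable[OF bounded_linear_vec_nth])
  ultimately show ?thesis using Suc Ck_on_const by auto
qed (auto intro: continuous_intros)

lemma smooth_on_const [intro]: "smooth_on U (\<lambda>x. c)"
  by (simp add: smooth_on_def Ck_on_const)

lemma smooth_on_coord [intro]: "smooth_on U (\<lambda>x. x $ i)"
  by (simp add: smooth_on_def Ck_on_coord)

lemma smooth_on_add [intro]:
  "open U \<Longrightarrow> smooth_on U f \<Longrightarrow> smooth_on U g \<Longrightarrow> smooth_on U (\<lambda>x. f x + g x)"
  by (simp add: smooth_on_def Ck_on_add)

lemma smooth_on_mult [intro]:
  "open U \<Longrightarrow> smooth_on U f \<Longrightarrow> smooth_on U g \<Longrightarrow> smooth_on U (\<lambda>x. f x * g x)"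
  by (simp add: smooth_on_def Ck_on_mult)

lemma smooth_on_diff [intro]:
  "open U \<Longrightarrow> smooth_on U f \<Longrightarrow> smooth_on U g \<Longrightarrow> smooth_on U (\<lambda>x. f x - g x)"
  using smooth_on_add[of U f "\<lambda>x. (- 1) * g x"] smooth_on_mult[of U "\<lambda>x. - 1" g] smooth_on_const
  by auto

lemma smooth_on_sum [intro]:
  assumes "open U" "\<And>i. i \<in> I \<Longrightarrow> smooth_on U (f i)"
  shows "smooth_on U (\<lambda>x. \<Sum>i\<in>I. f i x)"
  using assms(2)
  by (induction I rule: infinite_finite_induct) (use assms(1) in auto)

lemma smooth_on_inner_self [intro]: 
  assumes "open U" shows "smooth_on U (\<lambda>x. (x - a) \<bullet> (x - a))"
proof -
  have "(x - a) \<bullet> (x - a) = (\<Sum>i\<in>UNIV. (x $ i - a $ i) * (x $ i - a $ i))" for x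
    by (simp add: inner_vec_def)
  moreover have "smooth_on U (\<lambda>x. \<Sum>i\<in>UNIV. (x $ i - a $ i) * (x $ i - a $ i))"
    using assms by (intro smooth_on_sum smooth_on_mult smooth_on_diff smooth_on_coord smooth_on_const)
  ultimately show ?thesis by simp
qed

lemma smooth_on_compose:
  "deriv_seq D \<Longrightarrow> open U \<Longrightarrow> smooth_on U f \<Longrightarrow> smooth_on U (\<lambda>x. D m (f x))"
  by (simp add: smooth_on_def Ck_on_compose)

lemma smooth_on_subset: "smooth_on U f \<Longrightarrow> V \<subseteq> U \<Longrightarrow> smooth_on V f"
  unfolding smooth_on_def by (blast intro: Ck_on_subset)

lemma smooth_on_cong:
  "open U \<Longrightarrow> (\<And>x. x \<in> U \<Longrightarrow> f x = g x) \<Longrightarrow> smooth_on U f \<Longrightarrow> smooth_on U g"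
  using Ck_on_cong unfolding smooth_on_def by blast

lemma smooth_on_Un: "open U \<Longrightarrow> open V \<Longrightarrow> smooth_on U f \<Longrightarrow> smooth_on V f \<Longrightarrow> smooth_on (U \<union> V) f"
  by (simp add: smooth_on_def Ck_on_Un)

lemma smooth_on_partial_deriv: "smooth_on U f \<Longrightarrow> smooth_on U (partial_deriv i f)"
  unfolding smooth_on_def using Ck_on.simps(2) by blast

lemma smooth_on_differentiable: "smooth_on U f \<Longrightarrow> x \<in> U \<Longrightarrow> f differentiable (at x)"
  unfolding smooth_on_def using Ck_on.simps(2) by blast

lemma smooth_on_continuous: "smooth_on U f \<Longrightarrow> continuous_on U f"
  unfolding smooth_on_def using Ck_on.simps(1) by blast

section \<open>Gradient and Hessian\<close>

lemma has_derivative_grad: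
  fixes f :: "real ^ 'n \<Rightarrow> real"
  assumes "f differentiable (at x)"
  shows "(f has_derivative (\<lambda>v. grad f x \<bullet> v)) (at x)"
proof -
  have lin: "linear (frechet_derivative f (at x))" using assms by (rule linear_frechet_derivative)
  have "frechet_derivative f (at x) v = grad f x \<bullet> v" for v
  proof -
    have "frechet_derivative f (at x) v = frechet_derivative f (at x) (\<Sum>i\<in>UNIV. (v $ i) *\<^sub>R axis i 1)"
      using basis_expansion[of v] by (simp add: scalar_mult_eq_scaleR)
    also have "\<dots> = (\<Sum>i\<in>UNIV. (v $ i) * frechet_derivative f (at x) (axis i 1))"
      by (simp add: linear_sum[OF lin] linear_scale[OF lin])
    also have "\<dots> = grad f x \<bullet> v" by (simp add: grad_def inner_vec_def partial_deriv_def mult.commute)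
    finally show ?thesis .
  qed
  then have "frechet_derivative f (at x) = (\<lambda>v. grad f x \<bullet> v)" by auto
  then show ?thesis using differentiable_frechet[OF assms] by simp
qed

lemma DERIV_along_curve:
  fixes f :: "real ^ 'n \<Rightarrow> real"
  assumes "f differentiable (at (\<gamma> t))" "(\<gamma> has_vector_derivative w) (at t)"
  shows "((\<lambda>t. f (\<gamma> t)) has_real_derivative (grad f (\<gamma> t) \<bullet> w)) (at t)"
proof -
  have "(\<gamma> has_derivative (\<lambda>s. s *\<^sub>R w)) (at t)"
    using assms(2) by (simp add: has_vector_derivative_def)
  from has_derivative_compose[where g = f, OF this has_derivative_grad[OF assms(1)]]
  have "((\<lambda>t. f (\<gamma> t)) has_derivative (\<lambda>s. grad f (\<gamma> t) \<bullet> (s *\<^sub>R w))) (at t)" .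
  moreover have "(\<lambda>s. grad f (\<gamma> t) \<bullet> (s *\<^sub>R w)) = (*) (grad f (\<gamma> t) \<bullet> w)" by auto
  ultimately show ?thesis by (simp add: has_field_derivative_def)
qed

text \<open>The mean value theorem, applied first in the direction \<open>i\<close> and then in the direction \<open>j\<close>.\<close>
lemma second_difference_mean_value:
  fixes f :: "real ^ 'n \<Rightarrow> real"
  assumes f: "smooth_on U f" and h: "0 < h"
    and U: "\<And>s t. 0 \<le> s \<Longrightarrow> s \<le> h \<Longrightarrow> 0 \<le> t \<Longrightarrow> t \<le> h \<Longrightarrow> x + s *\<^sub>R axis i 1 + t *\<^sub>R axis j 1 \<in> U"
  obtains s t where "0 < s" "s < h" "0 < t" "t < h"
    "f (x + h *\<^sub>R axis i 1 + h *\<^sub>R axis j 1) - f (x + h *\<^sub>R axis i 1) - f (x + h *\<^sub>R axis j 1) + f x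
      = h * (h * partial_deriv j (partial_deriv i f) (x + s *\<^sub>R axis i 1 + t *\<^sub>R axis j 1))"
proof -
  let ?p = "\<lambda>s t. x + s *\<^sub>R axis i 1 + t *\<^sub>R axis j 1"
  have g: "grad f y \<bullet> axis k 1 = partial_deriv k f y" for f y k
    by (simp add: grad_def inner_axis)
  have d1: "((\<lambda>s. f (?p s t)) has_real_derivative partial_deriv i f (?p s t)) (at s)"
    if "0 \<le> s" "s \<le> h" "0 \<le> t" "t \<le> h" for s t
  proof -
    have "((\<lambda>s. ?p s t) has_vector_derivative axis i 1) (at s)"
      by (auto intro!: derivative_eq_intros)
    from DERIV_along_curve[OF smooth_on_differentiable[OF f U[OF that]] this] show ?thesis by (simp add: g)
  qed
  have d2: "((\<lambda>t. partial_deriv i f (?p s t)) has_real_derivative partial_deriv j (partial_deriv i f) (?p s t)) (at t)"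
    if "0 \<le> s" "s \<le> h" "0 \<le> t" "t \<le> h" for s t
  proof -
    have "((\<lambda>t. ?p s t) has_vector_derivative axis j 1) (at t)"
      by (auto intro!: derivative_eq_intros)
    from DERIV_along_curve[OF smooth_on_differentiable[OF smooth_on_partial_deriv[OF f] U[OF that]] this]
    show ?thesis by (simp add: g)
  qed
  have "\<exists>s>0. s < h \<and> (f (?p h h) - f (?p h 0)) - (f (?p 0 h) - f (?p 0 0))
      = (h - 0) * (partial_deriv i f (?p s h) - partial_deriv i f (?p s 0))"
    by (rule MVT2[OF h, of "\<lambda>s. f (?p s h) - f (?p s 0)"]) (use d1[of _ h] d1[of _ 0] h in \<open>auto intro!: DERIV_diff\<close>)
  then obtain s where s: "0 < s" "s < h"
    "(f (?p h h) - f (?p h 0)) - (f (?p 0 h) - f (?p 0 0)) = h * (partial_deriv i f (?p s h) - partial_deriv i f (?p s 0))"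
    by auto
  have "\<exists>t>0. t < h \<and> partial_deriv i f (?p s h) - partial_deriv i f (?p s 0)
      = (h - 0) * partial_deriv j (partial_deriv i f) (?p s t)"
    by (rule MVT2[OF h]) (use d2 s in auto)
  then obtain t where t: "0 < t" "t < h"
    "partial_deriv i f (?p s h) - partial_deriv i f (?p s 0) = h * partial_deriv j (partial_deriv i f) (?p s t)"
    by auto
  show ?thesis
    by (rule that[OF s(1,2) t(1,2)]) (use s(3) t(3) in simp)
qed

text \<open>The second difference is symmetric in the two directions, so it is \<open>h\<^sup>2\<close> times each of the two mixed
  partials at points within distance \<open>2 h\<close> of \<open>x\<close>. Continuity does the rest.\<close>
lemma mixed_partials_commute:
  fixes f :: "real ^ 'n \<Rightarrow> real"
  assumes "open U" and f: "smooth_on U f" and x: "x \<in> U"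
  shows "partial_deriv i (partial_deriv j f) x = partial_deriv j (partial_deriv i f) x"
proof (rule ccontr)
  define A where "A = (\<lambda>i j. partial_deriv j (partial_deriv i f))"
  assume "partial_deriv i (partial_deriv j f) x \<noteq> partial_deriv j (partial_deriv i f) x"
  then have ne: "A i j x \<noteq> A j i x" by (simp add: A_def)
  define \<epsilon> where "\<epsilon> = \<bar>A i j x - A j i x\<bar> / 2"
  have \<epsilon>: "\<epsilon> > 0" using ne by (simp add: \<epsilon>_def)
  have near: "\<exists>d>0. \<forall>y. dist y x < d \<longrightarrow> y \<in> U \<and> \<bar>A i j y - A i j x\<bar> < \<epsilon>" for i j
  proof -
    have "continuous_on U (A i j)"
      unfolding A_def by (intro smooth_on_continuous smooth_on_partial_deriv f)
    then have "isCont (A i j) x" using assms(1) x by (simp add: continuous_on_eq_continuous_at)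
    then obtain d1 where d1: "d1 > 0" "\<And>y. dist y x < d1 \<Longrightarrow> dist (A i j y) (A i j x) < \<epsilon>"
      using \<epsilon> unfolding continuous_at_eps_delta by meson
    obtain d2 where d2: "d2 > 0" "ball x d2 \<subseteq> U" using assms(1) x openE by blast
    show ?thesis
      by (rule exI[of _ "min d1 d2"]) (use d1 d2 in \<open>auto simp: dist_real_def dist_commute subset_iff\<close>)
  qed
  obtain d1 where d1: "d1 > 0" "\<And>y. dist y x < d1 \<Longrightarrow> y \<in> U \<and> \<bar>A i j y - A i j x\<bar> < \<epsilon>"
    using near[of i j] by blast
  obtain d2 where d2: "d2 > 0" "\<And>y. dist y x < d2 \<Longrightarrow> y \<in> U \<and> \<bar>A j i y - A j i x\<bar> < \<epsilon>"
    using near[of j i] by blast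
  \<comment> \<open>The whole square of side \<open>h\<close> at \<open>x\<close> then stays within distance \<open>2 h < min d1 d2\<close>.\<close>
  define h where "h = min d1 d2 / 3"
  have h: "0 < h" using d1 d2 by (simp add: h_def)
  have close: "dist (x + s *\<^sub>R axis i 1 + t *\<^sub>R axis j 1) x < min d1 d2"
    if "0 \<le> s" "s \<le> h" "0 \<le> t" "t \<le> h" for s t and i j :: 'n
  proof -
    have "norm (s *\<^sub>R axis i (1::real) + t *\<^sub>R axis j 1) \<le> norm (s *\<^sub>R axis i (1::real)) + norm (t *\<^sub>R axis j (1::real))"
      by (rule norm_triangle_ineq)
    also have "\<dots> \<le> 2 * h" using that by simp
    also have "\<dots> < 3 * h" using h by simp
    also have "\<dots> = min d1 d2" by (simp add: h_def)
    finally show ?thesis by (simp add: dist_norm algebra_simps)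
  qed
  define \<Delta> where "\<Delta> = f (x + h *\<^sub>R axis i 1 + h *\<^sub>R axis j 1) - f (x + h *\<^sub>R axis i 1) - f (x + h *\<^sub>R axis j 1) + f x"
  obtain s t where st: "0 < s" "s < h" "0 < t" "t < h" "\<Delta> = h * (h * A i j (x + s *\<^sub>R axis i 1 + t *\<^sub>R axis j 1))"
    unfolding \<Delta>_def A_def
    by (rule second_difference_mean_value[OF f h, of x i j]) (use close d1 in force)+
  obtain s' t' where st': "0 < s'" "s' < h" "0 < t'" "t' < h" "\<Delta> = h * (h * A j i (x + s' *\<^sub>R axis j 1 + t' *\<^sub>R axis i 1))"
  proof (rule second_difference_mean_value[OF f h, of x j i])
    show "x + s *\<^sub>R axis j 1 + t *\<^sub>R axis i 1 \<in> U" if "0 \<le> s" "s \<le> h" "0 \<le> t" "t \<le> h" for s t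
      using close[OF that, of j i] d1 by force
  next
    fix s t
    assume st: "0 < s" "s < h" "0 < t" "t < h"
      "f (x + h *\<^sub>R axis j 1 + h *\<^sub>R axis i 1) - f (x + h *\<^sub>R axis j 1) - f (x + h *\<^sub>R axis i 1) + f x
      = h * (h * partial_deriv i (partial_deriv j f) (x + s *\<^sub>R axis j 1 + t *\<^sub>R axis i 1))"
    have "x + h *\<^sub>R axis j 1 + h *\<^sub>R axis i 1 = x + h *\<^sub>R axis i 1 + h *\<^sub>R axis j 1"
      by (simp add: algebra_simps)
    with st show thesis by (intro that[of s t]) (auto simp: \<Delta>_def A_def)
  qed
  have "A i j (x + s *\<^sub>R axis i 1 + t *\<^sub>R axis j 1) = A j i (x + s' *\<^sub>R axis j 1 + t' *\<^sub>R axis i 1)"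
    using st(5) st'(5) h by simp
  moreover have "\<bar>A i j (x + s *\<^sub>R axis i 1 + t *\<^sub>R axis j 1) - A i j x\<bar> < \<epsilon>"
    using d1 close[of s t i j] st by simp
  moreover have "\<bar>A j i (x + s' *\<^sub>R axis j 1 + t' *\<^sub>R axis i 1) - A j i x\<bar> < \<epsilon>"
    using d2 close[of s' t' j i] st' by simp
  ultimately have "\<bar>A i j x - A j i x\<bar> < 2 * \<epsilon>" by linarith
  then show False by (simp add: \<epsilon>_def)
qed

lemma hessian_symmetric:
  "open U \<Longrightarrow> smooth_on U f \<Longrightarrow> x \<in> U \<Longrightarrow> transpose (hessian f x) = hessian f x"
  by (simp add: transpose_def hessian_def vec_eq_iff) (blast intro: mixed_partials_commute)

definition hess_form :: "(real ^ 'n \<Rightarrow> real) \<Rightarrow> real ^ 'n \<Rightarrow> real ^ 'n \<Rightarrow> real" where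
  "hess_form f x y = y \<bullet> (hessian f x *v y)"

lemma hess_form_eq:
  "hess_form f x y = (\<Sum>i\<in>UNIV. \<Sum>j\<in>UNIV. partial_deriv i (partial_deriv j f) x * (y $ i * y $ j))"
  by (simp add: hess_form_def hessian_def inner_vec_def matrix_vector_mult_def sum_distrib_left mult_ac)

lemma grad_inner_eq: "grad f x \<bullet> y = (\<Sum>i\<in>UNIV. partial_deriv i f x * y $ i)"
  by (simp add: grad_def inner_vec_def)

lemma has_derivative_grad_field:
  assumes "open U" "smooth_on U f" "x \<in> U"
  shows "(grad f has_derivative (\<lambda>v. hessian f x *v v)) (at x)"
proof -
  have "((\<lambda>y. grad f y $ i) has_derivative (\<lambda>v. (hessian f x *v v) $ i)) (at x)" for i
  proof -
    have "((partial_deriv i f) has_derivative (\<lambda>v. grad (partial_deriv i f) x \<bullet> v)) (at x)"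
      by (intro has_derivative_grad smooth_on_differentiable[OF smooth_on_partial_deriv[OF assms(2)] assms(3)])
    moreover have "grad (partial_deriv i f) x \<bullet> v = (hessian f x *v v) $ i" for v
      by (simp add: grad_inner_eq matrix_vector_mult_def hessian_def mixed_partials_commute[OF assms, of i])
    ultimately show ?thesis by (simp add: grad_def)
  qed
  then show ?thesis
    by (subst has_derivative_componentwise_within) (auto simp: Basis_vec_def inner_axis)
qed

lemma partial_deriv_cong_open:
  assumes "open U" "x \<in> U" "\<And>y. y \<in> U \<Longrightarrow> f y = g y" "f differentiable (at x)"
  shows "partial_deriv i f x = partial_deriv i g x"
  unfolding partial_deriv_def
  using frechet_derivative_transform_within_open[OF assms(4,1,2,3)] by simp

lemma hess_form_cong_open:
  assumes "open U" "smooth_on U f" "\<And>y. y \<in> U \<Longrightarrow> f y = g y" "x \<in> U"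
  shows "hess_form f x y = hess_form g x y"
proof -
  have 1: "partial_deriv j f z = partial_deriv j g z" if "z \<in> U" for z j
    by (rule partial_deriv_cong_open[OF assms(1) that assms(3) smooth_on_differentiable[OF assms(2) that]])
  have "partial_deriv i (partial_deriv j f) x = partial_deriv i (partial_deriv j g) x" for i j
    by (rule partial_deriv_cong_open[OF assms(1,4) 1])
       (use smooth_on_differentiable[OF smooth_on_partial_deriv[OF assms(2)] assms(4)] in auto)
  then show ?thesis by (simp add: hess_form_eq)
qed

lemma partial_deriv_add_smooth:
  assumes "open U" "smooth_on U f" "smooth_on U g" "x \<in> U"
  shows "partial_deriv i (partial_deriv j (\<lambda>x. f x + g x)) x
    = partial_deriv i (partial_deriv j f) x + partial_deriv i (partial_deriv j g) x"
proof -
  note d = smooth_on_differentiable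
  have dp: "partial_deriv j f differentiable (at x)" "partial_deriv j g differentiable (at x)"
    using assms by (blast intro: d smooth_on_partial_deriv)+
  have "partial_deriv i (partial_deriv j (\<lambda>x. f x + g x)) x = partial_deriv i (\<lambda>x. partial_deriv j f x + partial_deriv j g x) x"
  proof (rule partial_deriv_cong_open[OF assms(1,4), symmetric])
    show "partial_deriv j f y + partial_deriv j g y = partial_deriv j (\<lambda>x. f x + g x) y" if "y \<in> U" for y
      using partial_deriv_add[OF d[OF assms(2) that] d[OF assms(3) that]] by simp
    show "(\<lambda>x. partial_deriv j f x + partial_deriv j g x) differentiable at x"
      by (rule differentiable_add[OF dp])
  qed
  also have "\<dots> = partial_deriv i (partial_deriv j f) x + partial_deriv i (partial_deriv j g) x"
    by (rule partial_deriv_add[OF dp])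
  finally show ?thesis .
qed

lemma hess_form_add:
  assumes "open U" "smooth_on U f" "smooth_on U g" "x \<in> U"
  shows "hess_form (\<lambda>x. f x + g x) x y = hess_form f x y + hess_form g x y"
  by (simp add: hess_form_eq partial_deriv_add_smooth[OF assms] distrib_right sum.distrib)

lemma hess_form_compose:
  assumes D: "deriv_seq D" and "open U" "smooth_on U f" "x \<in> U"
  shows "hess_form (\<lambda>x. D m (f x)) x y
    = D (Suc m) (f x) * hess_form f x y + D (Suc (Suc m)) (f x) * (grad f x \<bullet> y)\<^sup>2"
proof -
  note d = smooth_on_differentiable
  have "partial_deriv i (partial_deriv j (\<lambda>x. D m (f x))) x
      = D (Suc m) (f x) * partial_deriv i (partial_deriv j f) x
        + D (Suc (Suc m)) (f x) * partial_deriv i f x * partial_deriv j f x" for i j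
  proof -
    have dc: "(\<lambda>x. D (Suc m) (f x)) differentiable (at x)" if "x \<in> U" for x
      using differentiable_compose_seq[OF D] d assms that by blast
    have dp: "partial_deriv j f differentiable (at x)" if "x \<in> U" for x
      using smooth_on_partial_deriv d assms that by blast
    have "partial_deriv i (partial_deriv j (\<lambda>x. D m (f x))) x = partial_deriv i (\<lambda>x. D (Suc m) (f x) * partial_deriv j f x) x"
      by (rule partial_deriv_cong_open[OF assms(2,4), symmetric])
         (use partial_deriv_compose[OF D] d assms dc dp in \<open>force intro: differentiable_mult\<close>)+
    also have "\<dots> = D (Suc m) (f x) * partial_deriv i (partial_deriv j f) x
        + D (Suc (Suc m)) (f x) * partial_deriv i f x * partial_deriv j f x"
      using partial_deriv_mult[OF dc dp] partial_deriv_compose[OF D d[OF assms(3,4)]] assms(4) by simp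
    finally show ?thesis .
  qed
  then have "hess_form (\<lambda>x. D m (f x)) x y
    = (\<Sum>i\<in>UNIV. \<Sum>j\<in>UNIV. D (Suc m) (f x) * (partial_deriv i (partial_deriv j f) x * (y $ i * y $ j))
        + D (Suc (Suc m)) (f x) * ((partial_deriv i f x * y $ i) * (partial_deriv j f x * y $ j)))"
    by (simp add: hess_form_eq algebra_simps)
  also have "\<dots> = D (Suc m) (f x) * hess_form f x y + D (Suc (Suc m)) (f x) * (grad f x \<bullet> y)\<^sup>2"
    unfolding power2_eq_square hess_form_eq grad_inner_eq sum_product
    by (simp add: sum.distrib sum_distrib_left)
  finally show ?thesis .
qed

lemma grad_add:
  "f differentiable (at x) \<Longrightarrow> g differentiable (at x) \<Longrightarrow> grad (\<lambda>x. f x + g x) x = grad f x + grad g x"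
  by (simp add: grad_def partial_deriv_add vec_eq_iff)

lemma grad_compose:
  "deriv_seq D \<Longrightarrow> f differentiable (at x) \<Longrightarrow> grad (\<lambda>x. D m (f x)) x = D (Suc m) (f x) *\<^sub>R grad f x"
  by (simp add: grad_def partial_deriv_compose vec_eq_iff)

lemma grad_mult:
  "f differentiable (at x) \<Longrightarrow> g differentiable (at x) \<Longrightarrow>
    grad (\<lambda>x. f x * g x) x = f x *\<^sub>R grad g x + g x *\<^sub>R grad f x"
  by (simp add: grad_def partial_deriv_mult vec_eq_iff)

definition entry_sum :: "real ^ 'n ^ 'n \<Rightarrow> real" where
  "entry_sum A = (\<Sum>i\<in>UNIV. \<Sum>j\<in>UNIV. \<bar>A $ i $ j\<bar>)"

lemma quadratic_form_bound: "\<bar>y \<bullet> (A *v y)\<bar> \<le> entry_sum A * (y \<bullet> y)"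
proof -
  have "\<bar>y \<bullet> (A *v y)\<bar> = \<bar>\<Sum>i\<in>UNIV. \<Sum>j\<in>UNIV. A $ i $ j * (y $ i * y $ j)\<bar>"
    by (simp add: inner_vec_def matrix_vector_mult_def sum_distrib_left mult_ac)
  also have "\<dots> \<le> (\<Sum>i\<in>UNIV. \<Sum>j\<in>UNIV. \<bar>A $ i $ j * (y $ i * y $ j)\<bar>)"
    by (intro order_trans[OF sum_abs] sum_mono order_trans[OF sum_abs]) simp
  also have "\<dots> \<le> (\<Sum>i\<in>UNIV. \<Sum>j\<in>UNIV. \<bar>A $ i $ j\<bar> * (y \<bullet> y))"
  proof (intro sum_mono)
    fix i j
    have "\<bar>y $ i\<bar> * \<bar>y $ j\<bar> \<le> norm y * norm y"
      by (intro mult_mono component_le_norm_cart) auto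
    also have "\<dots> = y \<bullet> y" by (simp add: power2_norm_eq_inner[symmetric] power2_eq_square)
    finally show "\<bar>A $ i $ j * (y $ i * y $ j)\<bar> \<le> \<bar>A $ i $ j\<bar> * (y \<bullet> y)"
      by (simp add: abs_mult mult_left_mono)
  qed
  also have "\<dots> = entry_sum A * (y \<bullet> y)" by (simp add: entry_sum_def sum_distrib_right)
  finally show ?thesis .
qed

lemma continuous_on_hessian_entry:
  "smooth_on U f \<Longrightarrow> continuous_on U (\<lambda>x. hessian f x $ i $ j)"
  by (simp add: hessian_def smooth_on_continuous smooth_on_partial_deriv)

lemma continuous_on_grad: "smooth_on U f \<Longrightarrow> continuous_on U (grad f)"
  unfolding grad_def[abs_def]
  by (intro continuous_on_vec_lambda smooth_on_continuous smooth_on_partial_deriv)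

lemma hess_form_bounded_on_compact:
  assumes "smooth_on U f" "compact K" "K \<subseteq> U"
  obtains C where "0 \<le> C" "\<And>x y. x \<in> K \<Longrightarrow> \<bar>hess_form f x y\<bar> \<le> C * (y \<bullet> y)"
proof -
  have "continuous_on K (\<lambda>x. entry_sum (hessian f x))"
    unfolding entry_sum_def
    by (intro continuous_intros continuous_on_subset[OF continuous_on_hessian_entry[OF assms(1)] assms(3)])
  then have "bounded ((\<lambda>x. entry_sum (hessian f x)) ` K)"
    using assms(2) compact_continuous_image compact_imp_bounded by blast
  then obtain C where C: "\<And>x. x \<in> K \<Longrightarrow> \<bar>entry_sum (hessian f x)\<bar> \<le> C"
    unfolding bounded_iff by auto
  show ?thesis
  proof (rule that[of "\<bar>C\<bar>"])
    fix x y assume x: "x \<in> K"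
    have "\<bar>hess_form f x y\<bar> \<le> entry_sum (hessian f x) * (y \<bullet> y)"
      unfolding hess_form_def by (rule quadratic_form_bound)
    also have "\<dots> \<le> \<bar>C\<bar> * (y \<bullet> y)" using C[OF x] by (intro mult_right_mono) auto
    finally show "\<bar>hess_form f x y\<bar> \<le> \<bar>C\<bar> * (y \<bullet> y)" .
  qed simp
qed

text \<open>Coefficients that converge entrywise make the quadratic forms converge uniformly on the unit
  sphere.\<close>
lemma hess_form_rank_one_near:
  fixes f :: "real ^ 'n \<Rightarrow> real"
  assumes "open U" "smooth_on U f" "x0 \<in> U" "\<epsilon> > 0"
  obtains d where "d > 0" "ball x0 d \<subseteq> U"
    "\<And>x y. x \<in> ball x0 d \<Longrightarrow> hess_form f x0 y + A * (grad f x0 \<bullet> y)\<^sup>2 - \<epsilon> * (y \<bullet> y)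
       \<le> hess_form f x y + A * (grad f x \<bullet> y)\<^sup>2"
proof -
  define T where "T = (\<lambda>x. hessian f x + (\<chi> i j. A * (grad f x $ i * grad f x $ j)))"
  have T: "y \<bullet> (T x *v y) = hess_form f x y + A * (grad f x \<bullet> y)\<^sup>2" for x y
  proof -
    have "y \<bullet> ((\<chi> i j. A * (grad f x $ i * grad f x $ j)) *v y)
      = (\<Sum>i\<in>UNIV. \<Sum>j\<in>UNIV. A * ((grad f x $ i * y $ i) * (grad f x $ j * y $ j)))"
      by (simp add: inner_vec_def matrix_vector_mult_def sum_distrib_left mult_ac)
    also have "\<dots> = A * (grad f x \<bullet> y)\<^sup>2"
      unfolding power2_eq_square inner_vec_def by (simp add: sum_product) (simp add: sum_distrib_left)
    finally show ?thesis
      by (simp add: T_def hess_form_def matrix_vector_mult_add_rdistrib inner_add_right)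
  qed
  define g where "g = (\<lambda>x. entry_sum (T x - T x0))"
  have "continuous_on U g"
    unfolding g_def entry_sum_def T_def
    by (auto intro!: continuous_intros continuous_on_hessian_entry[OF assms(2)] continuous_on_grad[OF assms(2)])
  then have "isCont g x0" using assms(1,3) by (simp add: continuous_on_eq_continuous_at)
  moreover have "g x0 = 0" by (simp add: g_def entry_sum_def)
  ultimately obtain d1 where d1: "d1 > 0" "\<And>x. dist x x0 < d1 \<Longrightarrow> \<bar>g x\<bar> < \<epsilon>"
    using assms(4) unfolding continuous_at_eps_delta by (metis dist_0_norm dist_commute real_norm_def)
  obtain d2 where d2: "d2 > 0" "ball x0 d2 \<subseteq> U" using assms(1,3) openE by blast
  show ?thesis
  proof (rule that[of "min d1 d2"])
    show "min d1 d2 > 0" "ball x0 (min d1 d2) \<subseteq> U" using d1 d2 by auto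
    fix x y :: "real ^ 'n" assume "x \<in> ball x0 (min d1 d2)"
    then have "g x \<le> \<epsilon>" using d1(2)[of x] by (simp add: dist_commute)
    then have "g x * (y \<bullet> y) \<le> \<epsilon> * (y \<bullet> y)" by (simp add: mult_right_mono)
    moreover have "\<bar>y \<bullet> ((T x - T x0) *v y)\<bar> \<le> g x * (y \<bullet> y)"
      unfolding g_def by (rule quadratic_form_bound)
    moreover have "y \<bullet> ((T x - T x0) *v y) = y \<bullet> (T x *v y) - y \<bullet> (T x0 *v y)"
      by (simp add: matrix_vector_mult_diff_rdistrib inner_diff_right)
    ultimately show "hess_form f x0 y + A * (grad f x0 \<bullet> y)\<^sup>2 - \<epsilon> * (y \<bullet> y)
       \<le> hess_form f x y + A * (grad f x \<bullet> y)\<^sup>2" unfolding T by linarith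
  qed
qed

lemma hess_form_half_square: "hess_form (\<lambda>x. (x \<bullet> x - R) / 2) x y = y \<bullet> y"
proof -
  have 1: "partial_deriv j (\<lambda>x. (x \<bullet> x - R) / 2) = (\<lambda>x. x $ j)" for j :: 'a
  proof
    fix x :: "real ^ 'a"
    have "((\<lambda>x. (x \<bullet> x - R) / 2) has_derivative (\<lambda>h. (x \<bullet> h + h \<bullet> x) / 2)) (at x)"
      by (auto intro!: derivative_eq_intros simp: field_simps)
    from partial_deriv_has_derivative[OF this]
    show "partial_deriv j (\<lambda>x. (x \<bullet> x - R) / 2) x = x $ j" by (simp add: inner_axis inner_commute)
  qed
  show ?thesis
    unfolding hess_form_eq 1 partial_deriv_coord by (simp add: inner_vec_def mult_delta_left)
qed

section \<open>The flat function\<close>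

primrec flat_poly :: "nat \<Rightarrow> real poly" where
  "flat_poly 0 = 1"
| "flat_poly (Suc m) = [:0, 0, 1:] * (flat_poly m - pderiv (flat_poly m))"

text \<open>The \<open>m\<close>-th derivative of \<open>exp (- 1 / t)\<close>, extended by \<open>0\<close> to \<open>t \<le> 0\<close>.\<close>
definition flat :: "nat \<Rightarrow> real \<Rightarrow> real" where
  "flat m t = (if t > 0 then poly (flat_poly m) (1 / t) * exp (- (1 / t)) else 0)"

lemma poly_times_exp_neg_tendsto_0: "((\<lambda>y. poly p y * exp (- y)) \<longlongrightarrow> (0::real)) at_top"
proof -
  have "((\<lambda>y. \<Sum>i\<le>degree p. coeff p i * (y ^ i / exp y)) \<longlongrightarrow> (\<Sum>i\<le>degree p. coeff p i * 0)) at_top"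
    by (intro tendsto_intros tendsto_power_div_exp_0)
  then show ?thesis by (simp add: poly_altdef exp_minus sum_distrib_right divide_inverse mult.assoc)
qed

text \<open>At \<open>0\<close> the difference quotient is a polynomial in \<open>1 / t\<close> times \<open>exp (- 1 / t)\<close>, which tends to \<open>0\<close>.\<close>
lemma deriv_seq_flat: "deriv_seq flat"
  unfolding deriv_seq_def
proof (intro allI)
  fix m and t :: real
  consider "t > 0" | "t < 0" | "t = 0" by linarith
  then show "(flat m has_real_derivative flat (Suc m) t) (at t)"
  proof cases
    case 1
    have "((\<lambda>t. poly (flat_poly m) (1 / t) * exp (- (1 / t))) has_real_derivative flat (Suc m) t) (at t)"
      using 1 by (auto intro!: derivative_eq_intros simp: flat_def power2_eq_square field_simps)
    then show ?thesis
      by (rule has_field_derivative_transform_within_open[of _ _ _ "{0<..}"]) (use 1 in \<open>auto simp: flat_def\<close>)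
  next
    case 2
    have "((\<lambda>t. 0) has_real_derivative flat (Suc m) t) (at t)" using 2 by (simp add: flat_def)
    then show ?thesis
      by (rule has_field_derivative_transform_within_open[of _ _ _ "{..<0}"]) (use 2 in \<open>auto simp: flat_def\<close>)
  next
    case 3
    have "((\<lambda>h. flat m h / h) \<longlongrightarrow> 0) (at_right 0)"
    proof -
      have "((\<lambda>h. poly (pCons 0 (flat_poly m)) (inverse h) * exp (- inverse h)) \<longlongrightarrow> 0) (at_right 0)"
        by (rule filterlim_compose[OF poly_times_exp_neg_tendsto_0 filterlim_inverse_at_top_right])
      then show ?thesis
        by (rule Lim_transform_eventually)
           (auto simp: flat_def eventually_at_right_less field_simps intro!: eventually_at_rightI[of 0 1])
    qed
    moreover have "((\<lambda>h. flat m h / h) \<longlongrightarrow> 0) (at_left 0)"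
      by (rule Lim_transform_eventually[of "\<lambda>_. 0"])
         (auto simp: flat_def intro!: eventually_at_leftI[of "-1" 0])
    ultimately have "((\<lambda>h. flat m h / h) \<longlongrightarrow> 0) (at 0)" by (simp add: filterlim_at_split)
    then show ?thesis using 3 by (simp add: has_field_derivative_iff flat_def)
  qed
qed

lemma flat_0: "flat 0 t = (if t > 0 then exp (- (1 / t)) else 0)"
  and flat_1: "flat 1 t = (if t > 0 then exp (- (1 / t)) / t\<^sup>2 else 0)"
  and flat_2: "flat 2 t = (if t > 0 then exp (- (1 / t)) / t\<^sup>2 * (1 / t\<^sup>2 - 2 / t) else 0)"
  by (auto simp: flat_def numeral_2_eq_2 pderiv_pCons field_simps power2_eq_square)

lemma deriv_seq_affine:
  assumes "deriv_seq D"
  shows "deriv_seq (\<lambda>m t. a * D m (t + b) + (if m = 0 then c else 0))"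
  unfolding deriv_seq_def
proof (intro allI)
  fix m t
  have "(D m has_real_derivative D (Suc m) (t + b)) (at (t + b))" using assms by (simp add: deriv_seq_def)
  then have "((\<lambda>t. D m (t + b)) has_real_derivative D (Suc m) (t + b) * 1) (at t)"
    by (rule DERIV_chain2) (auto intro!: derivative_eq_intros)
  then show "((\<lambda>t. a * D m (t + b) + (if m = 0 then c else 0)) has_real_derivative
      a * D (Suc m) (t + b) + (if Suc m = 0 then c else 0)) (at t)"
    by (auto intro!: derivative_eq_intros)
qed

lemma deriv_seq_exp: "deriv_seq (\<lambda>m t. a * (B ^ m * exp (B * t)) + (if m = 0 then c else 0))"
  unfolding deriv_seq_def by (auto intro!: derivative_eq_intros)

section \<open>Quadratic forms that dominate the cone\<close>

text \<open>Domination of a diagonal form, rather than diagonality, makes the notion monotone in \<open>Q\<close> by definition,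
  and \<open>e\<close> can be a basis adapted to the geometry, such as the principal directions and the normal.\<close>
definition Gamma_form :: "nat \<Rightarrow> (real ^ 'n \<Rightarrow> real) \<Rightarrow> bool" where
  "Gamma_form p Q \<longleftrightarrow> (\<exists>e l. onb e \<and> length l = CARD('n) \<and> in_cone p l \<and>
     (\<forall>y. (\<Sum>i<CARD('n). l ! i * (y \<bullet> e i)\<^sup>2) \<le> Q y))"

lemma Gamma_form_mono: "Gamma_form p Q \<Longrightarrow> (\<And>y. Q y \<le> Q' y) \<Longrightarrow> Gamma_form p Q'"
  unfolding Gamma_form_def by (meson order_trans)

lemma Gamma_form_scale:
  fixes Q :: "real ^ 'n \<Rightarrow> real"
  assumes "Gamma_form p Q" "c > 0"
  shows "Gamma_form p (\<lambda>y. c * Q y)"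
proof -
  obtain e :: "nat \<Rightarrow> real ^ 'n" and l where e: "onb e" and l: "length l = CARD('n)" "in_cone p l"
    and le: "\<And>y. (\<Sum>i<CARD('n). l ! i * (y \<bullet> e i)\<^sup>2) \<le> Q y"
    using assms(1) unfolding Gamma_form_def by blast
  have "(\<Sum>i<CARD('n). map (\<lambda>x. c * x) l ! i * (y \<bullet> e i)\<^sup>2) \<le> c * Q y" for y
  proof -
    have "(\<Sum>i<CARD('n). map (\<lambda>x. c * x) l ! i * (y \<bullet> e i)\<^sup>2) = c * (\<Sum>i<CARD('n). l ! i * (y \<bullet> e i)\<^sup>2)"
      unfolding sum_distrib_left using l(1) by (intro sum.cong) auto
    then show ?thesis using le[of y] assms(2) by simp
  qed
  then show ?thesis unfolding Gamma_form_def
    using e l(1) in_cone_scale[OF assms(2) l(2)]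
    by (intro exI[of _ e] exI[of _ "map (\<lambda>x. c * x) l"]) simp
qed

lemma elem_sym_replicate_pos: "r \<le> n \<Longrightarrow> 0 < d \<Longrightarrow> elem_sym r (replicate n d) > 0"
proof (induction n arbitrary: r)
  case (Suc n)
  show ?case
  proof (cases r)
    case (Suc k)
    have "elem_sym (Suc k) (replicate n d) \<ge> 0"
      using Suc.IH[of "Suc k"] Suc.prems by (cases "Suc k \<le> n") (auto simp: elem_sym_gt_length less_imp_le)
    moreover have "d * elem_sym k (replicate n d) > 0"
      using Suc.IH[of k] Suc.prems Suc by simp
    ultimately show ?thesis using Suc by (simp add: elem_sym_Cons)
  qed simp
qed simp

lemma Gamma_form_imp_le_CARD:
  fixes Q :: "real ^ 'n \<Rightarrow> real"
  assumes "Gamma_form p Q"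
  shows "p \<le> CARD('n)"
proof (rule ccontr)
  assume p: "\<not> p \<le> CARD('n)"
  obtain l where l: "length l = CARD('n)" "in_cone p l"
    using assms unfolding Gamma_form_def by blast
  then have "elem_sym p l = 0" using p by (intro elem_sym_gt_length) simp
  moreover have "elem_sym p l > 0" using l(2) by (simp add: in_cone_def)
  ultimately show False by simp
qed

lemma Gamma_form_scalar:
  assumes "p \<le> CARD('n)" "d > 0"
  shows "Gamma_form p (\<lambda>y :: real ^ 'n. d * (y \<bullet> y))"
proof -
  obtain e :: "nat \<Rightarrow> real ^ 'n" where e: "onb e"
    using symmetric_orthonormal_eigenvectors[of "mat 1 :: real ^ 'n ^ 'n" "CARD('n)"]
    unfolding onb_def by (auto simp: transpose_mat)
  have "in_cone p (replicate CARD('n) d)"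
    using assms by (auto simp: in_cone_def intro: elem_sym_replicate_pos)
  moreover have "(\<Sum>i<CARD('n). replicate CARD('n) d ! i * (y \<bullet> e i)\<^sup>2) = d * (y \<bullet> y)" for y
    unfolding onb_parseval[OF e, symmetric] sum_distrib_left by (intro sum.cong) auto
  ultimately show ?thesis unfolding Gamma_form_def
    by (intro exI[of _ e] exI[of _ "replicate CARD('n) d"]) (use e in simp)
qed

lemma Gamma_form_add_scalar:
  fixes Q :: "real ^ 'n \<Rightarrow> real"
  assumes "Gamma_form p Q" "c \<ge> 0" "d > 0"
  shows "Gamma_form p (\<lambda>y. c * Q y + d * (y \<bullet> y))"
proof (cases "c = 0")
  case True
  then show ?thesis using Gamma_form_scalar[OF Gamma_form_imp_le_CARD[OF assms(1)] assms(3)] by simp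
next
  case False
  then show ?thesis
    using Gamma_form_mono[OF Gamma_form_scale[OF assms(1), of c], of "\<lambda>y. c * Q y + d * (y \<bullet> y)"] assms by simp
qed

lemma eigenvals_of_Gamma_form:
  fixes M :: "real ^ 'n ^ 'n"
  assumes "transpose M = M" "Gamma_form p Q" "1 \<le> p" "0 \<le> c" "0 \<le> B"
    and "\<And>y. Q y + c * (y \<bullet> y) + B * (y \<bullet> \<xi>)\<^sup>2 \<le> y \<bullet> (M *v y)"
  shows "eigenvals M \<in> Gamma_cone CARD('n) p"
    and "c ^ p + c ^ (p - 1) * (B * (\<xi> \<bullet> \<xi>)) \<le> elem_sym p (eigenvals M)"
proof -
  obtain e :: "nat \<Rightarrow> real ^ 'n" and l where e: "onb e" and l: "length l = CARD('n)" "in_cone p l"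
    and le: "\<And>y. (\<Sum>i<CARD('n). l ! i * (y \<bullet> e i)\<^sup>2) \<le> Q y"
    using assms(2) unfolding Gamma_form_def by blast
  have p: "p \<le> CARD('n)" by (rule Gamma_form_imp_le_CARD[OF assms(2)])
  have form: "(\<Sum>i<CARD('n). l ! i * (y \<bullet> e i)\<^sup>2) + c * (y \<bullet> y) + B * (y \<bullet> \<xi>)\<^sup>2 \<le> y \<bullet> (M *v y)" for y
    using le[of y] assms(6)[of y] by linarith
  note R = eigenvals_of_form_lower_bound[OF assms(1) e l assms(3) p assms(4) form assms(5)]
  show "eigenvals M \<in> Gamma_cone CARD('n) p"
    using R(1) eigenvals_symmetric[OF assms(1)] by (simp add: Gamma_cone_iff)
  show "c ^ p + c ^ (p - 1) * (B * (\<xi> \<bullet> \<xi>)) \<le> elem_sym p (eigenvals M)" by (rule R(2))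
qed

lemma continuous_elem_sym_affine: "isCont (\<lambda>t. elem_sym r (map (\<lambda>k. c * k - t) \<kappa>)) x"
proof (induction \<kappa> arbitrary: r)
  case Nil then show ?case by simp
next
  case (Cons a \<kappa>)
  then show ?case
    by (cases r) (auto simp: elem_sym_Cons intro!: continuous_intros)
qed

lemma in_cone_shift_open:
  assumes "in_cone q \<kappa>" "c > 0"
  obtains \<epsilon> where "\<epsilon> > 0" "in_cone q (map (\<lambda>k. c * k - 2 * \<epsilon>) \<kappa>)"
proof -
  have "\<forall>\<^sub>F t in at_right 0. elem_sym r (map (\<lambda>k. c * k - t) \<kappa>) > 0" if "r \<le> q" for r
  proof (rule order_tendstoD(1))
    have "((\<lambda>t. elem_sym r (map (\<lambda>k. c * k - t) \<kappa>)) \<longlongrightarrow> elem_sym r (map (\<lambda>k. c * k - 0) \<kappa>)) (at 0)"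
      using continuous_elem_sym_affine unfolding isCont_def .
    then show "((\<lambda>t. elem_sym r (map (\<lambda>k. c * k - t) \<kappa>)) \<longlongrightarrow> elem_sym r (map (\<lambda>k. c * k) \<kappa>)) (at_right 0)"
      by (simp add: filterlim_at_split)
    show "0 < elem_sym r (map (\<lambda>k. c * k) \<kappa>)"
      using in_cone_scale[OF assms(2,1)] that by (simp add: in_cone_def)
  qed
  then have "\<forall>\<^sub>F t in at_right 0. \<forall>r\<in>{..q}. elem_sym r (map (\<lambda>k. c * k - t) \<kappa>) > 0"
    by (intro eventually_ball_finite) auto
  then have "\<forall>\<^sub>F t in at_right 0. 0 < t \<and> (\<forall>r\<in>{..q}. elem_sym r (map (\<lambda>k. c * k - t) \<kappa>) > 0)"
    by (intro eventually_conj eventually_at_right_less)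
  then obtain t :: real where "0 < t" "\<forall>r\<in>{..q}. elem_sym r (map (\<lambda>k. c * k - t) \<kappa>) > 0"
    by (metis (mono_tags, lifting) eventually_happens' trivial_limit_at_right_real)
  then show ?thesis by (intro that[of "t / 2"]) (auto simp: in_cone_def)
qed

text \<open>Appending \<open>L\<close> adds \<open>L \<sigma>\<^sub>k\<close> to \<open>\<sigma>\<^sub>k\<^sub>+\<^sub>1\<close>.\<close>
lemma in_cone_append_large:
  assumes "in_cone q l"
  obtains L where "in_cone (Suc q) (l @ [L])"
proof -
  define L where "L = 1 + (\<Sum>k\<le>q. \<bar>elem_sym (Suc k) l\<bar> / elem_sym k l)"
  have pos: "elem_sym k l > 0" if "k \<le> q" for k using assms that by (simp add: in_cone_def)
  have "elem_sym r (l @ [L]) > 0" if r: "r \<le> Suc q" for r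
  proof (cases r)
    case (Suc k)
    then have k: "k \<le> q" using r by simp
    have "\<bar>elem_sym (Suc k) l\<bar> / elem_sym k l \<le> (\<Sum>k\<le>q. \<bar>elem_sym (Suc k) l\<bar> / elem_sym k l)"
      by (rule member_le_sum[where f = "\<lambda>k. \<bar>elem_sym (Suc k) l\<bar> / elem_sym k l"])
         (use k pos in \<open>auto intro!: divide_nonneg_nonneg less_imp_le[OF pos]\<close>)
    then have "\<bar>elem_sym (Suc k) l\<bar> / elem_sym k l < L" by (simp add: L_def)
    then have "\<bar>elem_sym (Suc k) l\<bar> < L * elem_sym k l" using pos[OF k] by (simp add: pos_divide_less_eq)
    then show ?thesis using Suc by (simp add: elem_sym_snoc)
  qed simp
  then show ?thesis by (intro that[of L]) (simp add: in_cone_def)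
qed

text \<open>In the splitting \<open>y = z + a \<nu>\<close>, half of an arbitrarily small loss \<open>2 \<epsilon>\<close> in the tangential directions
  pays for the mixed term, at the price of a multiple of \<open>a\<^sup>2\<close>. What remains is diagonal: the shrunk
  tangential entries, which stay in \<open>\<Gamma>\<^sub>p\<^sub>-\<^sub>1\<close> since the cone is open, and one entry \<open>L\<close> that can be made as
  large as desired through \<open>A\<close>. Then \<open>in_cone_append_large\<close> applies.\<close>
lemma Gamma_form_bordered:
  fixes S :: "real ^ 'n ^ 'n" and e :: "nat \<Rightarrow> real ^ 'n"
  assumes sym: "transpose S = S"
    and \<kappa>: "length \<kappa> = CARD('n) - 1" "in_cone (p - 1) \<kappa>" and p: "1 \<le> p" and c: "c > 0"
    and \<nu>: "\<nu> \<bullet> \<nu> = 1" and e\<nu>: "\<And>i. i < CARD('n) - 1 \<Longrightarrow> e i \<bullet> \<nu> = 0"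
    and ee: "\<And>i j. i < CARD('n) - 1 \<Longrightarrow> j < CARD('n) - 1 \<Longrightarrow> e i \<bullet> e j = (if i = j then 1 else 0)"
    and tang: "\<And>z. z \<bullet> \<nu> = 0 \<Longrightarrow> c * (\<Sum>i<CARD('n) - 1. \<kappa> ! i * (z \<bullet> e i)\<^sup>2) \<le> z \<bullet> (S *v z)"
  obtains A \<epsilon> where "\<epsilon> > 0" "A \<ge> 0" "Gamma_form p (\<lambda>y. y \<bullet> (S *v y) + A * (y \<bullet> \<nu>)\<^sup>2 - \<epsilon> * (y \<bullet> y))"
proof -
  define m where "m = CARD('n) - 1"
  have n: "CARD('n) = Suc m" by (simp add: m_def)
  have klen: "length \<kappa> = m" using \<kappa>(1) by (simp add: m_def)
  obtain \<epsilon> where \<epsilon>: "\<epsilon> > 0" and l0: "in_cone (p - 1) (map (\<lambda>k. c * k - 2 * \<epsilon>) \<kappa>)"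
    using in_cone_shift_open[OF \<kappa>(2) c] .
  define l0 where "l0 = map (\<lambda>k. c * k - 2 * \<epsilon>) \<kappa>"
  obtain L where "in_cone (Suc (p - 1)) (l0 @ [L])" using in_cone_append_large[OF l0] unfolding l0_def .
  then have L: "in_cone p (l0 @ [L])" using p by simp
  define W where "W = norm (S *v \<nu>)"
  define s where "s = \<nu> \<bullet> (S *v \<nu>)"
  \<comment> \<open>The last three summands compensate the normal part of \<open>S\<close>, the mixed term and the margin \<open>\<epsilon>\<close>.\<close>
  define A where "A = \<bar>L\<bar> + \<bar>s\<bar> + W\<^sup>2 / \<epsilon> + \<epsilon>"
  define e' where "e' = (\<lambda>i. if i < m then e i else \<nu>)"
  have onb: "onb e'"
    using ee e\<nu> \<nu> unfolding onb_def e'_def n m_def[symmetric] by (auto simp: inner_commute less_Suc_eq)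
  have "(\<Sum>i<CARD('n). (l0 @ [L]) ! i * (y \<bullet> e' i)\<^sup>2) \<le> y \<bullet> (S *v y) + A * (y \<bullet> \<nu>)\<^sup>2 - \<epsilon> * (y \<bullet> y)" for y
  proof -
    define a where "a = y \<bullet> \<nu>"
    define z where "z = y - a *\<^sub>R \<nu>"
    have y: "y = z + a *\<^sub>R \<nu>" by (simp add: z_def)
    have z\<nu>: "z \<bullet> \<nu> = 0" using \<nu> by (simp add: z_def a_def inner_diff_left)
    have ze: "z \<bullet> e i = y \<bullet> e i" if "i < m" for i
      using e\<nu>[of i] that by (simp add: z_def m_def inner_diff_left inner_commute[of \<nu>])
    have par: "(\<Sum>i<m. (y \<bullet> e i)\<^sup>2) + a\<^sup>2 = y \<bullet> y"
      using onb_parseval[OF onb, of y] by (simp add: n e'_def a_def)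
    have zz: "z \<bullet> z = y \<bullet> y - a\<^sup>2" using z\<nu> \<nu> unfolding y
      by (simp add: inner_add_left inner_add_right inner_commute power2_eq_square)
    have cross: "z \<bullet> (S *v \<nu>) = \<nu> \<bullet> (S *v z)"
      using symmetric_matrix_inner[OF sym, of \<nu> z] by (simp add: inner_commute)
    have ySy: "y \<bullet> (S *v y) = z \<bullet> (S *v z) + 2 * (a * (z \<bullet> (S *v \<nu>))) + a\<^sup>2 * s"
      unfolding y s_def using cross
      by (simp add: matrix_vector_right_distrib matrix_vector_mult_scaleR inner_add_left inner_add_right
          power2_eq_square algebra_simps)
    have "\<bar>z \<bullet> (S *v \<nu>)\<bar> \<le> norm z * W" unfolding W_def by (rule Cauchy_Schwarz_ineq2)
    then have "\<bar>a * (z \<bullet> (S *v \<nu>))\<bar> \<le> \<bar>a\<bar> * (norm z * W)" by (simp add: abs_mult mult_left_mono)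
    \<comment> \<open>Young's inequality.\<close>
    moreover have "2 * (\<bar>a\<bar> * (norm z * W)) \<le> \<epsilon> * (z \<bullet> z) + a\<^sup>2 * (W\<^sup>2 / \<epsilon>)"
    proof -
      have "0 \<le> (\<epsilon> * norm z - \<bar>a\<bar> * W)\<^sup>2 / \<epsilon>" using \<epsilon> by simp
      also have "\<dots> = \<epsilon> * (z \<bullet> z) + a\<^sup>2 * (W\<^sup>2 / \<epsilon>) - 2 * (\<bar>a\<bar> * (norm z * W))"
        using \<epsilon> by (simp add: power2_diff power2_norm_eq_inner[symmetric] power_mult_distrib field_simps power2_eq_square)
      finally show ?thesis by simp
    qed
    ultimately have 1: "y \<bullet> (S *v y) \<ge> z \<bullet> (S *v z) - \<epsilon> * (z \<bullet> z) - a\<^sup>2 * (W\<^sup>2 / \<epsilon>) - a\<^sup>2 * \<bar>s\<bar>"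
    proof -
      have "a\<^sup>2 * s \<ge> - (a\<^sup>2 * \<bar>s\<bar>)" by (metis abs_ge_minus_self abs_mult abs_power2 minus_le_iff)
      then show ?thesis
        using \<open>\<bar>a * (z \<bullet> (S *v \<nu>))\<bar> \<le> \<bar>a\<bar> * (norm z * W)\<close>
          \<open>2 * (\<bar>a\<bar> * (norm z * W)) \<le> \<epsilon> * (z \<bullet> z) + a\<^sup>2 * (W\<^sup>2 / \<epsilon>)\<close> ySy by linarith
    qed
    have 2: "z \<bullet> (S *v z) \<ge> (\<Sum>i<m. c * \<kappa> ! i * (y \<bullet> e i)\<^sup>2)"
    proof -
      have "(\<Sum>i<m. c * \<kappa> ! i * (y \<bullet> e i)\<^sup>2) = c * (\<Sum>i<m. \<kappa> ! i * (z \<bullet> e i)\<^sup>2)"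
        unfolding sum_distrib_left by (intro sum.cong) (auto simp: ze)
      then show ?thesis using tang[OF z\<nu>] by (simp add: m_def)
    qed
    have "(\<Sum>i<CARD('n). (l0 @ [L]) ! i * (y \<bullet> e' i)\<^sup>2) = (\<Sum>i<m. (c * \<kappa> ! i - 2 * \<epsilon>) * (y \<bullet> e i)\<^sup>2) + L * a\<^sup>2"
      using klen unfolding n by (simp add: e'_def l0_def nth_append a_def)
    also have "\<dots> = (\<Sum>i<m. c * \<kappa> ! i * (y \<bullet> e i)\<^sup>2) - 2 * \<epsilon> * (y \<bullet> y - a\<^sup>2) + L * a\<^sup>2"
      unfolding par[symmetric] by (simp add: left_diff_distrib sum_subtractf sum_distrib_left)
    also have "\<dots> \<le> z \<bullet> (S *v z) - 2 * \<epsilon> * (y \<bullet> y - a\<^sup>2) + \<bar>L\<bar> * a\<^sup>2"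
      using 2 mult_right_mono[OF abs_ge_self[of L], of "a\<^sup>2"] by simp
    also have "\<dots> \<le> y \<bullet> (S *v y) + A * a\<^sup>2 - \<epsilon> * (y \<bullet> y)"
      using 1 unfolding zz A_def by (simp add: algebra_simps)
    finally show ?thesis by (simp add: a_def)
  qed
  then have "Gamma_form p (\<lambda>y. y \<bullet> (S *v y) + A * (y \<bullet> \<nu>)\<^sup>2 - \<epsilon> * (y \<bullet> y))"
    unfolding Gamma_form_def using onb L \<kappa>(1) n
    by (intro exI[of _ e'] exI[of _ "l0 @ [L]"]) (auto simp: l0_def)
  then show ?thesis using \<epsilon> by (intro that[of \<epsilon> A]) (auto simp: A_def)
qed

section \<open>Functions with the same sign near a common zero\<close>

text \<open>Along the parabola \<open>f\<close> vanishes to first order, and the bracket is its second derivative. The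
  factor \<open>\<sigma>\<close> covers both signs.\<close>
lemma positive_along_parabola:
  fixes f :: "real ^ 'n \<Rightarrow> real"
  assumes U: "open U" "smooth_on U f" "x \<in> U"
    and f: "f x = 0" "grad f x \<bullet> X = 0" and pos: "\<sigma> * (hess_form f x X + 2 * (grad f x \<bullet> Y)) > 0"
  obtains d where "d > 0" "\<And>t. 0 < t \<Longrightarrow> t < d \<Longrightarrow> x + t *\<^sub>R X + t\<^sup>2 *\<^sub>R Y \<in> U \<and> \<sigma> * f (x + t *\<^sub>R X + t\<^sup>2 *\<^sub>R Y) > 0"
proof -
  define \<gamma> where "\<gamma> = (\<lambda>t::real. x + t *\<^sub>R X + t\<^sup>2 *\<^sub>R Y)"
  have \<gamma>': "(\<gamma> has_vector_derivative (X + (2 * t) *\<^sub>R Y)) (at t)" for t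
    unfolding \<gamma>_def by (auto intro!: derivative_eq_intros)
  have \<gamma>0: "\<gamma> 0 = x" by (simp add: \<gamma>_def)
  have "isCont \<gamma> 0" unfolding \<gamma>_def by (intro continuous_intros)
  then have "\<forall>\<^sub>F t in at 0. \<gamma> t \<in> U" using U(1,3) \<gamma>0 unfolding isCont_def
    by (metis topological_tendstoD)
  then obtain d0 where d0: "d0 > 0" "\<And>t. t \<noteq> 0 \<Longrightarrow> \<bar>t\<bar> < d0 \<Longrightarrow> \<gamma> t \<in> U"
    unfolding eventually_at by (auto simp: dist_real_def)
  then have inU: "\<gamma> t \<in> U" if "\<bar>t\<bar> < d0" for t using that U(3) \<gamma>0 by (cases "t = 0") auto
  define g' where "g' = (\<lambda>t. \<sigma> * (grad f (\<gamma> t) \<bullet> (X + (2 * t) *\<^sub>R Y)))"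
  have g: "((\<lambda>t. \<sigma> * f (\<gamma> t)) has_real_derivative g' t) (at t)" if "\<bar>t\<bar> < d0" for t
    unfolding g'_def by (intro DERIV_cmult DERIV_along_curve[OF smooth_on_differentiable[OF U(2) inU[OF that]] \<gamma>'])
  have "(\<gamma> has_derivative (\<lambda>s. s *\<^sub>R X)) (at 0)"
    using \<gamma>'[of 0] by (simp add: has_vector_derivative_def)
  moreover have "(grad f has_derivative (\<lambda>v. hessian f x *v v)) (at (\<gamma> 0))"
    using has_derivative_grad_field[OF U] by (simp add: \<gamma>0)
  ultimately have "((\<lambda>t. grad f (\<gamma> t)) has_derivative (\<lambda>s. hessian f x *v (s *\<^sub>R X))) (at 0)"
    by (rule has_derivative_compose)
  then have "(g' has_derivative (\<lambda>s. \<sigma> * (grad f (\<gamma> 0) \<bullet> ((2 * s) *\<^sub>R Y) + (hessian f x *v (s *\<^sub>R X)) \<bullet> (X + (2 * 0) *\<^sub>R Y)))) (at 0)"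
    unfolding g'_def by (auto intro!: derivative_eq_intros)
  moreover have "(\<lambda>s. \<sigma> * (grad f (\<gamma> 0) \<bullet> ((2 * s) *\<^sub>R Y) + (hessian f x *v (s *\<^sub>R X)) \<bullet> (X + (2 * 0) *\<^sub>R Y)))
    = (*) (\<sigma> * (hess_form f x X + 2 * (grad f x \<bullet> Y)))"
    by (auto simp: \<gamma>0 matrix_vector_mult_scaleR hess_form_def inner_commute algebra_simps)
  ultimately have "DERIV g' 0 :> \<sigma> * (hess_form f x X + 2 * (grad f x \<bullet> Y))"
    by (simp add: has_field_derivative_def)
  from DERIV_pos_inc_right[OF this pos]
  obtain d1 where d1: "d1 > 0" "\<And>h. 0 < h \<Longrightarrow> h < d1 \<Longrightarrow> g' 0 < g' h" by auto
  have g'0: "g' 0 = 0" using f by (simp add: g'_def \<gamma>0)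
  show ?thesis
  proof (rule that[of "min d0 d1"])
    show "min d0 d1 > 0" using d0 d1 by simp
    fix t :: real assume t: "0 < t" "t < min d0 d1"
    have "\<exists>z>0. z < t \<and> \<sigma> * f (\<gamma> t) - \<sigma> * f (\<gamma> 0) = (t - 0) * g' z"
      using t by (intro MVT2) (auto intro!: g)
    then obtain z where "0 < z" "z < t" "\<sigma> * f (\<gamma> t) = t * g' z" using f \<gamma>0 by auto
    moreover have "g' z > 0" using d1(2)[of z] calculation t g'0 by simp
    ultimately have "\<sigma> * f (\<gamma> t) > 0" using t by simp
    then show "x + t *\<^sub>R X + t\<^sup>2 *\<^sub>R Y \<in> U \<and> \<sigma> * f (x + t *\<^sub>R X + t\<^sup>2 *\<^sub>R Y) > 0"
      using inU[of t] t by (simp add: \<gamma>_def)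
  qed
qed

text \<open>A direction in which \<open>f\<close> decreases cannot be one in which \<open>g\<close> increases, so the half-space
  \<open>grad f x \<bullet> X \<le> 0\<close> is contained in \<open>grad g x \<bullet> X \<le> 0\<close>.\<close>
lemma grad_parallel_of_same_sign:
  fixes f g :: "real ^ 'n \<Rightarrow> real"
  assumes U: "open U" "smooth_on U f" "smooth_on U g" "x \<in> U"
    and zero: "f x = 0" "g x = 0" and Nz: "grad f x \<noteq> 0"
    and sign: "\<And>y. y \<in> U \<Longrightarrow> f y < 0 \<Longrightarrow> g y \<le> 0"
  obtains c where "c \<ge> 0" "grad g x = c *\<^sub>R grad f x"
proof -
  let ?N = "grad f x" and ?G = "grad g x"
  have strict: "?G \<bullet> X \<le> 0" if X: "?N \<bullet> X < 0" for X
  proof (rule ccontr)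
    assume "\<not> ?G \<bullet> X \<le> 0"
    then have GX: "?G \<bullet> X > 0" by simp
    have line: "((\<lambda>t. x + t *\<^sub>R X) has_vector_derivative X) (at 0)" by (auto intro!: derivative_eq_intros)
    have "DERIV (\<lambda>t. f (x + t *\<^sub>R X)) 0 :> ?N \<bullet> X"
      using DERIV_along_curve[OF _ line, of f] smooth_on_differentiable[OF U(2,4)] by simp
    from DERIV_neg_dec_right[OF this X]
    obtain d1 where d1: "d1 > 0" "\<And>h. 0 < h \<Longrightarrow> h < d1 \<Longrightarrow> f (x + h *\<^sub>R X) < 0" using zero by auto
    have "DERIV (\<lambda>t. g (x + t *\<^sub>R X)) 0 :> ?G \<bullet> X"
      using DERIV_along_curve[OF _ line, of g] smooth_on_differentiable[OF U(3,4)] by simp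
    from DERIV_pos_inc_right[OF this GX]
    obtain d2 where d2: "d2 > 0" "\<And>h. 0 < h \<Longrightarrow> h < d2 \<Longrightarrow> g (x + h *\<^sub>R X) > 0" using zero by auto
    obtain r where r: "r > 0" "ball x r \<subseteq> U" using U(1,4) openE by blast
    define q where "q = min (min d1 d2) (r / (norm X + 1))"
    define h where "h = q / 2"
    have "q > 0" using d1 d2 r by (simp add: q_def add_nonneg_pos)
    moreover have "q \<le> d1" "q \<le> d2" "q \<le> r / (norm X + 1)" by (auto simp: q_def)
    ultimately have h: "0 < h" "h < d1" "h < d2" "h < r / (norm X + 1)" unfolding h_def by linarith+
    have "h * norm X \<le> h * (norm X + 1)" using h by simp
    also have "\<dots> < r" using h(4) by (simp add: pos_less_divide_eq add_nonneg_pos)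
    finally have "x + h *\<^sub>R X \<in> U" using r h(1) by (auto simp: dist_norm subset_iff)
    from sign[OF this] d1(2)[OF h(1,2)] d2(2)[OF h(1,3)] show False by simp
  qed
  have weak: "?G \<bullet> X \<le> 0" if X: "?N \<bullet> X \<le> 0" for X
  proof (rule field_le_epsilon)
    fix \<epsilon> :: real assume \<epsilon>: "\<epsilon> > 0"
    \<comment> \<open>Tilting \<open>X\<close> by \<open>- t N\<close> makes the hypothesis strict at a cost of at most \<open>\<epsilon>\<close>.\<close>
    define t where "t = \<epsilon> / (\<bar>?G \<bullet> ?N\<bar> + 1)"
    have t: "t > 0" using \<epsilon> by (simp add: t_def)
    have "?N \<bullet> (X - t *\<^sub>R ?N) < 0"
      using X t Nz by (simp add: inner_diff_right) (smt (verit) inner_gt_zero_iff mult_pos_pos)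
    from strict[OF this] have "?G \<bullet> X \<le> t * (?G \<bullet> ?N)" by (simp add: inner_diff_right)
    also have "\<dots> \<le> t * (\<bar>?G \<bullet> ?N\<bar> + 1)" using t by (intro mult_left_mono) auto
    also have "\<dots> = \<epsilon>" by (simp add: t_def)
    finally show "?G \<bullet> X \<le> 0 + \<epsilon>" by simp
  qed
  define c where "c = (?G \<bullet> ?N) / (?N \<bullet> ?N)"
  define X where "X = ?G - c *\<^sub>R ?N"
  have NX: "?N \<bullet> X = 0" using Nz by (simp add: X_def c_def inner_diff_right inner_commute)
  then have "?G \<bullet> X \<le> 0" by (intro weak) simp
  moreover have "?G \<bullet> X = X \<bullet> X" using NX by (simp add: X_def inner_diff_left inner_diff_right algebra_simps)
  ultimately have "X = 0" by (metis inner_gt_zero_iff not_le)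
  then have "?G = c *\<^sub>R ?N" by (simp add: X_def)
  moreover have "c \<ge> 0"
    using weak[of "- ?N"] Nz by (simp add: c_def)
  ultimately show ?thesis using that by blast
qed

text \<open>A one-sided version of the independence of the second fundamental form of the defining
  function. Bend the line \<open>x + t X\<close> by \<open>t\<^sup>2 s N\<close>, with \<open>s\<close> just large enough for \<open>f\<close> to become positive; then
  \<open>g\<close> is nonnegative on this parabola, so its second derivative there is nonnegative.\<close>
lemma hess_form_ge_of_same_sign:
  fixes f g :: "real ^ 'n \<Rightarrow> real"
  assumes U: "open U" "smooth_on U f" "smooth_on U g" "x \<in> U"
    and zero: "f x = 0" "g x = 0" and Nz: "grad f x \<noteq> 0"
    and G: "grad g x = c *\<^sub>R grad f x" "c \<ge> 0"
    and sign: "\<And>y. y \<in> U \<Longrightarrow> f y > 0 \<Longrightarrow> g y \<ge> 0"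
    and X: "grad f x \<bullet> X = 0"
  shows "c * hess_form f x X \<le> hess_form g x X"
proof (rule field_le_epsilon)
  fix \<epsilon> :: real assume \<epsilon>: "\<epsilon> > 0"
  define N where "N = grad f x"
  have NN: "N \<bullet> N > 0" using Nz by (simp add: N_def)
  define \<eta> where "\<eta> = \<epsilon> / (2 * c * (N \<bullet> N) + 1)"
  have den: "2 * c * (N \<bullet> N) + 1 > 0" using G(2) NN by (simp add: add_nonneg_pos)
  then have \<eta>: "\<eta> > 0" using \<epsilon> by (simp add: \<eta>_def)
  \<comment> \<open>For \<open>\<eta> = 0\<close> the second derivative of \<open>f\<close> along the parabola would be exactly \<open>0\<close>.\<close>
  define s where "s = - hess_form f x X / (2 * (N \<bullet> N)) + \<eta>"
  have sN: "2 * s * (N \<bullet> N) = - hess_form f x X + 2 * \<eta> * (N \<bullet> N)"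
    using NN by (simp add: s_def field_simps)
  have "1 * (hess_form f x X + 2 * (grad f x \<bullet> (s *\<^sub>R N))) > 0"
    using sN mult_pos_pos[OF \<eta> NN] by (simp add: N_def[symmetric])
  from positive_along_parabola[OF U(1,2,4) zero(1) X this]
  obtain d1 where d1: "d1 > 0" "\<And>t. 0 < t \<Longrightarrow> t < d1 \<Longrightarrow>
      x + t *\<^sub>R X + t\<^sup>2 *\<^sub>R (s *\<^sub>R N) \<in> U \<and> f (x + t *\<^sub>R X + t\<^sup>2 *\<^sub>R (s *\<^sub>R N)) > 0"
    by auto
  have "hess_form g x X + 2 * (grad g x \<bullet> (s *\<^sub>R N)) \<ge> 0"
  proof (rule ccontr)
    assume "\<not> hess_form g x X + 2 * (grad g x \<bullet> (s *\<^sub>R N)) \<ge> 0"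
    then have neg: "(-1) * (hess_form g x X + 2 * (grad g x \<bullet> (s *\<^sub>R N))) > 0" by simp
    have GX: "grad g x \<bullet> X = 0" using G X by simp
    from positive_along_parabola[OF U(1,3,4) zero(2) GX neg]
    obtain d2 where d2: "d2 > 0" "\<And>t. 0 < t \<Longrightarrow> t < d2 \<Longrightarrow>
      x + t *\<^sub>R X + t\<^sup>2 *\<^sub>R (s *\<^sub>R N) \<in> U \<and> (-1) * g (x + t *\<^sub>R X + t\<^sup>2 *\<^sub>R (s *\<^sub>R N)) > 0"
      by blast
    define t where "t = min d1 d2 / 2"
    have "0 < t" "t < d1" "t < d2" using d1 d2 by (auto simp: t_def)
    then show False using d1(2)[of t] d2(2)[of t] sign by force
  qed
  moreover have "2 * (grad g x \<bullet> (s *\<^sub>R N)) = c * (2 * s * (N \<bullet> N))" by (simp add: G N_def)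
  ultimately have "c * hess_form f x X \<le> hess_form g x X + 2 * \<eta> * c * (N \<bullet> N)"
    unfolding sN by (simp add: algebra_simps)
  also have "2 * \<eta> * c * (N \<bullet> N) \<le> \<eta> * (2 * c * (N \<bullet> N) + 1)" using \<eta> by (simp add: algebra_simps)
  also have "\<dots> = \<epsilon>" using den by (simp add: \<eta>_def)
  finally show "c * hess_form f x X \<le> hess_form g x X + \<epsilon>" by simp
qed

section \<open>Curvature and the Hessian of a defining function\<close>

text \<open>Differentiating the normalised gradient gives \<open>D\<^sup>2\<rho> / |D\<rho>|\<close> up to a multiple of \<open>D\<rho>\<close>, and the latter is
  invisible in tangential directions.\<close>
lemma hess_form_of_principal_curvatures:
  fixes \<rho> :: "real ^ 'n \<Rightarrow> real" and e :: "nat \<Rightarrow> real ^ 'n"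
  assumes U: "open U" "smooth_on U \<rho>" "x \<in> U" and N: "grad \<rho> x \<noteq> 0"
    and tangent: "\<And>i. i < CARD('n) - 1 \<Longrightarrow> e i \<bullet> inward_normal \<rho> x = 0"
    and ee: "\<And>i j. i < CARD('n) - 1 \<Longrightarrow> j < CARD('n) - 1 \<Longrightarrow> e i \<bullet> e j = (if i = j then 1 else 0)"
    and shape: "\<And>i. i < CARD('n) - 1 \<Longrightarrow>
           - frechet_derivative (inward_normal \<rho>) (at x) (e i) = (\<kappa> ! i) *\<^sub>R e i"
    and X: "X \<bullet> grad \<rho> x = 0"
  shows "hess_form \<rho> x X = norm (grad \<rho> x) * (\<Sum>i<CARD('n) - 1. \<kappa> ! i * (X \<bullet> e i)\<^sup>2)"
proof -
  define m where "m = CARD('n) - 1"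
  have n: "CARD('n) = Suc m" by (simp add: m_def)
  let ?N = "grad \<rho> x" and ?H = "hessian \<rho> x"
  define \<nu> where "\<nu> = ?N /\<^sub>R norm ?N"
  have e\<nu>: "e i \<bullet> ?N = 0" if "i < m" for i
    using tangent[of i] that N by (simp add: m_def inward_normal_def)
  have "norm \<nu> = 1" using N by (simp add: \<nu>_def)
  then have "\<nu> \<bullet> \<nu> = 1" by (simp add: norm_eq_1)
  moreover have "e i \<bullet> \<nu> = 0" if "i < m" for i using e\<nu>[OF that] by (simp add: \<nu>_def)
  ultimately have "onb (\<lambda>i. if i < m then e i else \<nu>)"
    using ee unfolding onb_def n m_def[symmetric] by (auto simp: inner_commute less_Suc_eq)
  from onb_expand[OF this, of X] have Xexp: "X = (\<Sum>i<m. (X \<bullet> e i) *\<^sub>R e i)"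
    using X by (simp add: n \<nu>_def)
  have Hd: "(grad \<rho> has_derivative (\<lambda>v. ?H *v v)) (at x)" by (rule has_derivative_grad_field[OF U])
  have "(\<lambda>y. inverse (norm (grad \<rho> y))) differentiable (at x)"
  proof -
    have "(norm has_derivative (\<lambda>h. h \<bullet> sgn ?N)) (at ?N)"
      using has_derivative_norm[OF N] by (simp add: inner_commute)
    from has_derivative_compose[OF Hd this] have "((\<lambda>y. norm (grad \<rho> y)) has_derivative (\<lambda>v. (?H *v v) \<bullet> sgn ?N)) (at x)" .
    then show ?thesis using N by (intro differentiable_inverse differentiableI) auto
  qed
  then obtain r where r: "((\<lambda>y. inverse (norm (grad \<rho> y))) has_derivative r) (at x)"
    unfolding differentiable_def by blast
  have "(inward_normal \<rho> has_derivative
      (\<lambda>v. - (inverse (norm ?N) *\<^sub>R (?H *v v) + r v *\<^sub>R ?N))) (at x)"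
    unfolding inward_normal_def[abs_def] by (intro has_derivative_minus has_derivative_scaleR r Hd)
  from frechet_derivative_at[OF this] have "frechet_derivative (inward_normal \<rho>) (at x) = (\<lambda>v. - (inverse (norm ?N) *\<^sub>R (?H *v v) + r v *\<^sub>R ?N))" ..
  then have sh: "inverse (norm ?N) *\<^sub>R (?H *v e i) + r (e i) *\<^sub>R ?N = (\<kappa> ! i) *\<^sub>R e i" if "i < m" for i
    using shape[of i] that by (simp add: m_def add.commute)
  have HX: "X \<bullet> (?H *v e i) = norm ?N * (\<kappa> ! i * (X \<bullet> e i))" if "i < m" for i
  proof -
    have "X \<bullet> (inverse (norm ?N) *\<^sub>R (?H *v e i) + r (e i) *\<^sub>R ?N) = X \<bullet> ((\<kappa> ! i) *\<^sub>R e i)"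
      using sh[OF that] by simp
    then have "inverse (norm ?N) * (X \<bullet> (?H *v e i)) = \<kappa> ! i * (X \<bullet> e i)"
      using X by (simp add: inner_add_right)
    then show ?thesis using N by (simp add: field_simps)
  qed
  have "hess_form \<rho> x X = X \<bullet> (?H *v (\<Sum>i<m. (X \<bullet> e i) *\<^sub>R e i))"
    unfolding hess_form_def using Xexp by simp
  also have "\<dots> = (\<Sum>i<m. (X \<bullet> e i) * (X \<bullet> (?H *v e i)))"
    by (simp add: linear_sum[OF matrix_vector_mul_linear] matrix_vector_mult_scaleR inner_sum_right)
  also have "\<dots> = norm ?N * (\<Sum>i<m. \<kappa> ! i * (X \<bullet> e i)\<^sup>2)"
    unfolding sum_distrib_left by (intro sum.cong) (auto simp: HX power2_eq_square)
  finally show ?thesis by (simp add: m_def)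
qed

section \<open>A global defining function\<close>

definition bump :: "real ^ 'n \<Rightarrow> real \<Rightarrow> real ^ 'n \<Rightarrow> real" where
  "bump a r y = flat 0 (r\<^sup>2 - (y - a) \<bullet> (y - a))"

lemma smooth_on_bump: "smooth_on UNIV (bump a r)"
  unfolding bump_def[abs_def]
  by (intro smooth_on_compose[OF deriv_seq_flat] smooth_on_diff smooth_on_const smooth_on_inner_self) auto

lemma bump_nonneg: "0 \<le> bump a r y"
  by (simp add: bump_def flat_0)

lemma bump_eq_0: "0 < r \<Longrightarrow> y \<notin> ball a r \<Longrightarrow> bump a r y = 0"
  using power_mono[of r "norm (y - a)" 2]
  by (simp add: bump_def flat_0 dist_norm norm_minus_commute[of a] power2_norm_eq_inner)

lemma bump_pos: "y \<in> ball a r \<Longrightarrow> bump a r y > 0"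
  using power_strict_mono[of "norm (y - a)" r 2]
  by (simp add: bump_def flat_0 dist_norm norm_minus_commute[of a] power2_norm_eq_inner)

text \<open>Near any point outside \<open>U\<close> the product vanishes, whatever \<open>f\<close> is there.\<close>
lemma smooth_on_bump_mult:
  assumes "open U" "0 < r" "cball a r \<subseteq> U" "smooth_on U f"
  shows "smooth_on UNIV (\<lambda>y. bump a r y * f y)"
proof -
  have "smooth_on U (\<lambda>y. bump a r y * f y)"
    using assms smooth_on_subset[OF smooth_on_bump] by (intro smooth_on_mult) auto
  moreover have "smooth_on (- cball a r) (\<lambda>y. bump a r y * f y)"
  proof (rule smooth_on_cong)
    show "0 = bump a r y * f y" if "y \<in> - cball a r" for y
      using bump_eq_0[OF assms(2), of y a] that by simp
  qed auto
  ultimately have "smooth_on (U \<union> - cball a r) (\<lambda>y. bump a r y * f y)"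
    using assms(1) by (intro smooth_on_Un) auto
  moreover have "U \<union> - cball a r = UNIV" using assms(3) by auto
  ultimately show ?thesis by simp
qed

lemma grad_const: "grad (\<lambda>x. c) x = 0"
  by (simp add: grad_def partial_deriv_def vec_eq_iff)

lemma grad_sum:
  assumes "\<And>i. i \<in> I \<Longrightarrow> f i differentiable (at x)"
  shows "grad (\<lambda>x. \<Sum>i\<in>I. f i x) x = (\<Sum>i\<in>I. grad (f i) x)"
  using assms
proof (induction I rule: infinite_finite_induct)
  case (insert i I)
  then show ?case by (simp add: grad_add differentiable_sum)
qed (simp_all add: grad_const)

lemma grad_cong_open:
  assumes "open U" "x \<in> U" "\<And>y. y \<in> U \<Longrightarrow> f y = g y" "f differentiable (at x)"
  shows "grad f x = grad g x"
  using partial_deriv_cong_open[OF assms] by (simp add: grad_def)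

text \<open>Weaker than a local defining function in that \<open>f\<close> may vanish outside the closure of \<open>\<Omega>\<close>: products with
  bump functions do. This weaker notion survives gluing and is enough for the comparison of Hessians.\<close>
definition sign_defining :: "(real ^ 'n) set \<Rightarrow> (real ^ 'n) set \<Rightarrow> (real ^ 'n \<Rightarrow> real) \<Rightarrow> bool" where
  "sign_defining \<Omega> U f \<longleftrightarrow> open U \<and> smooth_on U f \<and> (\<forall>y\<in>U.
     (y \<in> \<Omega> \<longrightarrow> f y < 0) \<and> (y \<in> frontier \<Omega> \<longrightarrow> f y = 0 \<and> grad f y \<noteq> 0) \<and>
     (y \<notin> closure \<Omega> \<longrightarrow> 0 \<le> f y))"

lemma sign_definingD:
  assumes "sign_defining \<Omega> U f"
  shows "open U" "smooth_on U f"
    "\<And>y. y \<in> U \<Longrightarrow> y \<in> \<Omega> \<Longrightarrow> f y < 0"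
    "\<And>y. y \<in> U \<Longrightarrow> y \<in> frontier \<Omega> \<Longrightarrow> f y = 0"
    "\<And>y. y \<in> U \<Longrightarrow> y \<in> frontier \<Omega> \<Longrightarrow> grad f y \<noteq> 0"
    "\<And>y. y \<in> U \<Longrightarrow> y \<notin> closure \<Omega> \<Longrightarrow> 0 \<le> f y"
  using assms unfolding sign_defining_def by blast+

lemma sign_defining_local:
  assumes "open \<Omega>" "local_defining_function \<Omega> U \<rho>"
  shows "sign_defining \<Omega> U \<rho>"
proof -
  have closure: "y \<in> closure \<Omega> \<longleftrightarrow> y \<in> \<Omega> \<or> y \<in> frontier \<Omega>" for y
    using closure_Un_frontier[of \<Omega>] by auto
  have loc: "\<Omega> \<inter> U = {y \<in> U. \<rho> y < 0}" "frontier \<Omega> \<inter> U = {y \<in> U. \<rho> y = 0}"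
    "open U" "smooth_on U \<rho>" "\<And>y. y \<in> U \<Longrightarrow> grad \<rho> y \<noteq> 0"
    using assms(2) unfolding local_defining_function_def smooth_on_def by auto
  have "\<rho> y < 0" if "y \<in> U" "y \<in> \<Omega>" for y using loc(1) that by blast
  moreover have "\<rho> y = 0" if "y \<in> U" "y \<in> frontier \<Omega>" for y using loc(2) that by blast
  moreover have "0 \<le> \<rho> y" if "y \<in> U" "y \<notin> closure \<Omega>" for y
  proof (rule ccontr)
    assume "\<not> 0 \<le> \<rho> y"
    then have "y \<in> \<Omega> \<inter> U" using loc(1) that(1) by simp
    then show False using that(2) closure by blast
  qed
  ultimately show ?thesis using loc(3-5) unfolding sign_defining_def by blast
qed

lemma sign_defining_interior:
  assumes "open \<Omega>" shows "sign_defining \<Omega> \<Omega> (\<lambda>_. - 1)"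
  using assms frontier_disjoint_eq[of \<Omega>] closure_subset[of \<Omega>] smooth_on_const
  unfolding sign_defining_def by auto

text \<open>The factor is positive because neither gradient vanishes.\<close>
lemma sign_defining_grad_parallel:
  assumes f: "sign_defining \<Omega> U f" and g: "sign_defining \<Omega> V g" and \<Omega>: "open \<Omega>"
    and f_neg: "\<And>y. y \<in> U \<Longrightarrow> f y < 0 \<Longrightarrow> y \<in> \<Omega>"
    and y: "y \<in> U" "y \<in> V" "y \<in> frontier \<Omega>"
  obtains c where "c > 0" "grad g y = c *\<^sub>R grad f y"
proof -
  note F = sign_definingD[OF f] and G = sign_definingD[OF g]
  obtain c where c: "c \<ge> 0" "grad g y = c *\<^sub>R grad f y"
  proof (rule grad_parallel_of_same_sign[of "U \<inter> V" f g y])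
    show "open (U \<inter> V)" "smooth_on (U \<inter> V) f" "smooth_on (U \<inter> V) g" "y \<in> U \<inter> V"
      using F(1,2) G(1,2) y by (auto intro: smooth_on_subset)
    show "f y = 0" "g y = 0" "grad f y \<noteq> 0" using F G y by auto
    show "g z \<le> 0" if "z \<in> U \<inter> V" "f z < 0" for z
      using f_neg[of z] G(3)[of z] that by auto
  qed (rule that)
  moreover have "c \<noteq> 0" using c(2) G(5)[OF y(2,3)] by auto
  ultimately show ?thesis using that[of c] by auto
qed

text \<open>Cover the compact closure of \<open>\<Omega>\<close> by balls carrying local functions of the right sign (the constant \<open>- 1\<close> in the
  interior) and add up these functions weighted by bump functions. At a boundary point all
  contributions to the gradient are nonnegative multiples of the same normal vector, and at least one
  is nonzero.\<close>
lemma global_defining_function: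
  fixes \<Omega> :: "(real ^ 'n) set"
  assumes \<Omega>: "open \<Omega>" "bounded \<Omega>" and smooth: "smooth_boundary \<Omega>"
  obtains \<rho> where "sign_defining \<Omega> UNIV \<rho>"
proof -
  have clos: "closure \<Omega> = \<Omega> \<union> frontier \<Omega>" by (rule closure_Un_frontier)
  have disj: "\<Omega> \<inter> frontier \<Omega> = {}" using \<Omega>(1) frontier_disjoint_eq[of \<Omega>] by blast
  define good where "good = (\<lambda>U f. local_defining_function \<Omega> U f \<or> U = \<Omega> \<and> f = (\<lambda>_. - 1))"
  have "\<exists>U f r. x \<in> U \<and> good U f \<and> 0 < r \<and> cball x r \<subseteq> U" if x: "x \<in> closure \<Omega>" for x
  proof -
    have "\<exists>U f. open U \<and> x \<in> U \<and> good U f"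
    proof (cases "x \<in> \<Omega>")
      case True then show ?thesis using \<Omega>(1) unfolding good_def by blast
    next
      case False
      then have "x \<in> frontier \<Omega>" using x clos by blast
      then obtain U f where "x \<in> U" "local_defining_function \<Omega> U f"
        using smooth unfolding smooth_boundary_def by blast
      then show ?thesis unfolding good_def local_defining_function_def by blast
    qed
    then obtain U f where U: "open U" "x \<in> U" "good U f" by blast
    moreover obtain r where "0 < r" "cball x r \<subseteq> U" using U(1,2) open_contains_cball by blast
    ultimately show ?thesis by blast
  qed
  then obtain U f r where loc: "\<And>x. x \<in> closure \<Omega> \<Longrightarrow>
      x \<in> U x \<and> good (U x) (f x) \<and> 0 < r x \<and> cball x (r x) \<subseteq> U x"
    by metis
  have def: "sign_defining \<Omega> (U x) (f x)" if "x \<in> closure \<Omega>" for x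
    using loc[OF that] sign_defining_local[OF \<Omega>(1)] sign_defining_interior[OF \<Omega>(1)]
    unfolding good_def by auto
  have comp: "compact (closure \<Omega>)" using \<Omega>(2) by simp
  obtain F where F: "F \<subseteq> closure \<Omega>" "finite F" "closure \<Omega> \<subseteq> (\<Union>x\<in>F. ball x (r x))"
  proof (rule compactE_image[OF comp, of "closure \<Omega>" "\<lambda>x. ball x (r x)"])
    show "closure \<Omega> \<subseteq> (\<Union>x\<in>closure \<Omega>. ball x (r x))" using loc by force
  qed auto
  define h where "h = (\<lambda>x y. bump x (r x) y * f x y)"
  define \<rho> where "\<rho> = (\<lambda>y. \<Sum>x\<in>F. h x y)"
  have FU: "0 < r x" "cball x (r x) \<subseteq> U x" "sign_defining \<Omega> (U x) (f x)" if "x \<in> F" for x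
    using loc def that F(1) by blast+
  have h_smooth: "smooth_on UNIV (h x)" if "x \<in> F" for x
    unfolding h_def using smooth_on_bump_mult[OF sign_definingD(1)[OF FU(3)[OF that]] FU(1,2)[OF that]]
      sign_definingD(2)[OF FU(3)[OF that]] by blast
  have h_cases: "h x y = 0 \<or> y \<in> U x" if "x \<in> F" for x y
    using bump_eq_0[OF FU(1)[OF that], of y x] FU(2)[OF that] unfolding h_def
    by (metis ball_subset_cball mult_eq_0_iff subsetD)
  have smooth_\<rho>: "smooth_on UNIV \<rho>" unfolding \<rho>_def using h_smooth by (intro smooth_on_sum) auto
  have neg: "\<rho> y < 0" if y: "y \<in> \<Omega>" for y
  proof -
    have le: "h x y \<le> 0" if "x \<in> F" for x
      using h_cases[OF that, of y] sign_definingD(3)[OF FU(3)[OF that] _ y] bump_nonneg[of x "r x" y]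
      by (auto simp: h_def mult_le_0_iff less_imp_le)
    have "y \<in> closure \<Omega>" using y closure_subset by blast
    then obtain x where x: "x \<in> F" "y \<in> ball x (r x)" using F(3) by blast
    then have "y \<in> U x" using FU(2) ball_subset_cball by blast
    then have "f x y < 0" using sign_definingD(3)[OF FU(3)[OF x(1)]] y by blast
    then have "h x y < 0" using bump_pos[OF x(2)] by (simp add: h_def mult_pos_neg)
    then have "(\<Sum>x\<in>F. h x y) < (\<Sum>x\<in>F. 0)" using le x(1) F(2) by (intro sum_strict_mono_ex1) auto
    then show ?thesis by (simp add: \<rho>_def)
  qed
  have zero: "\<rho> y = 0" if y: "y \<in> frontier \<Omega>" for y
    unfolding \<rho>_def
  proof (rule sum.neutral, rule ballI)
    fix x assume "x \<in> F"
    then show "h x y = 0" using h_cases[of x y] sign_definingD(4)[OF FU(3), of x y] y by (auto simp: h_def)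
  qed
  have nonneg: "0 \<le> \<rho> y" if y: "y \<notin> closure \<Omega>" for y
    unfolding \<rho>_def
  proof (rule sum_nonneg)
    fix x assume "x \<in> F"
    then show "0 \<le> h x y"
      using h_cases[of x y] sign_definingD(6)[OF FU(3), of x y] y bump_nonneg[of x "r x" y] by (auto simp: h_def)
  qed
  have grad0: "grad \<rho> y \<noteq> 0" if y: "y \<in> frontier \<Omega>" for y
  proof -
    have "y \<in> closure \<Omega>" using y clos by blast
    then obtain x0 where x0: "x0 \<in> F" "y \<in> ball x0 (r x0)" using F(3) by blast
    then have yU0: "y \<in> U x0" using FU(2) ball_subset_cball by blast
    then have "U x0 \<noteq> \<Omega>" using y disj by blast
    then have ldf: "local_defining_function \<Omega> (U x0) (f x0)" using loc x0(1) F(1) unfolding good_def by blast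
    then have f_neg: "z \<in> \<Omega>" if "z \<in> U x0" "f x0 z < 0" for z
      using that unfolding local_defining_function_def by blast
    define N where "N = grad (f x0) y"
    have N: "N \<noteq> 0" using sign_definingD(5)[OF FU(3)[OF x0(1)] yU0 y] by (simp add: N_def)
    have gh: "grad (h x) y = bump x (r x) y *\<^sub>R grad (f x) y" if x: "x \<in> F" "y \<in> U x" for x
    proof -
      have "grad (h x) y = bump x (r x) y *\<^sub>R grad (f x) y + f x y *\<^sub>R grad (bump x (r x)) y"
        unfolding h_def using smooth_on_differentiable[OF smooth_on_bump]
          smooth_on_differentiable[OF sign_definingD(2)[OF FU(3)[OF x(1)]] x(2)] by (intro grad_mult) auto
      then show ?thesis using sign_definingD(4)[OF FU(3)[OF x(1)] x(2) y] by simp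
    qed
    have gh0: "grad (h x) y = 0" if x: "x \<in> F" "y \<notin> U x" for x
    proof -
      have "y \<in> - cball x (r x)" using FU(2)[OF x(1)] x(2) by blast
      moreover have "h x z = 0" if "z \<in> - cball x (r x)" for z
        using bump_eq_0[OF FU(1)[OF x(1)], of z x] that by (simp add: h_def)
      ultimately have "grad (h x) y = grad (\<lambda>_. 0) y"
        using smooth_on_differentiable[OF h_smooth[OF x(1)]]
        by (intro grad_cong_open[of "- cball x (r x)"]) auto
      then show ?thesis by (simp add: grad_const)
    qed
    have ge: "0 \<le> grad (h x) y \<bullet> N" if x: "x \<in> F" for x
    proof (cases "y \<in> U x")
      case True
      obtain c where "c > 0" "grad (f x) y = c *\<^sub>R N"
        using sign_defining_grad_parallel[OF FU(3)[OF x0(1)] FU(3)[OF x] \<Omega>(1) f_neg yU0 True y]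
        unfolding N_def by blast
      then show ?thesis using gh[OF x True] bump_nonneg[of x "r x" y] by simp
    qed (simp add: gh0[OF x])
    have "grad (h x0) y \<bullet> N = bump x0 (r x0) y * (N \<bullet> N)" using gh[OF x0(1) yU0] by (simp add: N_def)
    also have "\<dots> > 0" using bump_pos[OF x0(2)] N by simp
    finally have "(\<Sum>x\<in>F. 0) < (\<Sum>x\<in>F. grad (h x) y \<bullet> N)"
      using ge x0(1) F(2) by (intro sum_strict_mono_ex1) auto
    also have "\<dots> = grad \<rho> y \<bullet> N"
      unfolding \<rho>_def using smooth_on_differentiable[OF h_smooth]
      by (subst grad_sum) (auto simp: inner_sum_left)
    finally show ?thesis by auto
  qed
  show ?thesis
    using that[of \<rho>] smooth_\<rho> neg zero nonneg grad0 unfolding sign_defining_def by auto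
qed

text \<open>The principal curvatures belong to some local defining function \<open>f\<close>; the comparison of \<open>f\<close> with
  \<open>\<rho>\<close> carries them over to a lower bound for the tangential part of the Hessian of \<open>\<rho>\<close>.\<close>
lemma Gamma_form_at_frontier:
  fixes \<Omega> :: "(real ^ 'n) set"
  assumes \<Omega>: "open \<Omega>" and \<rho>: "sign_defining \<Omega> UNIV \<rho>"
    and convex: "strictly_convex_order (p - 1) \<Omega>" and p: "1 \<le> p" and x: "x \<in> frontier \<Omega>"
  obtains A \<epsilon> where "A \<ge> 0" "\<epsilon> > 0"
    "Gamma_form p (\<lambda>y. hess_form \<rho> x y + A * (grad \<rho> x \<bullet> y)\<^sup>2 - \<epsilon> * (y \<bullet> y))"
proof -
  obtain \<kappa> where pc: "principal_curvatures \<Omega> x \<kappa>" and cone: "\<kappa> \<in> Gamma_cone (CARD('n) - 1) (p - 1)"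
    using convex x unfolding strictly_convex_order_def by blast
  obtain U f e where U: "x \<in> U" "local_defining_function \<Omega> U f"
    and e: "\<forall>i<CARD('n) - 1. e i \<bullet> inward_normal f x = 0"
      "\<forall>i<CARD('n) - 1. \<forall>j<CARD('n) - 1. e i \<bullet> e j = (if i = j then 1 else 0)"
      "\<forall>i<CARD('n) - 1. - frechet_derivative (inward_normal f) (at x) (e i) = (\<kappa> ! i) *\<^sub>R e i"
    using pc unfolding principal_curvatures_def by blast
  have f: "sign_defining \<Omega> U f" using sign_defining_local[OF \<Omega> U(2)] .
  note F = sign_definingD[OF f] and R = sign_definingD[OF \<rho>]
  have f_neg: "z \<in> \<Omega>" if "z \<in> U" "f z < 0" for z
    using that U(2) unfolding local_defining_function_def by blast
  have f_pos: "z \<notin> closure \<Omega>" if "z \<in> U" "f z > 0" for z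
  proof -
    have "z \<notin> \<Omega> \<inter> U" "z \<notin> frontier \<Omega> \<inter> U"
      using that U(2) unfolding local_defining_function_def by auto
    then show ?thesis using that(1) closure_Un_frontier[of \<Omega>] by blast
  qed
  define N where "N = grad f x"
  have N: "N \<noteq> 0" using F(5)[OF U(1) x] by (simp add: N_def)
  obtain c where c: "c > 0" "grad \<rho> x = c *\<^sub>R N"
    using sign_defining_grad_parallel[OF f \<rho> \<Omega> f_neg U(1) _ x] unfolding N_def by auto
  define \<nu> where "\<nu> = N /\<^sub>R norm N"
  have "norm \<nu> = 1" using N by (simp add: \<nu>_def)
  then have \<nu>: "\<nu> \<bullet> \<nu> = 1" by (simp add: norm_eq_1)
  have tangent_iff: "z \<bullet> \<nu> = 0 \<longleftrightarrow> z \<bullet> N = 0" for z using N by (simp add: \<nu>_def)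
  have tang: "(c * norm N) * (\<Sum>i<CARD('n) - 1. \<kappa> ! i * (z \<bullet> e i)\<^sup>2) \<le> z \<bullet> (hessian \<rho> x *v z)"
    if z: "z \<bullet> \<nu> = 0" for z
  proof -
    have zN: "z \<bullet> grad f x = 0" using z tangent_iff N_def by simp
    have "hess_form f x z = norm (grad f x) * (\<Sum>i<CARD('n) - 1. \<kappa> ! i * (z \<bullet> e i)\<^sup>2)"
      by (rule hess_form_of_principal_curvatures[OF F(1,2) U(1)])
         (use e zN F(5)[OF U(1) x] in auto)
    moreover have "c * hess_form f x z \<le> hess_form \<rho> x z"
    proof (rule hess_form_ge_of_same_sign[of U f \<rho> x c z])
      show "smooth_on U \<rho>" using R(2) smooth_on_subset by blast
      show "0 \<le> \<rho> y" if "y \<in> U" "0 < f y" for y using R(6) f_pos[OF that] by blast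
      show "grad f x \<bullet> z = 0" using zN by (simp add: inner_commute)
    qed (use F U(1) R x c in \<open>auto simp: N_def\<close>)
    ultimately show ?thesis by (simp add: hess_form_def N_def mult.assoc)
  qed
  have ee: "e i \<bullet> e j = (if i = j then 1 else 0)" if "i < CARD('n) - 1" "j < CARD('n) - 1" for i j
    using e(2) that by blast
  have e\<nu>: "e i \<bullet> \<nu> = 0" if "i < CARD('n) - 1" for i
    using e(1) that unfolding inward_normal_def \<nu>_def N_def by simp
  have \<kappa>: "length \<kappa> = CARD('n) - 1" "in_cone (p - 1) \<kappa>" using cone by (simp_all add: Gamma_cone_iff)
  have sym: "transpose (hessian \<rho> x) = hessian \<rho> x" using R(1,2) by (intro hessian_symmetric) auto
  have cN: "c * norm N > 0" using c N by simp
  obtain A \<epsilon> where A: "\<epsilon> > 0" "A \<ge> 0"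
    "Gamma_form p (\<lambda>y. y \<bullet> (hessian \<rho> x *v y) + A * (y \<bullet> \<nu>)\<^sup>2 - \<epsilon> * (y \<bullet> y))"
    by (rule Gamma_form_bordered[OF sym \<kappa> p cN \<nu> e\<nu> ee tang])
  have "A * (y \<bullet> \<nu>)\<^sup>2 = (A / (c * norm N)\<^sup>2) * (grad \<rho> x \<bullet> y)\<^sup>2" for y
  proof -
    have "grad \<rho> x \<bullet> y = (c * norm N) * (y \<bullet> \<nu>)" using N by (simp add: c(2) \<nu>_def inner_commute)
    then show ?thesis using N c(1) by (simp add: power_mult_distrib)
  qed
  then show ?thesis using A by (intro that[of "A / (c * norm N)\<^sup>2" \<epsilon>]) (auto simp: hess_form_def)
qed

text \<open>On the compact set of points of the closure outside \<open>W\<close>, the function \<open>\<rho>\<close> has a negative maximum.\<close>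
lemma near_frontier:
  fixes \<Omega> :: "(real ^ 'n) set"
  assumes "bounded \<Omega>" and \<rho>: "sign_defining \<Omega> UNIV \<rho>" and W: "open W" "frontier \<Omega> \<subseteq> W"
  obtains \<delta> where "\<delta> > 0" "\<And>x. x \<in> closure \<Omega> \<Longrightarrow> - \<delta> < \<rho> x \<Longrightarrow> x \<in> W"
proof -
  define K where "K = closure \<Omega> - W"
  have "compact K" unfolding K_def using assms(1) W(1) by (intro compact_diff) auto
  have neg: "\<rho> x < 0" if "x \<in> K" for x
    using that W(2) closure_Un_frontier[of \<Omega>] sign_definingD(3)[OF \<rho>, of x] by (auto simp: K_def)
  show ?thesis
  proof (cases "K = {}")
    case True
    then show ?thesis by (intro that[of 1]) (auto simp: K_def)
  next
    case False
    have "continuous_on K \<rho>"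
      using smooth_on_continuous[OF sign_definingD(2)[OF \<rho>]] by (rule continuous_on_subset) simp
    then obtain x0 where x0: "x0 \<in> K" "\<And>x. x \<in> K \<Longrightarrow> \<rho> x \<le> \<rho> x0"
      using continuous_attains_sup[OF \<open>compact K\<close> False] by blast
    show ?thesis
    proof (rule that[of "- \<rho> x0"])
      show "- \<rho> x0 > 0" using neg[OF x0(1)] by simp
      show "x \<in> W" if "x \<in> closure \<Omega>" "- (- \<rho> x0) < \<rho> x" for x
        using x0(2)[of x] that by (force simp: K_def)
    qed
  qed
qed

text \<open>Enlarging \<open>A\<close> and shrinking \<open>\<epsilon>\<close> preserve the conclusion at a point, so finitely many balls suffice.\<close>
lemma Gamma_form_near_frontier:
  fixes \<Omega> :: "(real ^ 'n) set"
  assumes \<Omega>: "open \<Omega>" "bounded \<Omega>" and \<rho>: "sign_defining \<Omega> UNIV \<rho>"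
    and convex: "strictly_convex_order (p - 1) \<Omega>" and p: "1 \<le> p"
  obtains A \<epsilon> \<delta> where "A \<ge> 0" "\<epsilon> > 0" "\<delta> > 0"
    "\<And>x. x \<in> closure \<Omega> \<Longrightarrow> - \<delta> < \<rho> x \<Longrightarrow>
      Gamma_form p (\<lambda>y. hess_form \<rho> x y + A * (grad \<rho> x \<bullet> y)\<^sup>2 - \<epsilon> * (y \<bullet> y))"
proof -
  note R = sign_definingD[OF \<rho>]
  let ?T = "\<lambda>A \<epsilon> x. Gamma_form p (\<lambda>y. hess_form \<rho> x y + A * (grad \<rho> x \<bullet> y)\<^sup>2 - \<epsilon> * (y \<bullet> y))"
  define ok where "ok = (\<lambda>x0 A \<epsilon> d. A \<ge> 0 \<and> \<epsilon> > 0 \<and> d > 0 \<and> (\<forall>x\<in>ball x0 d. ?T A \<epsilon> x))"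
  have "\<exists>A \<epsilon> d. ok x0 A \<epsilon> d" if x0: "x0 \<in> frontier \<Omega>" for x0
  proof -
    obtain A \<epsilon> where A: "A \<ge> 0" "\<epsilon> > 0" "?T A \<epsilon> x0"
      using Gamma_form_at_frontier[OF \<Omega>(1) \<rho> convex p x0] by blast
    obtain d where d: "d > 0" "\<And>x y. x \<in> ball x0 d \<Longrightarrow>
        hess_form \<rho> x0 y + A * (grad \<rho> x0 \<bullet> y)\<^sup>2 - \<epsilon> / 2 * (y \<bullet> y) \<le> hess_form \<rho> x y + A * (grad \<rho> x \<bullet> y)\<^sup>2"
      using hess_form_rank_one_near[OF R(1,2), of x0 "\<epsilon> / 2" A] A(2) by auto
    have "?T A (\<epsilon> / 2) x" if "x \<in> ball x0 d" for x
    proof (rule Gamma_form_mono[OF A(3)])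
      fix y
      show "hess_form \<rho> x0 y + A * (grad \<rho> x0 \<bullet> y)\<^sup>2 - \<epsilon> * (y \<bullet> y)
        \<le> hess_form \<rho> x y + A * (grad \<rho> x \<bullet> y)\<^sup>2 - \<epsilon> / 2 * (y \<bullet> y)"
        using d(2)[OF that, of y] by simp
    qed
    then have "ok x0 A (\<epsilon> / 2) d" using A d(1) unfolding ok_def by auto
    then show ?thesis by blast
  qed
  then obtain A \<epsilon> d where ok: "\<And>x. x \<in> frontier \<Omega> \<Longrightarrow> ok x (A x) (\<epsilon> x) (d x)"
    by metis
  have loc: "A x \<ge> 0" "\<epsilon> x > 0" "d x > 0" "\<And>z. z \<in> ball x (d x) \<Longrightarrow> ?T (A x) (\<epsilon> x) z"
    if "x \<in> frontier \<Omega>" for x using ok[OF that] unfolding ok_def by auto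
  have comp: "compact (frontier \<Omega>)" using \<Omega>(2) by (rule compact_frontier_bounded)
  obtain F where F: "F \<subseteq> frontier \<Omega>" "finite F" "frontier \<Omega> \<subseteq> (\<Union>x\<in>F. ball x (d x))"
  proof (rule compactE_image[OF comp, of "frontier \<Omega>" "\<lambda>x. ball x (d x)"])
    show "frontier \<Omega> \<subseteq> (\<Union>x\<in>frontier \<Omega>. ball x (d x))" using loc(3) by force
  qed auto
  define A0 where "A0 = (\<Sum>x\<in>F. A x)"
  define \<epsilon>0 where "\<epsilon>0 = Min (insert 1 (\<epsilon> ` F))"
  have A0: "A0 \<ge> 0" "\<And>x. x \<in> F \<Longrightarrow> A x \<le> A0"
    unfolding A0_def using loc(1) F(1,2) by (auto intro!: sum_nonneg member_le_sum)
  have \<epsilon>0: "\<epsilon>0 > 0" "\<And>x. x \<in> F \<Longrightarrow> \<epsilon>0 \<le> \<epsilon> x"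
    unfolding \<epsilon>0_def using loc(2) F(1,2) by auto
  obtain \<delta> where \<delta>: "\<delta> > 0" "\<And>x. x \<in> closure \<Omega> \<Longrightarrow> - \<delta> < \<rho> x \<Longrightarrow> x \<in> (\<Union>x\<in>F. ball x (d x))"
    using near_frontier[OF \<Omega>(2) \<rho> _ F(3)] by blast
  have "?T A0 \<epsilon>0 z" if z: "z \<in> closure \<Omega>" "- \<delta> < \<rho> z" for z
  proof -
    obtain x where x: "x \<in> F" "z \<in> ball x (d x)" using \<delta>(2)[OF z] by blast
    then have "?T (A x) (\<epsilon> x) z" using loc(4) F(1) by blast
    then show ?thesis
    proof (rule Gamma_form_mono)
      fix y
      have "A x * (grad \<rho> z \<bullet> y)\<^sup>2 \<le> A0 * (grad \<rho> z \<bullet> y)\<^sup>2" using A0(2)[OF x(1)] by (simp add: mult_right_mono)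
      moreover have "\<epsilon>0 * (y \<bullet> y) \<le> \<epsilon> x * (y \<bullet> y)" using \<epsilon>0(2)[OF x(1)] by (simp add: mult_right_mono)
      ultimately show "hess_form \<rho> z y + A x * (grad \<rho> z \<bullet> y)\<^sup>2 - \<epsilon> x * (y \<bullet> y)
        \<le> hess_form \<rho> z y + A0 * (grad \<rho> z \<bullet> y)\<^sup>2 - \<epsilon>0 * (y \<bullet> y)" by linarith
    qed
  qed
  then show ?thesis using that[OF A0(1) \<epsilon>0(1) \<delta>(1)] by blast
qed

section \<open>A strictly subharmonic function vanishing on the boundary\<close>

lemma smooth_on_half_square:
  assumes "open U" shows "smooth_on U (\<lambda>x. (x \<bullet> x - R) / 2)"
proof -
  have "smooth_on U (\<lambda>x. (1 / 2) * ((x - 0) \<bullet> (x - 0) - R))"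
    using assms by (intro smooth_on_mult smooth_on_diff smooth_on_const smooth_on_inner_self)
  then show ?thesis by simp
qed

text \<open>With \<open>f\<close> the flat function, \<open>\<eta> = M (f (\<rho> + \<delta>) - f \<delta>) + \<kappa> (\<rho>) (|x|\<^sup>2 - R) / 2\<close>, where the cut-off
  \<open>\<kappa> (t) = 1 - f (t + \<delta> / 2) / f (\<delta> / 2)\<close> is \<open>1\<close> for \<open>t \<le> - \<delta> / 2\<close> and \<open>0\<close> at \<open>t = 0\<close>. Where
  \<open>\<rho> < - \<delta> / 2\<close> the second summand contributes the identity to the Hessian and the first one only helps. Elsewhere
  the derivative of \<open>f (\<rho> + \<delta>)\<close> is bounded below, and a large \<open>M\<close> dominates the Hessian of the second
  summand. With \<open>R\<close> at least the maximum of \<open>|x|\<^sup>2\<close>, both summands are nonpositive.\<close>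
lemma Gamma_subharmonic_exists:
  fixes \<Omega> :: "(real ^ 'n) set"
  assumes \<Omega>: "open \<Omega>" "bounded \<Omega>" and \<rho>: "sign_defining \<Omega> UNIV \<rho>"
    and convex: "strictly_convex_order (p - 1) \<Omega>" and p: "1 \<le> p" "p \<le> CARD('n)"
  obtains \<eta> where "smooth_on UNIV \<eta>" "\<And>x. x \<in> frontier \<Omega> \<Longrightarrow> \<eta> x = 0" "\<And>x. x \<in> closure \<Omega> \<Longrightarrow> \<eta> x \<le> 0"
    "\<And>x. x \<in> closure \<Omega> \<Longrightarrow> Gamma_form p (\<lambda>y. hess_form \<eta> x y - 1 / 2 * (y \<bullet> y))"
proof -
  note R = sign_definingD[OF \<rho>]
  have le0: "\<rho> x \<le> 0" if "x \<in> closure \<Omega>" for x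
    using that closure_Un_frontier[of \<Omega>] R(3)[of x] R(4)[of x] by auto
  obtain A \<epsilon> \<delta>0 where A: "A \<ge> 0" "\<epsilon> > 0" "\<delta>0 > 0" and
    P0: "\<And>x. x \<in> closure \<Omega> \<Longrightarrow> - \<delta>0 < \<rho> x \<Longrightarrow>
      Gamma_form p (\<lambda>y. hess_form \<rho> x y + A * (grad \<rho> x \<bullet> y)\<^sup>2 - \<epsilon> * (y \<bullet> y))"
    using Gamma_form_near_frontier[OF \<Omega> \<rho> convex p(1)] by blast
  \<comment> \<open>Since \<open>flat 2 t / flat 1 t = (1 / t) (1 / t - 2)\<close>, this quotient is at least \<open>A\<close> as soon as \<open>1 / t \<ge> A + 2\<close>.\<close>
  define \<delta> where "\<delta> = min \<delta>0 (1 / (A + 2))"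
  have \<delta>: "\<delta> > 0" "\<delta> \<le> \<delta>0" "\<delta> \<le> 1 / (A + 2)" using A by (auto simp: \<delta>_def)
  have flat2: "A * flat 1 t \<le> flat 2 t" if "t \<le> \<delta>" for t
  proof (cases "t > 0")
    case True
    have "t * (A + 2) \<le> \<delta> * (A + 2)" using that A(1) by (intro mult_right_mono) auto
    also have "\<dots> \<le> 1" using \<delta>(3) A(1) by (simp add: pos_le_divide_eq add_nonneg_pos)
    finally have "t * (A + 2) \<le> 1" .
    then have inv: "A + 2 \<le> 1 / t" using True by (simp add: pos_le_divide_eq mult.commute)
    have "A * 1 \<le> (1 / t - 2) * (1 / t)" using inv A(1) by (intro mult_mono) auto
    then have "A \<le> 1 / t\<^sup>2 - 2 / t" using True by (simp add: power2_eq_square field_simps)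
    then have "exp (- (1 / t)) / t\<^sup>2 * A \<le> exp (- (1 / t)) / t\<^sup>2 * (1 / t\<^sup>2 - 2 / t)"
      by (intro mult_left_mono) auto
    then show ?thesis unfolding flat_1 flat_2 using True by (simp add: mult.commute)
  qed (simp add: flat_def)
  obtain R0 where R0: "\<And>x. x \<in> closure \<Omega> \<Longrightarrow> x \<bullet> x \<le> R0"
  proof -
    have "bounded (closure \<Omega>)" using \<Omega>(2) by (rule bounded_closure)
    then obtain B where "\<And>x. x \<in> closure \<Omega> \<Longrightarrow> norm x \<le> B" unfolding bounded_iff by blast
    then have "x \<bullet> x \<le> B\<^sup>2" if "x \<in> closure \<Omega>" for x
      using that power_mono[of "norm x" B 2] by (simp add: power2_norm_eq_inner)
    then show ?thesis using that by blast
  qed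
  define f0 where "f0 = flat 0 (\<delta> / 2)"
  have f0: "f0 > 0" using \<delta>(1) by (simp add: f0_def flat_0)
  define K where "K = (\<lambda>m t. (- 1 / f0) * flat m (t + \<delta> / 2) + (if m = 0 then 1 else 0))"
  have K: "deriv_seq K" unfolding K_def by (rule deriv_seq_affine[OF deriv_seq_flat])
  define s where "s = (\<lambda>x :: real ^ 'n. (x \<bullet> x - R0) / 2)"
  define q where "q = (\<lambda>x. K 0 (\<rho> x) * s x)"
  have s_smooth: "smooth_on U s" if "open U" for U unfolding s_def by (rule smooth_on_half_square[OF that])
  have q_smooth: "smooth_on UNIV q"
    unfolding q_def using R(2) by (intro smooth_on_mult s_smooth smooth_on_compose[OF K]) auto
  have flat_mono: "flat 0 a \<le> flat 0 b" if "a \<le> b" for a b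
    using that by (auto simp: flat_0 intro: divide_left_mono frac_le)
  have K_nonneg: "K 0 t \<ge> 0" if "t \<le> 0" for t
    using flat_mono[of "t + \<delta> / 2" "\<delta> / 2"] that f0 by (simp add: K_def f0_def)
  have K_0: "K 0 0 = 0" using f0 by (simp add: K_def f0_def)
  have compact: "compact (closure \<Omega>)" using \<Omega>(2) by simp
  obtain Cq where Cq: "0 \<le> Cq" "\<And>x y. x \<in> closure \<Omega> \<Longrightarrow> \<bar>hess_form q x y\<bar> \<le> Cq * (y \<bullet> y)"
    using hess_form_bounded_on_compact[OF q_smooth compact] by auto
  \<comment> \<open>A lower bound for \<open>flat 1\<close> on the interval from \<open>\<delta> / 2\<close> to \<open>\<delta>\<close>.\<close>
  define m0 where "m0 = exp (- (2 / \<delta>)) / \<delta>\<^sup>2"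
  have m0: "m0 > 0" using \<delta>(1) by (simp add: m0_def)
  have flat1: "m0 \<le> flat 1 t" if "\<delta> / 2 \<le> t" "t \<le> \<delta>" for t
  proof -
    have t: "t > 0" using that \<delta>(1) by linarith
    have "1 / t \<le> 1 / (\<delta> / 2)" using that \<delta>(1) t by (intro divide_left_mono) auto
    then have "exp (- (2 / \<delta>)) \<le> exp (- (1 / t))" by simp
    moreover have "t\<^sup>2 \<le> \<delta>\<^sup>2" using that t by (intro power_mono) auto
    ultimately have "m0 \<le> exp (- (1 / t)) / t\<^sup>2" unfolding m0_def using t by (intro frac_le) auto
    then show ?thesis unfolding flat_1 using t by simp
  qed
  have flat1_nonneg: "0 \<le> flat 1 t" for t unfolding flat_1 by simp
  define M where "M = (Cq + 1) / (m0 * \<epsilon>)"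
  have M: "M > 0" "M * m0 * \<epsilon> = Cq + 1" using Cq(1) m0 A(2) by (simp_all add: M_def)
  define E where "E = (\<lambda>m t. M * flat m (t + \<delta>) + (if m = 0 then - M * flat 0 \<delta> else 0))"
  have E: "deriv_seq E" unfolding E_def by (rule deriv_seq_affine[OF deriv_seq_flat])
  define \<eta> where "\<eta> = (\<lambda>x. E 0 (\<rho> x) + q x)"
  have E_smooth: "smooth_on UNIV (\<lambda>x. E 0 (\<rho> x))" using smooth_on_compose[OF E _ R(2)] by simp
  have \<eta>_smooth: "smooth_on UNIV \<eta>" unfolding \<eta>_def using E_smooth q_smooth by auto
  have "\<eta> x = 0" if "x \<in> frontier \<Omega>" for x
    using R(4)[of x] that K_0 by (simp add: \<eta>_def q_def E_def)
  moreover have "\<eta> x \<le> 0" if x: "x \<in> closure \<Omega>" for x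
  proof -
    have "M * flat 0 (\<rho> x + \<delta>) \<le> M * flat 0 \<delta>"
      using flat_mono[of "\<rho> x + \<delta>" \<delta>] le0[OF x] M(1) by (intro mult_left_mono) auto
    moreover have "q x \<le> 0"
      using K_nonneg[OF le0[OF x]] R0[OF x] by (simp add: q_def s_def mult_nonneg_nonpos)
    ultimately show ?thesis by (simp add: \<eta>_def E_def)
  qed
  moreover have "Gamma_form p (\<lambda>y. hess_form \<eta> x y - 1 / 2 * (y \<bullet> y))" if x: "x \<in> closure \<Omega>" for x
  proof -
    define t where "t = \<rho> x + \<delta>"
    have t\<delta>: "t \<le> \<delta>" using le0[OF x] by (simp add: t_def)
    define P where "P = (\<lambda>y. hess_form \<rho> x y + A * (grad \<rho> x \<bullet> y)\<^sup>2 - \<epsilon> * (y \<bullet> y))"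
    define m where "m = M * flat 1 t"
    have m: "m \<ge> 0" using M(1) flat1_nonneg by (simp add: m_def)
    have lower: "hess_form \<eta> x y \<ge> m * P y + m * \<epsilon> * (y \<bullet> y) + hess_form q x y" for y
    proof -
      have "hess_form \<eta> x y = E (Suc 0) (\<rho> x) * hess_form \<rho> x y
          + E (Suc (Suc 0)) (\<rho> x) * (grad \<rho> x \<bullet> y)\<^sup>2 + hess_form q x y"
        unfolding \<eta>_def using hess_form_add[OF _ E_smooth q_smooth] hess_form_compose[OF E _ R(2)] by simp
      also have "E (Suc 0) (\<rho> x) = m" by (simp add: E_def m_def t_def)
      also have "E (Suc (Suc 0)) (\<rho> x) = M * flat 2 t" by (simp add: E_def t_def numeral_2_eq_2)
      finally have "hess_form \<eta> x y = m * hess_form \<rho> x y + M * flat 2 t * (grad \<rho> x \<bullet> y)\<^sup>2 + hess_form q x y" .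
      moreover have "M * (A * flat 1 t) * (grad \<rho> x \<bullet> y)\<^sup>2 \<le> M * flat 2 t * (grad \<rho> x \<bullet> y)\<^sup>2"
        using flat2[OF t\<delta>] M(1) by (intro mult_right_mono mult_left_mono) auto
      ultimately show ?thesis by (simp add: P_def m_def algebra_simps)
    qed
    show ?thesis
    proof (cases "\<rho> x < - \<delta> / 2")
      case True
      have "open {z. \<rho> z < - \<delta> / 2}"
        using smooth_on_continuous[OF R(2)] by (intro open_Collect_less) auto
      moreover have "s z = q z" if "z \<in> {z. \<rho> z < - \<delta> / 2}" for z
        using that by (simp add: q_def K_def flat_0)
      ultimately have sq: "hess_form s x y = hess_form q x y" for y
        using True s_smooth by (intro hess_form_cong_open[of "{z. \<rho> z < - \<delta> / 2}"]) auto
      have hq: "hess_form q x y = y \<bullet> y" for y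
      proof -
        have "hess_form s x y = y \<bullet> y" unfolding s_def by (rule hess_form_half_square)
        then show ?thesis using sq[of y] by simp
      qed
      have low: "m * P y + 1 / 2 * (y \<bullet> y) \<le> hess_form \<eta> x y - 1 / 2 * (y \<bullet> y)" for y
      proof -
        have "0 \<le> m * \<epsilon> * (y \<bullet> y)" using m A(2) by simp
        then show ?thesis using lower[of y] by (simp add: hq)
      qed
      show ?thesis
      proof (cases "\<rho> x > - \<delta>")
        case True
        then have "Gamma_form p P" unfolding P_def using P0[OF x] \<delta>(2) by simp
        from Gamma_form_add_scalar[OF this m, of "1 / 2"] show ?thesis
          using low by (auto intro: Gamma_form_mono)
      next
        case False
        then have "flat 1 t = 0" unfolding flat_1 by (simp add: t_def)
        then have "m = 0" by (simp add: m_def)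
        then show ?thesis using Gamma_form_mono[OF Gamma_form_scalar[OF p(2), of "1 / 2"]] low by simp
      qed
    next
      case False
      then have "\<delta> / 2 \<le> t" by (simp add: t_def)
      then have fl: "m0 \<le> flat 1 t" using flat1 t\<delta> by blast
      then have mm: "m \<ge> M * m0" "m > 0" using M(1) m0 by (auto simp: m_def mult_left_mono less_le_trans)
      have "M * m0 * \<epsilon> \<le> m * \<epsilon>" using mm(1) A(2) by (simp add: mult_right_mono)
      then have "Cq + 1 \<le> m * \<epsilon>" using M(2) by simp
      then have Cq1: "(Cq + 1) * (y \<bullet> y) \<le> m * \<epsilon> * (y \<bullet> y)" for y by (intro mult_right_mono) auto
      have low: "m * P y \<le> hess_form \<eta> x y - 1 / 2 * (y \<bullet> y)" for y
      proof -
        have "Cq * (y \<bullet> y) + y \<bullet> y \<le> m * \<epsilon> * (y \<bullet> y)" using Cq1[of y] by (simp add: distrib_right)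
        moreover have "- (Cq * (y \<bullet> y)) \<le> hess_form q x y" using Cq(2)[OF x, of y] by linarith
        moreover have "0 \<le> y \<bullet> y" by simp
        ultimately show ?thesis using lower[of y] by linarith
      qed
      have "Gamma_form p P" unfolding P_def using P0[OF x] \<delta>(1,2) False by simp
      from Gamma_form_mono[OF Gamma_form_scale[OF this mm(2)] low] show ?thesis .
    qed
  qed
  ultimately show ?thesis using that[OF \<eta>_smooth] by blast
qed

text \<open>Multiply by a cut-off function of \<open>\<rho>\<close> that is \<open>1\<close> on the boundary and vanishes before the domain of
  \<open>g\<close> ends.\<close>
lemma smooth_extension_from_frontier:
  fixes \<Omega> :: "(real ^ 'n) set"
  assumes \<Omega>: "bounded \<Omega>" and \<rho>: "sign_defining \<Omega> UNIV \<rho>" and \<psi>: "smooth_restriction (frontier \<Omega>) \<psi>"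
  obtains U \<Psi> where "open U" "closure \<Omega> \<subseteq> U" "smooth_on U \<Psi>" "\<And>x. x \<in> frontier \<Omega> \<Longrightarrow> \<Psi> x = \<psi> x"
proof -
  note R = sign_definingD[OF \<rho>]
  obtain g W where g: "open W" "frontier \<Omega> \<subseteq> W" "smooth_on W g" "\<And>x. x \<in> frontier \<Omega> \<Longrightarrow> g x = \<psi> x"
    using \<psi> unfolding smooth_restriction_def smooth_near_def smooth_on_def by blast
  obtain \<delta> where \<delta>: "\<delta> > 0" "\<And>x. x \<in> closure \<Omega> \<Longrightarrow> - \<delta> < \<rho> x \<Longrightarrow> x \<in> W"
    using near_frontier[OF \<Omega> \<rho> g(1,2)] by blast
  define D where "D = (\<lambda>m t. (1 / flat 0 (\<delta> / 2)) * flat m (t + \<delta> / 2))"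
  have D: "deriv_seq D"
    using deriv_seq_affine[OF deriv_seq_flat, of "1 / flat 0 (\<delta> / 2)" "\<delta> / 2" 0] by (simp add: D_def)
  define \<Psi> where "\<Psi> = (\<lambda>x. D 0 (\<rho> x) * g x)"
  define V where "V = {x. \<rho> x < - \<delta> / 2}"
  have V: "open V" unfolding V_def using smooth_on_continuous[OF R(2)] by (intro open_Collect_less) auto
  have "smooth_on W \<Psi>"
    unfolding \<Psi>_def using g(1,3) smooth_on_subset[OF R(2)] by (intro smooth_on_mult smooth_on_compose[OF D]) auto
  moreover have "smooth_on V \<Psi>"
  proof (rule smooth_on_cong[OF V])
    show "0 = \<Psi> x" if "x \<in> V" for x using that by (simp add: V_def \<Psi>_def D_def flat_0)
  qed auto
  ultimately have "smooth_on (W \<union> V) \<Psi>" using g(1) V by (intro smooth_on_Un)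
  moreover have "closure \<Omega> \<subseteq> W \<union> V" using \<delta> by (force simp: V_def)
  moreover have "\<Psi> x = \<psi> x" if "x \<in> frontier \<Omega>" for x
    using g(4)[OF that] R(4)[of x] that \<delta>(1) by (simp add: \<Psi>_def D_def flat_0)
  ultimately show ?thesis using that[of "W \<union> V" \<Psi>] g(1) V by blast
qed

section \<open>The subsolution\<close>

lemma sublinear_powr_eventually:
  fixes \<alpha> :: real
  assumes "0 < \<alpha>" "\<alpha> < 1" "0 < k"
  shows "\<forall>\<^sub>F M in at_top. a + b * (c + M) powr \<alpha> \<le> k * M"
  using assms by real_asymp

theorem proposition3p1:
  fixes \<Omega> :: "(real ^ 'n) set"
    and \<psi> :: "real ^ 'n \<Rightarrow> real"
    and \<phi> :: "real ^ 'n \<Rightarrow> real \<Rightarrow> real"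
    and p :: nat and \<alpha> :: real
  assumes "1 \<le> p" and "p \<le> CARD('n)"
    and "0 < \<alpha>" and "\<alpha> < 1"
    and "open \<Omega>" and "connected \<Omega>" and "\<Omega> \<noteq> {}" and "bounded \<Omega>"
    and "smooth_boundary \<Omega>"
    and "strictly_convex_order (p - 1) \<Omega>"
    and "smooth_restriction (frontier \<Omega>) \<psi>"
    and "continuous_on (closure \<Omega> \<times> UNIV) (\<lambda>(x, t). \<phi> x t)"
    and "\<forall>x\<in>closure \<Omega>. \<forall>t. \<phi> x t > 0"
    and "\<forall>x\<in>closure \<Omega>. mono (\<phi> x)"
  shows "\<exists>v. smooth_near (closure \<Omega>) v \<and>
    (\<forall>x\<in>closure \<Omega>. elem_sym p (eigenvals (hessian v x)) powr (1 / real p)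
        \<ge> \<phi> x (v x) * (1 + norm (grad v x) + \<bar>v x\<bar> powr \<alpha>)) \<and>
    (\<forall>x\<in>closure \<Omega>. eigenvals (hessian v x) \<in> Gamma_cone CARD('n) p) \<and>
    (\<forall>x\<in>frontier \<Omega>. v x = \<psi> x)"
proof -
  obtain \<rho> where \<rho>: "sign_defining \<Omega> UNIV \<rho>"
    using global_defining_function[OF assms(5,8,9)] .
  obtain \<eta> where \<eta>: "smooth_on UNIV \<eta>" "\<And>x. x \<in> frontier \<Omega> \<Longrightarrow> \<eta> x = 0"
      "\<And>x. x \<in> closure \<Omega> \<Longrightarrow> \<eta> x \<le> 0"
      "\<And>x. x \<in> closure \<Omega> \<Longrightarrow> Gamma_form p (\<lambda>y. hess_form \<eta> x y - 1 / 2 * (y \<bullet> y))"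
    using Gamma_subharmonic_exists[OF assms(5,8) \<rho> assms(10,1,2)] by blast
  obtain U \<Psi> where U: "open U" "closure \<Omega> \<subseteq> U" and \<Psi>: "smooth_on U \<Psi>"
      "\<And>x. x \<in> frontier \<Omega> \<Longrightarrow> \<Psi> x = \<psi> x"
    using smooth_extension_from_frontier[OF assms(8) \<rho> assms(11)] by blast
  have compact: "compact (closure \<Omega>)" using assms(8) by simp
  have bound: "\<exists>B\<ge>0. \<forall>x\<in>closure \<Omega>. norm (h x) \<le> B" if "continuous_on (closure \<Omega>) h"
    for h :: "real ^ 'n \<Rightarrow> 'b :: real_normed_vector"
  proof -
    have "bounded (h ` closure \<Omega>)"
      using compact_continuous_image[OF that compact] compact_imp_bounded by blast
    then obtain B where "\<And>x. x \<in> closure \<Omega> \<Longrightarrow> norm (h x) \<le> B" unfolding bounded_iff by auto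
    then show ?thesis by (intro exI[of _ "\<bar>B\<bar>"]) force
  qed
  obtain P0 where P0: "P0 \<ge> 0" "\<And>x. x \<in> closure \<Omega> \<Longrightarrow> \<bar>\<Psi> x\<bar> \<le> P0"
    using bound[OF continuous_on_subset[OF smooth_on_continuous[OF \<Psi>(1)] U(2)]] by auto
  obtain P1 where P1: "P1 \<ge> 0" "\<And>x. x \<in> closure \<Omega> \<Longrightarrow> norm (grad \<Psi> x) \<le> P1"
    using bound[OF continuous_on_subset[OF continuous_on_grad[OF \<Psi>(1)] U(2)]] by auto
  obtain P2 where P2: "P2 \<ge> 0" "\<And>x. x \<in> closure \<Omega> \<Longrightarrow> norm (grad \<eta> x) \<le> P2"
    using bound[OF continuous_on_subset[OF continuous_on_grad[OF \<eta>(1)] subset_UNIV]] by auto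
  obtain S where S: "S \<ge> 0" "\<And>x. x \<in> closure \<Omega> \<Longrightarrow> \<bar>\<eta> x\<bar> \<le> S"
    using bound[OF continuous_on_subset[OF smooth_on_continuous[OF \<eta>(1)] subset_UNIV]] by auto
  obtain C where C: "0 \<le> C" "\<And>x y. x \<in> closure \<Omega> \<Longrightarrow> \<bar>hess_form \<Psi> x y\<bar> \<le> C * (y \<bullet> y)"
    using hess_form_bounded_on_compact[OF \<Psi>(1) compact U(2)] by blast
  have "continuous_on (closure \<Omega>) (\<lambda>x. (\<lambda>(x, t). \<phi> x t) (x, P0))"
    by (rule continuous_on_compose2[OF assms(12)]) (auto intro!: continuous_intros)
  then obtain F0 where F0: "F0 \<ge> 0" "\<And>x. x \<in> closure \<Omega> \<Longrightarrow> \<bar>\<phi> x P0\<bar> \<le> F0"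
    using bound[of "\<lambda>x. \<phi> x P0"] by auto
  define F where "F = F0 + 1"
  have F: "F > 0" using F0(1) by (simp add: F_def)
  \<comment> \<open>The margin \<open>1 / 2\<close> in the Hessian of \<open>\<eta>\<close> is \<open>2 c\<close>: one \<open>c\<close> absorbs the Hessian of \<open>\<Psi>\<close>, the other one bounds
    \<open>\<sigma>\<^sub>p\<close> from below. Of the resulting \<open>c\<close> in the \<open>p\<close>-th root, half pays for the terms other than
    \<open>|D\<eta>|\<close>.\<close>
  define c where "c = (1 / 4 :: real)"
  have c: "c > 0" by (simp add: c_def)
  \<comment> \<open>Only gradients with \<open>F |D\<eta>| > c / 2\<close> need the term with \<open>B\<close>, and for them \<open>|D\<eta>|\<close> is bounded away from \<open>0\<close>.\<close>
  define B where "B = (F * P2 + c / 2) ^ p / (c ^ (p - 1) * (c / (2 * F))\<^sup>2)"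
  have den: "c ^ (p - 1) * (c / (2 * F))\<^sup>2 > 0" using c F by simp
  have B: "B > 0" unfolding B_def using F P2(1) c den by (intro divide_pos_pos zero_less_power add_nonneg_pos) auto
  have key: "(F * g + c / 2) ^ p \<le> c ^ p + c ^ (p - 1) * (B * g\<^sup>2)" if g: "0 \<le> g" "g \<le> P2" for g
  proof (cases "F * g \<le> c / 2")
    case True
    have "(F * g + c / 2) ^ p \<le> c ^ p" using True F g(1) c by (intro power_mono) auto
    then show ?thesis using c B by (simp add: add_increasing2)
  next
    case False
    then have "c / (2 * F) \<le> g" using F by (simp add: field_simps)
    then have "(c / (2 * F))\<^sup>2 \<le> g\<^sup>2" using c F by (intro power_mono) auto
    have "(F * g + c / 2) ^ p \<le> (F * P2 + c / 2) ^ p" using F g c by (intro power_mono add_mono mult_left_mono) auto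
    also have "\<dots> = c ^ (p - 1) * (B * (c / (2 * F))\<^sup>2)" using c F by (simp add: B_def)
    also have "\<dots> \<le> c ^ (p - 1) * (B * g\<^sup>2)"
      using \<open>(c / (2 * F))\<^sup>2 \<le> g\<^sup>2\<close> c B by (intro mult_left_mono) auto
    also have "\<dots> \<le> c ^ p + c ^ (p - 1) * (B * g\<^sup>2)" using c by simp
    finally show ?thesis .
  qed
  \<comment> \<open>On the closure of \<open>\<Omega>\<close> the factor \<open>h = M B exp (B \<eta>)\<close> is at least \<open>M k\<close>.\<close>
  define k where "k = B * exp (- (B * S))"
  have k: "k > 0" using B by (simp add: k_def)
  have "\<forall>\<^sub>F M in at_top. F * (1 + P1) + F * (P0 + M) powr \<alpha> \<le> (c / 2 * k) * M"
    using assms(3,4) c k by (intro sublinear_powr_eventually) auto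
  moreover have "\<forall>\<^sub>F M in at_top. C / (k * c) \<le> M" by (rule eventually_ge_at_top)
  moreover have "\<forall>\<^sub>F M in at_top. (0::real) < M" by (rule eventually_gt_at_top)
  ultimately have "\<forall>\<^sub>F M in at_top. F * (1 + P1) + F * (P0 + M) powr \<alpha> \<le> (c / 2 * k) * M \<and> C / (k * c) \<le> M \<and> 0 < M"
    by eventually_elim blast
  then obtain M where M: "F * (1 + P1) + F * (P0 + M) powr \<alpha> \<le> (c / 2 * k) * M" "C / (k * c) \<le> M" "0 < M"
    using eventually_happens' trivial_limit_at_top_linorder by blast
  define G where "G = (\<lambda>m t. M * (B ^ m * exp (B * t)) + (if m = 0 then - M else 0))"
  have G: "deriv_seq G" unfolding G_def by (rule deriv_seq_exp)
  define v where "v = (\<lambda>x. \<Psi> x + G 0 (\<eta> x))"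
  have \<eta>U: "smooth_on U \<eta>" using smooth_on_subset[OF \<eta>(1)] by simp
  have G\<eta>: "smooth_on U (\<lambda>x. G 0 (\<eta> x))" by (rule smooth_on_compose[OF G U(1) \<eta>U])
  have v_smooth: "smooth_on U v" unfolding v_def by (rule smooth_on_add[OF U(1) \<Psi>(1) G\<eta>])
  have main: "eigenvals (hessian v x) \<in> Gamma_cone CARD('n) p \<and>
      \<phi> x (v x) * (1 + norm (grad v x) + \<bar>v x\<bar> powr \<alpha>) \<le> elem_sym p (eigenvals (hessian v x)) powr (1 / real p)"
    if x: "x \<in> closure \<Omega>" for x
  proof -
    have xU: "x \<in> U" using x U(2) by blast
    define h where "h = M * (B * exp (B * \<eta> x))"
    define g where "g = norm (grad \<eta> x)"
    have "- (B * S) \<le> B * \<eta> x" using S(2)[OF x] B by (metis abs_le_iff minus_le_iff mult_left_mono mult_minus_right less_imp_le)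
    then have h_ge: "M * k \<le> h" unfolding h_def k_def using M(3) B by (intro mult_left_mono) auto
    have h: "h > 0" using M(3) B by (simp add: h_def)
    have hC: "C \<le> h * c"
    proof -
      have "C \<le> M * k * c" using M(2) k c by (simp add: pos_divide_le_eq mult_ac)
      also have "\<dots> \<le> h * c" using h_ge c by (intro mult_right_mono) auto
      finally show ?thesis .
    qed
    have form: "h * (hess_form \<eta> x y - 1 / 2 * (y \<bullet> y)) + h * c * (y \<bullet> y) + h * B * (y \<bullet> grad \<eta> x)\<^sup>2
        \<le> y \<bullet> (hessian v x *v y)" for y
    proof -
      have "hess_form v x y = hess_form \<Psi> x y + (G (Suc 0) (\<eta> x) * hess_form \<eta> x y + G (Suc (Suc 0)) (\<eta> x) * (grad \<eta> x \<bullet> y)\<^sup>2)"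
        unfolding v_def using hess_form_add[OF U(1) \<Psi>(1) G\<eta> xU] hess_form_compose[OF G U(1) \<eta>U xU] by simp
      also have "\<dots> = hess_form \<Psi> x y + h * hess_form \<eta> x y + h * B * (y \<bullet> grad \<eta> x)\<^sup>2"
        by (simp add: G_def h_def inner_commute)
      finally have "hess_form v x y = hess_form \<Psi> x y + h * hess_form \<eta> x y + h * B * (y \<bullet> grad \<eta> x)\<^sup>2" .
      moreover have "hess_form \<Psi> x y \<ge> - (h * c * (y \<bullet> y))"
        using C(2)[OF x, of y] mult_right_mono[OF hC, of "y \<bullet> y"] by simp
      ultimately show ?thesis unfolding hess_form_def[of v, symmetric] c_def by (simp add: algebra_simps)
    qed
    note eig = eigenvals_of_Gamma_form[OF hessian_symmetric[OF U(1) v_smooth xU]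
        Gamma_form_scale[OF \<eta>(4)[OF x] h] assms(1) _ _ form]
    have cone: "eigenvals (hessian v x) \<in> Gamma_cone CARD('n) p" using eig(1) h c B by simp
    let ?\<sigma> = "elem_sym p (eigenvals (hessian v x))"
    have hp: "h ^ p = h ^ (p - 1) * h" using assms(1) by (metis Suc_pred' less_le_trans zero_less_one power_Suc2)
    have "(h * (F * g + c / 2)) ^ p \<le> h ^ p * (c ^ p + c ^ (p - 1) * (B * g\<^sup>2))"
      unfolding power_mult_distrib using key[of g] P2(2)[OF x] h by (intro mult_left_mono) (auto simp: g_def)
    also have "\<dots> = (h * c) ^ p + (h * c) ^ (p - 1) * (h * B * (grad \<eta> x \<bullet> grad \<eta> x))"
      unfolding g_def power2_norm_eq_inner power_mult_distrib distrib_left by (simp add: hp mult_ac)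
    also have "\<dots> \<le> ?\<sigma>" using eig(2) h c B by simp
    finally have pow: "(h * (F * g + c / 2)) ^ p \<le> ?\<sigma>" .
    have nn: "0 < h * (F * g + c / 2)" using h F c by (simp add: g_def add_nonneg_pos)
    have "h * (F * g + c / 2) = ((h * (F * g + c / 2)) ^ p) powr (1 / real p)"
      using nn assms(1) by (simp add: powr_realpow[symmetric] powr_powr)
    also have "\<dots> \<le> ?\<sigma> powr (1 / real p)" using pow nn by (intro powr_mono2) auto
    finally have root: "h * (F * g + c / 2) \<le> ?\<sigma> powr (1 / real p)" .
    have Geq: "G 0 (\<eta> x) = M * (exp (B * \<eta> x) - 1)" by (simp add: G_def algebra_simps)
    have expB: "exp (B * \<eta> x) \<le> 1" using \<eta>(3)[OF x] B by (simp add: mult_nonneg_nonpos)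
    have G_le: "G 0 (\<eta> x) \<le> 0" unfolding Geq using expB M(3) by (simp add: mult_nonneg_nonpos)
    have G_ge: "- M \<le> G 0 (\<eta> x)" using M(3) by (simp add: G_def)
    have v_le: "v x \<le> P0" using P0(2)[OF x] G_le by (simp add: v_def)
    have v_abs: "\<bar>v x\<bar> \<le> P0 + M" using P0(2)[OF x] G_le G_ge M(3) by (simp add: v_def)
    have "\<phi> x (v x) \<le> \<phi> x P0" using assms(14) x v_le by (simp add: monoD)
    also have "\<dots> \<le> F" using F0(2)[OF x] by (simp add: F_def)
    finally have \<phi>F: "\<phi> x (v x) \<le> F" .
    have "grad v x = grad \<Psi> x + h *\<^sub>R grad \<eta> x"
      unfolding v_def
      using grad_add[OF smooth_on_differentiable[OF \<Psi>(1) xU] smooth_on_differentiable[OF G\<eta> xU]]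
        grad_compose[OF G smooth_on_differentiable[OF \<eta>U xU], of 0] by (simp add: G_def h_def)
    then have "norm (grad v x) \<le> norm (grad \<Psi> x) + norm (h *\<^sub>R grad \<eta> x)" by (simp only: norm_triangle_ineq)
    then have gv: "norm (grad v x) \<le> P1 + h * g" using P1(2)[OF x] h by (simp add: g_def)
    have vp: "\<bar>v x\<bar> powr \<alpha> \<le> (P0 + M) powr \<alpha>" using v_abs assms(3) by (intro powr_mono2) auto
    have "\<phi> x (v x) * (1 + norm (grad v x) + \<bar>v x\<bar> powr \<alpha>) \<le> F * (1 + (P1 + h * g) + (P0 + M) powr \<alpha>)"
      using \<phi>F gv vp F by (intro mult_mono) (auto intro!: add_nonneg_nonneg)
    also have "\<dots> = (F * (1 + P1) + F * (P0 + M) powr \<alpha>) + h * (F * g)" by (simp add: algebra_simps)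
    also have "\<dots> \<le> h * (F * g + c / 2)"
    proof -
      have "(c / 2 * k) * M \<le> h * (c / 2)" using mult_right_mono[OF h_ge, of "c / 2"] c by (simp add: mult_ac)
      then show ?thesis using M(1) by (simp add: distrib_left)
    qed
    also note root
    finally show ?thesis using cone by blast
  qed
  have "smooth_near (closure \<Omega>) v"
    using v_smooth U unfolding smooth_near_def smooth_on_def by blast
  moreover have "v x = \<psi> x" if "x \<in> frontier \<Omega>" for x
    using \<eta>(2)[OF that] \<Psi>(2)[OF that] by (simp add: v_def G_def)
  ultimately show ?thesis using main by (intro exI[of _ v]) blast
qed

end
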